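(* Let $n\ge 1$. For every wooded triangulation $S\in\mathcal S_n$, the walk $\varphi(S)=Z^{\mathrm b}$ belongs to $\mathcal W_n$, and the map $\varphi:\mathcal S_n\to\mathcal W_n$ is a bijection.
   Context: **Wooded triangulations.** A planar map is an embedding of a connected planar graph in the plane, modulo orientation-preserving homeomorphism. A simple plane triangulation of size $n$ is a planar map without loops or multiple edges, all of whose faces are bounded by three edges, whose unbounded face is a triangle with outer vertices $A_{\mathrm b},A_{\mathrm g},A_{\mathrm r}$ (blue, green, red) arranged in clockwise order, and which has $n$ other (inner) vertices. The edges other than the outer edges $\overline{A_{\mathrm b}A_{\mathrm g}},\overline{A_{\mathrm g}A_{\mathrm r}},\overline{A_{\mathrm r}A_{\mathrm b}}$ are the inner edges. A 3-orientation is an orientation of the inner edges such that every inner vertex has out-degree 3. A Schnyder wood is a 3-orientation together with a coloring of the inner edges by $\mathrm b,\mathrm g,\mathrm r$ such that at each inner vertex: (i) the three outgoing edges are colored blue, green, red in clockwise cyclic order; (ii) incoming blue edges lie between the green and red outgoing edges, incoming red edges lie between the blue and green outgoing edges, and incoming green edges lie between the red and blue outgoing edges. (So the clockwise cyclic order at an inner vertex is: blue out, red in, green out, blue in, red out, green in.) Moreover all inner edges incident to $A_c$ have color $c$. $\mathcal S_n$ is the set of pairs (simple plane triangulation of size $n$, Schnyder wood on it); its elements are called wooded triangulations. The edges of color $c$ form a tree $T_c(S)$ rooted at $A_c$, with edges oriented toward the root. **The exploration path $\mathcal P_S$.** The path $\mathcal P_S$ starts in the outer face, enters through $\overline{A_{\mathrm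 r}A_{\mathrm g}}$, crosses all inner edges incident to $A_{\mathrm g}$ and exits through $\overline{A_{\mathrm g}A_{\mathrm b}}$; it re-enters through $\overline{A_{\mathrm g}A_{\mathrm b}}$, explores $T_{\mathrm b}(S)$ clockwise and exits through $\overline{A_{\mathrm b}A_{\mathrm r}}$; it re-enters through $\overline{A_{\mathrm b}A_{\mathrm r}}$, crosses the inner edges incident to $A_{\mathrm r}$ in clockwise order around $A_{\mathrm r}$ and exits through $\overline{A_{\mathrm r}A_{\mathrm g}}$. Exploring $T_{\mathrm b}$ clockwise means: start at $A_{\mathrm b}$ at $\overline{A_{\mathrm g}A_{\mathrm b}}$ and repeatedly look at the next edge in clockwise order around the current vertex; if it is red or green, cross it and stay at the current vertex; if it is blue, traverse it to its other endpoint and continue there with the edge following it clockwise; stop when $\overline{A_{\mathrm b}A_{\mathrm r}}$ is reached at $A_{\mathrm b}$. Thus each red and green inner edge is crossed twice and each blue edge is traversed twice by $\mathcal P_S$. **The walk $\varphi(S)=Z^{\mathrm b}$** on $\mathbb Z^2$ starts at $(0,0)$ and, as $\mathcal P_S$ is followed, takes a $(1,-1)$-step whenever a blue edge is traversed for the second time, a $(-1,0)$-step whenever a red edge is crossed for the second time, and a $(0,1)$-step whenever a green edge is crossed for the second time. **$\mathcal W_n$** is the set of walks on $\mathbb Z^2$ such that: (1) the walk starts and ends at $(0,0)$ and stays in the closed first quadrant; (2) it has $3n$ steps, each in $\{(0,1),(-1,0),(1,-1)\}$; (3) no $(1,-1)$-step is immediately preceded by a $(-1,0)$-step. *)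

theory Defs
  imports "HOL-Combinatorics.Orbits" "HOL-Library.Product_Plus"
begin

datatype colour = Blue | Green | Red

text \<open>
  A planar map without loops and multiple edges is encoded by its rotation system: an edge
  \<open>uv\<close> is present as the two darts \<open>(u, v)\<close> and \<open>(v, u)\<close>, and \<open>cw M v u\<close> is the neighbour of
  \<open>v\<close> whose edge follows the edge \<open>vu\<close> in clockwise order around \<open>v\<close>.  A rotation system of a
  connected graph is induced by an embedding in the sphere exactly if it satisfies Euler's
  formula, and the embedding is then unique up to orientation-preserving homeomorphism; the
  unbounded face is singled out by the three outer vertices \<open>corner M c\<close>.
\<close>

record 'v plane_map =
  verts :: "'v set"
  darts :: "('v \<times> 'v) set"
  cw :: "'v \<Rightarrow> 'v \<Rightarrow> 'v"
  corner :: "colour \<Rightarrow> 'v"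

definition nbrs :: "('v, 'z) plane_map_scheme \<Rightarrow> 'v \<Rightarrow> 'v set" where
  "nbrs M v = {u. (v, u) \<in> darts M}"

definition edges :: "('v, 'z) plane_map_scheme \<Rightarrow> 'v set set" where
  "edges M = {{u, v} |u v. (u, v) \<in> darts M}"

text \<open>
  At the head \<open>v\<close> of \<open>(u, v)\<close> the clockwise successor of the edge back to \<open>u\<close> is the sharpest
  left turn, so an orbit of \<open>face_succ M\<close> runs along the boundary of the face on the left of
  each of its darts.
\<close>

definition face_succ :: "('v, 'z) plane_map_scheme \<Rightarrow> 'v \<times> 'v \<Rightarrow> 'v \<times> 'v" where
  "face_succ M = (\<lambda>(u, v). (v, cw M v u))"

definition faces :: "('v, 'z) plane_map_scheme \<Rightarrow> ('v \<times> 'v) set set" where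
  "faces M = {orbit (face_succ M) d |d. d \<in> darts M}"

text \<open>The one-vertex map, which has no darts, is left out.\<close>

definition simple_planar_map :: "('v, 'z) plane_map_scheme \<Rightarrow> bool" where
  "simple_planar_map M \<longleftrightarrow>
     finite (verts M) \<and> verts M \<noteq> {} \<and>
     darts M \<subseteq> verts M \<times> verts M \<and> sym (darts M) \<and> irrefl (darts M) \<and>
     (\<forall>u\<in>verts M. \<forall>v\<in>verts M. (u, v) \<in> (darts M)\<^sup>*) \<and>
     (\<forall>v\<in>verts M. cyclic_on (cw M v) (nbrs M v)) \<and>
     card (verts M) + card (faces M) = card (edges M) + 2"

definition inner_verts :: "('v, 'z) plane_map_scheme \<Rightarrow> 'v set" where
  "inner_verts M = verts M - range (corner M)"

definition inner_darts :: "('v, 'z) plane_map_scheme \<Rightarrow> ('v \<times> 'v) set" where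
  "inner_darts M = darts M - {(corner M c, corner M c') |c c'. c \<noteq> c'}"

text \<open>
  The corners are in clockwise order on the outer triangle, so the unbounded face is on the
  left of the darts from blue to green, from green to red and from red to blue.
\<close>

definition simple_triangulation :: "nat \<Rightarrow> ('v, 'z) plane_map_scheme \<Rightarrow> bool" where
  "simple_triangulation n M \<longleftrightarrow>
     simple_planar_map M \<and>
     (\<forall>f\<in>faces M. card f = 3) \<and>
     {(corner M Blue, corner M Green), (corner M Green, corner M Red),
       (corner M Red, corner M Blue)} \<in> faces M \<and>
     card (inner_verts M) = n"

text \<open>
  \<open>arcs S\<close> contains each inner edge in the chosen direction only; \<open>col S\<close> is relevant on
  \<open>arcs S\<close> only.
\<close>

record 'v wooded_map = "'v plane_map" +
  arcs :: "('v \<times> 'v) set"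
  col :: "'v \<times> 'v \<Rightarrow> colour"

definition three_orientation :: "'v wooded_map \<Rightarrow> bool" where
  "three_orientation S \<longleftrightarrow>
     arcs S \<subseteq> inner_darts S \<and>
     (\<forall>(u, v)\<in>inner_darts S. (u, v) \<in> arcs S \<longleftrightarrow> (v, u) \<notin> arcs S) \<and>
     (\<forall>v\<in>inner_verts S. card {w. (v, w) \<in> arcs S} = 3)"

text \<open>The neighbours met when turning clockwise around \<open>v\<close>, strictly after \<open>x\<close> and strictly before
  \<open>y\<close>.\<close>

definition sector :: "('v, 'z) plane_map_scheme \<Rightarrow> 'v \<Rightarrow> 'v \<Rightarrow> 'v \<Rightarrow> 'v set" where
  "sector M v x y = {(cw M v ^^ i) x |i. 0 < i \<and> i < funpow_dist1 (cw M v) x y}"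

definition schnyder_at :: "'v wooded_map \<Rightarrow> 'v \<Rightarrow> bool" where
  "schnyder_at S v \<longleftrightarrow>
     (\<exists>out. {w. (v, w) \<in> arcs S} = range out \<and> (\<forall>c. col S (v, out c) = c) \<and>
        out Green \<in> sector S v (out Blue) (out Red) \<and>
        (\<forall>u. (u, v) \<in> arcs S \<longrightarrow>
           (case col S (u, v) of
              Blue \<Rightarrow> u \<in> sector S v (out Green) (out Red)
            | Red \<Rightarrow> u \<in> sector S v (out Blue) (out Green)
            | Green \<Rightarrow> u \<in> sector S v (out Red) (out Blue))))"

definition schnyder_wood :: "'v wooded_map \<Rightarrow> bool" where
  "schnyder_wood S \<longleftrightarrow>
     three_orientation S \<and> (\<forall>v\<in>inner_verts S. schnyder_at S v) \<and>
     (\<forall>(u, v)\<in>arcs S. \<forall>c. u = corner S c \<or> v = corner S c \<longrightarrow> col S (u, v) = c)"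

definition wooded_triangulation :: "nat \<Rightarrow> 'v wooded_map \<Rightarrow> bool" where
  "wooded_triangulation n S \<longleftrightarrow> simple_triangulation n S \<and> schnyder_wood S"

definition wooded_iso :: "('v \<Rightarrow> 'w) \<Rightarrow> 'v wooded_map \<Rightarrow> 'w wooded_map \<Rightarrow> bool" where
  "wooded_iso h S S' \<longleftrightarrow>
     bij_betw h (verts S) (verts S') \<and>
     (\<forall>u\<in>verts S. \<forall>v\<in>verts S. (u, v) \<in> darts S \<longleftrightarrow> (h u, h v) \<in> darts S') \<and>
     (\<forall>(v, u)\<in>darts S. h (cw S v u) = cw S' (h v) (h u)) \<and>
     (\<forall>c. h (corner S c) = corner S' c) \<and>
     (\<forall>u\<in>verts S. \<forall>v\<in>verts S. (u, v) \<in> arcs S \<longleftrightarrow> (h u, h v) \<in> arcs S') \<and>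
     (\<forall>(u, v)\<in>arcs S. col S' (h u, h v) = col S (u, v))"

text \<open>
  Every finite map has a copy with vertices in \<^typ>\<open>nat\<close>, so the isomorphism classes of those
  maps are all the wooded triangulations.
\<close>

definition same_wooded :: "nat \<Rightarrow> (nat wooded_map \<times> nat wooded_map) set" where
  "same_wooded n =
     {(S, S'). wooded_triangulation n S \<and> wooded_triangulation n S' \<and> (\<exists>h. wooded_iso h S S')}"

definition wooded_triangulations :: "nat \<Rightarrow> nat wooded_map set set" where
  "wooded_triangulations n = {S. wooded_triangulation n S} // same_wooded n"

definition edge_col :: "'v wooded_map \<Rightarrow> 'v \<times> 'v \<Rightarrow> colour" where
  "edge_col S = (\<lambda>(u, v). if (u, v) \<in> arcs S then col S (u, v) else col S (v, u))"

text \<open>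
  The exploration path is recorded as the list of darts \<open>(v, w)\<close> such that, from the current
  vertex \<open>v\<close>, the path meets the inner edge \<open>vw\<close>.
\<close>

definition iterates_until :: "('a \<Rightarrow> 'a) \<Rightarrow> 'a \<Rightarrow> 'a \<Rightarrow> 'a list" where
  "iterates_until f x y = map (\<lambda>i. (f ^^ i) x) [0..<funpow_dist f x y]"

definition turn :: "('v, 'z) plane_map_scheme \<Rightarrow> 'v \<times> 'v \<Rightarrow> 'v \<times> 'v" where
  "turn M = (\<lambda>(v, w). (v, cw M v w))"

definition explore :: "'v wooded_map \<Rightarrow> 'v \<times> 'v \<Rightarrow> 'v \<times> 'v" where
  "explore S = (\<lambda>(v, w). if edge_col S (v, w) = Blue then (w, cw S w v) else (v, cw S v w))"

definition exploration_path :: "'v wooded_map \<Rightarrow> ('v \<times> 'v) list" where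
  "exploration_path S =
     (let b = corner S Blue; g = corner S Green; r = corner S Red in
        iterates_until (turn S) (turn S (g, r)) (g, b) @
        iterates_until (explore S) (turn S (b, g)) (b, r) @
        iterates_until (turn S) (turn S (r, b)) (r, g))"

fun step_of :: "colour \<Rightarrow> int \<times> int" where
  "step_of Blue = (1, -1)"
| "step_of Red = (-1, 0)"
| "step_of Green = (0, 1)"

text \<open>\<open>count_list (take i es) (es ! i) = 1\<close> says that position \<open>i\<close> is the second visit to its edge.\<close>

definition walk_steps :: "'v wooded_map \<Rightarrow> (int \<times> int) list" where
  "walk_steps S =
     (let p = exploration_path S; es = map (\<lambda>(v, w). {v, w}) p in
        [step_of (edge_col S (p ! i)). i \<leftarrow> [0..<length p], count_list (take i es) (es ! i) = 1])"

text \<open>A walk is the list of its positions.\<close>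

definition walk_of :: "'v wooded_map \<Rightarrow> (int \<times> int) list" where
  "walk_of S = map (\<lambda>i. sum_list (take i (walk_steps S))) [0..<Suc (length (walk_steps S))]"

definition class_walk :: "nat wooded_map set \<Rightarrow> (int \<times> int) list" where
  "class_walk C = the_elem (walk_of ` C)"

definition quadrant_walks :: "nat \<Rightarrow> (int \<times> int) list set" where
  "quadrant_walks n =
     {z. length z = Suc (3 * n) \<and> z ! 0 = (0, 0) \<and> z ! (3 * n) = (0, 0) \<and>
         (\<forall>(x, y)\<in>set z. 0 \<le> x \<and> 0 \<le> y) \<and>
         (\<forall>i < 3 * n. z ! Suc i - z ! i \<in> {(0, 1), (-1, 0), (1, -1)}) \<and>
         (\<forall>i. Suc i < 3 * n \<longrightarrow>
            \<not> (z ! Suc i - z ! i = (-1, 0) \<and> z ! Suc (Suc i) - z ! Suc i = (1, -1)))}"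

lemma wooded_iso_refl: "wooded_iso id S S"
  by (auto simp: wooded_iso_def)

lemma cw_in_verts:
  assumes "simple_planar_map M" "(v, u) \<in> darts M"
  shows "u \<in> verts M" "v \<in> verts M" "(v, cw M v u) \<in> darts M" "cw M v u \<in> verts M"
proof -
  show uv: "u \<in> verts M" "v \<in> verts M"
    using assms by (auto simp: simple_planar_map_def)
  then obtain s where s: "nbrs M v = orbit (cw M v) s"
    using assms(1) unfolding simple_planar_map_def cyclic_on_def by blast
  have "u \<in> orbit (cw M v) s"
    using assms(2) s by (auto simp: nbrs_def)
  then have "cw M v u \<in> nbrs M v"
    unfolding s by (rule orbit.step)
  then show "(v, cw M v u) \<in> darts M" "cw M v u \<in> verts M"
    using assms(1) by (auto simp: nbrs_def simple_planar_map_def)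
qed

lemma wooded_iso_trans:
  assumes "simple_planar_map S" "arcs S \<subseteq> darts S" "wooded_iso h S S'" "wooded_iso k S' S''"
  shows "wooded_iso (k \<circ> h) S S''"
proof -
  have V: "bij_betw h (verts S) (verts S')" "bij_betw k (verts S') (verts S'')"
    using assms by (auto simp: wooded_iso_def)
  have im: "h u \<in> verts S'" if "u \<in> verts S" for u
    using V that by (auto dest: bij_betwE)
  have dv: "u \<in> verts S \<and> v \<in> verts S" if "(u, v) \<in> darts S" for u v
    using assms(1) that by (auto simp: simple_planar_map_def)
  have d: "(h u, h v) \<in> darts S'" if "(u, v) \<in> darts S" for u v
    using dv[OF that] that assms(3) by (auto simp: wooded_iso_def)
  have a: "(h u, h v) \<in> arcs S'" if "(u, v) \<in> arcs S" for u v
    using dv[of u v] that assms(2,3) by (auto simp: wooded_iso_def)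
  show ?thesis
    unfolding wooded_iso_def
  proof (intro conjI)
    show "bij_betw (k \<circ> h) (verts S) (verts S'')"
      using V by (rule bij_betw_trans)
    show "\<forall>u\<in>verts S. \<forall>v\<in>verts S. (u, v) \<in> darts S \<longleftrightarrow> ((k \<circ> h) u, (k \<circ> h) v) \<in> darts S''"
      "\<forall>u\<in>verts S. \<forall>v\<in>verts S. (u, v) \<in> arcs S \<longleftrightarrow> ((k \<circ> h) u, (k \<circ> h) v) \<in> arcs S''"
      "\<forall>c. (k \<circ> h) (corner S c) = corner S'' c"
      using assms(3,4) im by (auto simp: wooded_iso_def)
    show "\<forall>(v, u)\<in>darts S. (k \<circ> h) (cw S v u) = cw S'' ((k \<circ> h) v) ((k \<circ> h) u)"
      using assms(3,4) d by (fastforce simp: wooded_iso_def)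
    show "\<forall>(u, v)\<in>arcs S. col S'' ((k \<circ> h) u, (k \<circ> h) v) = col S (u, v)"
      using assms(3,4) a by (fastforce simp: wooded_iso_def)
  qed
qed

lemma wooded_iso_sym:
  assumes "simple_planar_map S" "simple_planar_map S'" "arcs S' \<subseteq> darts S'"
    and range: "range (corner S) \<subseteq> verts S" and iso: "wooded_iso h S S'"
  shows "wooded_iso (inv_into (verts S) h) S' S"
proof -
  define k where "k = inv_into (verts S) h"
  have h: "bij_betw h (verts S) (verts S')"
    using iso by (auto simp: wooded_iso_def)
  have k: "bij_betw k (verts S') (verts S)"
    unfolding k_def using h by (rule bij_betw_inv_into)
  have kv: "k u \<in> verts S" and hk: "h (k u) = u" if "u \<in> verts S'" for u
    using that k h by (auto simp: k_def bij_betw_inv_into_right dest: bij_betwE)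
  have kh: "k (h u) = u" if "u \<in> verts S" for u
    using that h by (auto simp: k_def bij_betw_inv_into_left)
  have dv: "u \<in> verts S'" "v \<in> verts S'" if "(u, v) \<in> darts S'" for u v
    using assms(2) that by (auto simp: simple_planar_map_def)
  have dd: "(u, v) \<in> darts S' \<longleftrightarrow> (k u, k v) \<in> darts S"
    and aa: "(u, v) \<in> arcs S' \<longleftrightarrow> (k u, k v) \<in> arcs S"
    if "u \<in> verts S'" "v \<in> verts S'" for u v
    using iso kv[OF that(1)] kv[OF that(2)] hk[OF that(1)] hk[OF that(2)]
    by (auto simp: wooded_iso_def)
  show ?thesis
    unfolding k_def[symmetric] wooded_iso_def
  proof (intro conjI)
    show "bij_betw k (verts S') (verts S)" by (rule k)
    show "\<forall>u\<in>verts S'. \<forall>v\<in>verts S'. (u, v) \<in> darts S' \<longleftrightarrow> (k u, k v) \<in> darts S"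
      "\<forall>u\<in>verts S'. \<forall>v\<in>verts S'. (u, v) \<in> arcs S' \<longleftrightarrow> (k u, k v) \<in> arcs S"
      using dd aa by auto
    show "\<forall>c. k (corner S' c) = corner S c"
    proof
      fix c
      have "corner S' c = h (corner S c)"
        using iso by (auto simp: wooded_iso_def)
      then show "k (corner S' c) = corner S c"
        using kh range by auto
    qed
    show "\<forall>(v, u)\<in>darts S'. k (cw S' v u) = cw S (k v) (k u)"
    proof safe
      fix v u assume vu: "(v, u) \<in> darts S'"
      then have kvu: "(k v, k u) \<in> darts S"
        using dd dv by blast
      then have "h (cw S (k v) (k u)) = cw S' (h (k v)) (h (k u))"
        using iso by (auto simp: wooded_iso_def)
      then have "h (cw S (k v) (k u)) = cw S' v u"
        using hk dv[OF vu] by simp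
      then show "k (cw S' v u) = cw S (k v) (k u)"
        using kh cw_in_verts(4)[OF assms(1) kvu] by metis
    qed
    show "\<forall>(u, v)\<in>arcs S'. col S (k u, k v) = col S' (u, v)"
    proof safe
      fix u v assume uv: "(u, v) \<in> arcs S'"
      then have d: "(u, v) \<in> darts S'"
        using assms(3) by auto
      then have "(k u, k v) \<in> arcs S"
        using aa uv dv by blast
      then have "col S' (h (k u), h (k v)) = col S (k u, k v)"
        using iso by (auto simp: wooded_iso_def)
      then show "col S (k u, k v) = col S' (u, v)"
        using hk dv[OF d] by simp
    qed
  qed
qed

lemma wooded_triangulationD:
  assumes "wooded_triangulation n S"
  shows "simple_planar_map S" "arcs S \<subseteq> darts S" "range (corner S) \<subseteq> verts S"
proof -
  show sp: "simple_planar_map S" and "arcs S \<subseteq> darts S"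
    using assms
    by (auto simp: wooded_triangulation_def simple_triangulation_def schnyder_wood_def
        three_orientation_def inner_darts_def)
  obtain d where d: "d \<in> darts S"
    and f: "{(corner S Blue, corner S Green), (corner S Green, corner S Red),
      (corner S Red, corner S Blue)} = orbit (face_succ S) d"
    using assms
    by (auto simp: wooded_triangulation_def simple_triangulation_def faces_def)
  have fs: "face_succ S e \<in> darts S" if "e \<in> darts S" for e
  proof -
    obtain u v where e: "e = (u, v)" by (cases e)
    have "(v, u) \<in> darts S"
      using sp that unfolding e simple_planar_map_def by (blast dest: symD)
    then show ?thesis
      using cw_in_verts(3)[OF sp] by (simp add: e face_succ_def)
  qed
  have "e \<in> darts S" if "e \<in> orbit (face_succ S) d" for e
    using that by (induction rule: orbit.induct) (simp_all add: fs d)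
  then have "corner S c \<in> verts S" for c
    using f sp by (cases c) (auto simp: simple_planar_map_def)
  then show "range (corner S) \<subseteq> verts S" by auto
qed

lemma equiv_same_wooded: "equiv {S. wooded_triangulation n S} (same_wooded n)"
proof (rule equivI)
  show "same_wooded n \<subseteq> {S. wooded_triangulation n S} \<times> {S. wooded_triangulation n S}"
    by (auto simp: same_wooded_def)
  show "refl_on {S. wooded_triangulation n S} (same_wooded n)"
    by (auto simp: refl_on_def same_wooded_def intro: wooded_iso_refl)
  show "sym (same_wooded n)"
  proof (rule symI)
    fix S S' assume "(S, S') \<in> same_wooded n"
    then obtain h where "wooded_triangulation n S" "wooded_triangulation n S'" "wooded_iso h S S'"
      by (auto simp: same_wooded_def)
    then show "(S', S) \<in> same_wooded n"
      using wooded_iso_sym wooded_triangulationD unfolding same_wooded_def by blast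
  qed
  show "trans (same_wooded n)"
  proof (rule transI)
    fix S S' S'' assume "(S, S') \<in> same_wooded n" "(S', S'') \<in> same_wooded n"
    then obtain h k where "wooded_triangulation n S" "wooded_triangulation n S''"
      "wooded_iso h S S'" "wooded_iso k S' S''"
      by (auto simp: same_wooded_def)
    then show "(S, S'') \<in> same_wooded n"
      using wooded_iso_trans wooded_triangulationD unfolding same_wooded_def by blast
  qed
qed

end

theory Submission
  imports Defs "HOL-Combinatorics.Cycles"
begin

text \<open>
  In a walk of \<open>quadrant_walks n\<close> a run of red steps is followed by a green step or by nothing,
  because red must not directly precede blue.  The word of its steps therefore falls uniquely into
  moves: \<open>Attach a\<close> is a run of \<open>a\<close> red steps together with the green step behind it, \<open>Retreat\<close> is a
  blue step, and the red steps left over stand at the end.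

  The moves are instructions for building a triangulation from the edge between \<open>A\<^sub>b\<close> and \<open>A\<^sub>g\<close> by adding
  the inner vertices in the order in which the contour of the blue tree first meets them.  The part
  built so far is bounded by this edge and by a path from \<open>A\<^sub>b\<close> to \<open>A\<^sub>g\<close>, its front.  The front consists
  of the spine, which is the blue branch from \<open>A\<^sub>b\<close> to the current vertex, followed by the stack of those
  vertices which the contour has left and which still lack their red arc, with \<open>A\<^sub>g\<close> at its bottom.
  \<open>Attach a\<close> adds a vertex with a blue arc to the current vertex, with red arcs from the \<open>a\<close> topmost
  stack vertices, which are thereby covered, and with a green arc to the stack vertex below them; the
  new vertex becomes the current one.  \<open>Retreat\<close> moves the current vertex from the spine to the stack.
  In the end \<open>A\<^sub>r\<close> is joined to the whole front.  The walk is at \<open>(x, y)\<close> when the stack has \<open>x\<close> vertices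
  besides \<open>A\<^sub>g\<close> and the spine has \<open>y\<close> vertices besides \<open>A\<^sub>b\<close>, so staying in the quadrant means that each
  move can be carried out.

  Every sequence of moves builds a wooded triangulation.  Attaching a vertex adds triangles along a
  segment of the front, and the condition that all faces are triangles is local: it says that
  \<open>cw (cw v u) v = u\<close> for all darts \<open>(v, u)\<close> and passes from each stage to the next (\<open>nxt_attach\<close>,
  \<open>building_attach\<close>).  Three arcs at each of the \<open>n\<close> inner vertices make \<open>3 n + 3\<close> edges and \<open>2 n + 2\<close>
  faces, which is Euler's formula.

  Conversely, every wooded triangulation \<open>S\<close> is built in this way (\<open>moves_exist\<close>).  Euler's formula
  shows that the corners have no outgoing arcs.  While a part of \<open>S\<close> has been built, the next edge
  clockwise around the current vertex is its outgoing red arc, which calls for \<open>Retreat\<close>, or an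
  incoming blue arc, whose tail is the next vertex to attach, or it joins \<open>A\<^sub>b\<close> to \<open>A\<^sub>r\<close>, which ends the
  construction.  Schnyder's rule at the new vertex, together with the triangles of \<open>S\<close>, forces its
  neighbours on the front to be consecutive (\<open>fan\<close>).  A vertex has only one
  outgoing blue arc, so the new vertex has not been used before (\<open>z_new\<close>); hence the construction ends,
  and it exhausts \<open>S\<close> because \<open>S\<close> is connected.

  Finally the exploration path of a built map is followed move by move.  The edges that it meets for
  the second time during \<open>Attach a\<close> are the \<open>a\<close> new red edges and the new green one, and during
  \<open>Retreat\<close> only the blue edge to the parent (\<open>contour_second_visits\<close>).  Thus the walk of a wooded
  triangulation spells the moves that build it, and it determines the triangulation up to isomorphism.
\<close>

section \<open>Quadrant walks and sequences of moves\<close>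

text \<open>
  \<open>Attach a\<close> stands for \<open>a\<close> red steps and the green step that follows them, \<open>Retreat\<close> for a blue step.
\<close>

datatype move = Attach nat | Retreat

text \<open>
  The arguments \<open>x\<close> and \<open>y\<close> are the coordinates of the walk before the moves.  After them only red
  steps remain, so the second coordinate has to be zero by then.
\<close>

fun fits :: "nat \<Rightarrow> nat \<Rightarrow> move list \<Rightarrow> bool" where
  "fits x y [] \<longleftrightarrow> y = 0"
| "fits x y (Attach a # ms) \<longleftrightarrow> a \<le> x \<and> fits (x - a) (Suc y) ms"
| "fits x y (Retreat # ms) \<longleftrightarrow> 0 < y \<and> fits (Suc x) (y - 1) ms"

fun word :: "nat \<Rightarrow> move list \<Rightarrow> colour list" where
  "word x [] = replicate x Red"
| "word x (Attach a # ms) = replicate a Red @ Green # word (x - a) ms"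
| "word x (Retreat # ms) = Blue # word (Suc x) ms"

fun legal :: "nat \<Rightarrow> nat \<Rightarrow> colour list \<Rightarrow> bool" where
  "legal x y [] \<longleftrightarrow> x = 0 \<and> y = 0"
| "legal x y (Green # w) \<longleftrightarrow> legal x (Suc y) w"
| "legal x y (Blue # w) \<longleftrightarrow> 0 < y \<and> legal (Suc x) (y - 1) w"
| "legal x y (Red # w) \<longleftrightarrow> 0 < x \<and> legal (x - 1) y w \<and> (w = [] \<or> hd w \<noteq> Blue)"

lemma legal_replicate: "legal (x + a) y (replicate a Red @ w) \<longleftrightarrow> legal x y w"
  if "w = [] \<or> hd w \<noteq> Blue"
  using that by (induction a) (auto simp: neq_Nil_conv Cons_replicate_eq hd_append)

lemma legal_word: "fits x y ms \<Longrightarrow> legal x y (word x ms)"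
proof (induction x y ms rule: fits.induct)
  case (1 x y)
  then show ?case using legal_replicate[of "[]" 0 x 0] by simp
next
  case (2 x y a ms)
  then show ?case using legal_replicate[of "Green # word (x - a) ms" "x - a" a y] by simp
qed simp_all

text \<open>
  The last red letter of a run can be added to the \<open>Attach\<close> behind it or to the final run; a \<open>Retreat\<close>
  behind it is what the ban on red before blue excludes.
\<close>

lemma legal_is_word: "legal x y w \<Longrightarrow> \<exists>ms. fits x y ms \<and> word x ms = w"
proof (induction x y w rule: legal.induct)
  case (1 x y)
  then show ?case by (intro exI[of _ "[]"]) simp
next
  case (2 x y w)
  then obtain ms where "fits x (Suc y) ms" "word x ms = w" by auto
  then show ?case by (intro exI[of _ "Attach 0 # ms"]) simp
next
  case (3 x y w)
  then obtain ms where "fits (Suc x) (y - 1) ms" "word (Suc x) ms = w" by auto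
  with 3 show ?case by (intro exI[of _ "Retreat # ms"]) simp
next
  case (4 x y w)
  then obtain ms where ms: "fits (x - 1) y ms" "word (x - 1) ms = w" and x: "0 < x" by auto
  show ?case
  proof (cases ms)
    case Nil
    then show ?thesis
      using ms x by (intro exI[of _ "[]"]) (cases x; simp)
  next
    case (Cons m ms')
    show ?thesis
    proof (cases m)
      case (Attach a)
      then show ?thesis
        using ms x Cons by (intro exI[of _ "Attach (Suc a) # ms'"]) auto
    next
      case Retreat
      then show ?thesis using 4 ms Cons by auto
    qed
  qed
qed

lemma replicate_Green_eq:
  "replicate a Red @ Green # u = replicate b Red @ Green # v \<longleftrightarrow> a = b \<and> u = v"
proof (induction a arbitrary: b)
  case 0 then show ?case by (cases b) auto
next
  case (Suc a) then show ?case by (cases b) auto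
qed

lemma replicate_Green_neq:
  "replicate a Red @ Green # u \<noteq> replicate b Red"
  "replicate a Red @ Green # u \<noteq> Blue # v"
proof -
  show "replicate a Red @ Green # u \<noteq> replicate b Red"
  proof
    assume "replicate a Red @ Green # u = replicate b Red"
    then have "Green \<in> set (replicate b Red)"
      by (metis in_set_conv_decomp)
    then show False by simp
  qed
  show "replicate a Red @ Green # u \<noteq> Blue # v"
    by (cases a) auto
qed

lemma word_inject: "word x ms = word x ms' \<longleftrightarrow> ms = ms'"
proof (induction x ms arbitrary: ms' rule: word.induct)
  case (1 x)
  show ?case
    using replicate_Green_neq(1)[of _ _ x]
    by (cases "(x, ms')" rule: word.cases) (auto simp: Cons_replicate_eq dest: sym)
next
  case (2 x a ms)
  then show ?case
    by (cases "(x, ms')" rule: word.cases) (auto simp: replicate_Green_eq replicate_Green_neq)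
next
  case (3 x ms)
  then show ?case
    by (cases "(x, ms')" rule: word.cases)
      (auto simp: replicate_Green_neq[symmetric] Cons_replicate_eq dest: sym)
qed

lemma legal_length: "legal x y w \<Longrightarrow> length w = 3 * count_list w Green + 2 * y + x"
  by (induction x y w rule: legal.induct) auto

fun attachments :: "move list \<Rightarrow> nat" where
  "attachments [] = 0"
| "attachments (Attach a # ms) = Suc (attachments ms)"
| "attachments (Retreat # ms) = attachments ms"

lemma count_word: "count_list (word x ms) Green = attachments ms"
proof -
  have "count_list (replicate a Red) Green = 0" for a by (induction a) auto
  then show ?thesis
    by (induction x ms rule: word.induct) auto
qed

fun walk_from :: "int \<times> int \<Rightarrow> colour list \<Rightarrow> (int \<times> int) list" where
  "walk_from z [] = [z]"
| "walk_from z (c # w) = z # walk_from (z + step_of c) w"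

lemma length_walk_from [simp]: "length (walk_from z w) = Suc (length w)"
  by (induction z w rule: walk_from.induct) auto

lemma hd_walk_from [simp]: "hd (walk_from z w) = z" and walk_from_neq [simp]: "walk_from z w \<noteq> []"
  by (cases w; simp)+

lemma walk_from_sums:
  "walk_from z w = map (\<lambda>i. z + sum_list (take i (map step_of w))) [0..<Suc (length w)]"
proof (induction z w rule: walk_from.induct)
  case (2 z c w)
  have "[0..<Suc (length (c # w))] = 0 # map Suc [0..<Suc (length w)]"
    by (simp only: map_Suc_upt) (simp add: upt_rec[of 0] Suc_le_eq)
  then show ?case
    unfolding walk_from.simps 2 by (simp add: o_def add.assoc del: upt_Suc)
qed auto

lemma step_of_inject: "step_of c = step_of c' \<longleftrightarrow> c = c'"
  by (cases c; cases c') auto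

lemma range_step_of: "range step_of = {(0, 1), (-1, 0), (1, -1)}"
proof -
  have UNIV: "(UNIV :: colour set) = {Blue, Green, Red}"
    using colour.exhaust by auto
  show ?thesis
    unfolding UNIV by auto
qed

lemma walk_from_steps:
  "i < length w \<Longrightarrow> walk_from z w ! Suc i - walk_from z w ! i = step_of (w ! i)"
proof (induction z w arbitrary: i rule: walk_from.induct)
  case (2 z c w)
  show ?case
  proof (cases i)
    case 0
    then show ?thesis
      using hd_conv_nth[OF walk_from_neq, of "z + step_of c" w] by simp
  next
    case (Suc j)
    then show ?thesis using 2 by simp
  qed
qed simp

lemma walk_from_inject: "walk_from z w = walk_from z w' \<longleftrightarrow> w = w'"
proof (induction z w arbitrary: w' rule: walk_from.induct)
  case (1 z) then show ?case by (cases w') (auto dest: sym)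
next
  case (2 z c w)
  show ?case
  proof (cases w')
    case (Cons d v)
    have "step_of c = step_of d" if "walk_from (z + step_of c) w = walk_from (z + step_of d) v"
      using arg_cong[OF that, of hd] by simp
    then show ?thesis using Cons 2 step_of_inject by auto
  qed auto
qed

lemma unit_steps_walk_from:
  assumes "zs \<noteq> []" "\<And>i. Suc i < length zs \<Longrightarrow> zs ! Suc i - zs ! i \<in> range step_of"
  shows "\<exists>w. zs = walk_from (hd zs) w"
  using assms
proof (induction zs)
  case (Cons z zs)
  show ?case
  proof (cases zs)
    case Nil
    then show ?thesis by (intro exI[of _ "[]"]) simp
  next
    case (Cons z' zs')
    have "zs ! Suc i - zs ! i \<in> range step_of" if "Suc i < length zs" for i
      using Cons.prems(2)[of "Suc i"] that by simp
    then obtain w where w: "zs = walk_from (hd zs) w"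
      using Cons.IH Cons by auto
    have "(z # zs) ! Suc 0 - (z # zs) ! 0 \<in> range step_of"
      by (rule Cons.prems(2)) (simp add: Cons)
    then obtain c where "z' - z = step_of c" using Cons by auto
    then have "z' = z + step_of c" by (metis add_diff_cancel_left' diff_add_cancel add.commute)
    then show ?thesis using w Cons by (intro exI[of _ "c # w"]) auto
  qed
qed simp

text \<open>
  A step out of the quadrant shows up at the head of the remaining walk.
\<close>

lemma legal_iff_walk_from:
  "legal x y w \<longleftrightarrow>
     (\<forall>(a, b)\<in>set (walk_from (int x, int y) w). 0 \<le> a \<and> 0 \<le> b) \<and>
     last (walk_from (int x, int y) w) = (0, 0) \<and>
     (\<forall>i. Suc i < length w \<longrightarrow> \<not> (w ! i = Red \<and> w ! Suc i = Blue))"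
proof (induction x y w rule: legal.induct)
  case (2 x y w)
  have "(\<forall>i. Suc i < length (Green # w) \<longrightarrow> \<not> ((Green # w) ! i = Red \<and> (Green # w) ! Suc i = Blue))
    \<longleftrightarrow> (\<forall>i. Suc i < length w \<longrightarrow> \<not> (w ! i = Red \<and> w ! Suc i = Blue))"
    by (auto simp: nth_Cons split: nat.splits)
  then show ?case using 2 by (simp add: add.commute)
next
  case (3 x y w)
  have *: "(\<forall>i. Suc i < length (Blue # w) \<longrightarrow> \<not> ((Blue # w) ! i = Red \<and> (Blue # w) ! Suc i = Blue))
    \<longleftrightarrow> (\<forall>i. Suc i < length w \<longrightarrow> \<not> (w ! i = Red \<and> w ! Suc i = Blue))"
    by (auto simp: nth_Cons split: nat.splits)
  show ?case
  proof (cases "0 < y")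
    case True
    then have "(int x, int y) + step_of Blue = (int (Suc x), int (y - 1))" by auto
    then show ?thesis using 3 * True by (simp add: add.commute)
  next
    case False
    have "(int x + 1, -1) \<in> set (walk_from (int x + 1, -1) w)"
      by (metis hd_in_set hd_walk_from walk_from_neq)
    then show ?thesis using False by (auto intro!: bexI[of _ "(int x + 1, -1)"])
  qed
next
  case (4 x y w)
  have *: "(\<forall>i. Suc i < length (Red # w) \<longrightarrow> \<not> ((Red # w) ! i = Red \<and> (Red # w) ! Suc i = Blue))
    \<longleftrightarrow> (w = [] \<or> hd w \<noteq> Blue) \<and> (\<forall>i. Suc i < length w \<longrightarrow> \<not> (w ! i = Red \<and> w ! Suc i = Blue))"
    by (cases w) (auto simp: nth_Cons split: nat.splits)
  show ?case
  proof (cases "0 < x")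
    case True
    then have "(int x, int y) + step_of Red = (int (x - 1), int y)" by auto
    then show ?thesis using 4 * True by auto
  next
    case False
    have "(-1, int y) \<in> set (walk_from (-1, int y) w)"
      by (metis hd_in_set hd_walk_from walk_from_neq)
    then show ?thesis using False by (auto intro!: bexI[of _ "(-1, int y)"])
  qed
qed auto

lemma quadrant_walks_legal:
  "quadrant_walks n = walk_from (0, 0) ` {w. legal 0 0 w \<and> count_list w Green = n}"
proof safe
  fix zs assume zs: "zs \<in> quadrant_walks n"
  then have len: "length zs = Suc (3 * n)" and start: "zs ! 0 = (0, 0)" and fin: "zs ! (3 * n) = (0, 0)"
    and quad: "\<forall>(x, y)\<in>set zs. 0 \<le> x \<and> 0 \<le> y"
    and steps: "\<And>i. i < 3 * n \<Longrightarrow> zs ! Suc i - zs ! i \<in> {(0, 1), (-1, 0), (1, -1)}"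
    and noRB: "\<And>i. Suc i < 3 * n \<Longrightarrow>
      \<not> (zs ! Suc i - zs ! i = (-1, 0) \<and> zs ! Suc (Suc i) - zs ! Suc i = (1, -1))"
    by (auto simp: quadrant_walks_def)
  have "hd zs = (0, 0)" using start len by (cases zs) auto
  then obtain w where w: "zs = walk_from (0, 0) w"
    using unit_steps_walk_from[of zs] steps len unfolding range_step_of by fastforce
  have lw: "length w = 3 * n" using len w by simp
  have "\<not> (w ! i = Red \<and> w ! Suc i = Blue)" if "Suc i < length w" for i
    using noRB[of i] that lw walk_from_steps[of i w "(0,0)"] walk_from_steps[of "Suc i" w "(0,0)"]
    by (auto simp: w)
  moreover have "last (walk_from (0, 0) w) = (0, 0)"
    using fin len w by (simp add: last_conv_nth)
  ultimately have leg: "legal 0 0 w"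
    using quad w by (auto simp: legal_iff_walk_from[of 0 0])
  then show "zs \<in> walk_from (0, 0) ` {w. legal 0 0 w \<and> count_list w Green = n}"
    using w legal_length[OF leg] lw by auto
next
  fix w assume leg: "legal 0 0 w"
  have lw: "length w = 3 * count_list w Green" using legal_length[OF leg] by simp
  have "walk_from (0, 0) w ! length w = (0, 0)"
    using leg by (simp add: legal_iff_walk_from[of 0 0] last_conv_nth)
  moreover have "walk_from (0, 0) w ! 0 = (0, 0)"
    by (simp flip: hd_conv_nth[OF walk_from_neq])
  moreover have "step_of c \<in> {(0, 1), (-1, 0), (1, -1)}" for c
    using range_step_of by blast
  moreover have "w ! i \<noteq> Red \<or> w ! Suc i \<noteq> Blue" if "Suc i < length w" for i
    using leg that by (auto simp: legal_iff_walk_from[of 0 0])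
  moreover have "step_of c = (-1, 0) \<longleftrightarrow> c = Red" "step_of c = (1, -1) \<longleftrightarrow> c = Blue" for c
    by (cases c; simp)+
  ultimately show "walk_from (0, 0) w \<in> quadrant_walks (count_list w Green)"
    using leg unfolding quadrant_walks_def
    by (auto simp: lw[symmetric] walk_from_steps legal_iff_walk_from[of 0 0])
qed

section \<open>Lists as cycles\<close>

definition consec :: "'a list \<Rightarrow> 'a \<Rightarrow> 'a \<Rightarrow> bool" where
  "consec l x y \<longleftrightarrow> (\<exists>as bs. l = as @ x # y # bs)"

lemma consec_Nil [simp]: "\<not> consec [] x y"
  by (simp add: consec_def)

lemma consec_Cons: "consec (z # l) x y \<longleftrightarrow> (l \<noteq> [] \<and> x = z \<and> y = hd l) \<or> consec l x y"
proof
  assume "consec (z # l) x y"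
  then obtain as bs where "z # l = as @ x # y # bs" by (auto simp: consec_def)
  then show "(l \<noteq> [] \<and> x = z \<and> y = hd l) \<or> consec l x y"
    by (cases as) (auto simp: consec_def)
next
  assume "(l \<noteq> [] \<and> x = z \<and> y = hd l) \<or> consec l x y"
  then show "consec (z # l) x y"
  proof
    assume "l \<noteq> [] \<and> x = z \<and> y = hd l"
    then have "z # l = [] @ x # y # tl l" by simp
    then show ?thesis unfolding consec_def by blast
  next
    assume "consec l x y"
    then obtain as bs where "z # l = (z # as) @ x # y # bs" by (auto simp: consec_def)
    then show ?thesis unfolding consec_def by blast
  qed
qed

lemma consec_append:
  "consec (l @ l') x y \<longleftrightarrow> consec l x y \<or> consec l' x y \<or> (l \<noteq> [] \<and> l' \<noteq> [] \<and> x = last l \<and> y = hd l')"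
  by (induction l) (auto simp: consec_Cons hd_append)

lemma consec_set: "consec l x y \<Longrightarrow> x \<in> set l \<and> y \<in> set l"
  by (auto simp: consec_def)

lemma not_consec_hd: "distinct l \<Longrightarrow> \<not> consec l x (hd l)"
  by (cases l) (auto simp: consec_Cons dest: consec_set)

lemma consec_unique:
  assumes "distinct l" "consec l x y"
  shows "consec l x z \<longleftrightarrow> z = y" "consec l z y \<longleftrightarrow> z = x"
proof -
  have "consec l x z \<Longrightarrow> z = y" "consec l z y \<Longrightarrow> z = x" for z
    using assms
    by (induction l) (auto simp: consec_Cons not_consec_hd dest: consec_set)
  then show "consec l x z \<longleftrightarrow> z = y" "consec l z y \<longleftrightarrow> z = x"
    using assms by blast+
qed

lemma consec_succ: "x \<in> set l \<Longrightarrow> x = last l \<or> (\<exists>y. consec l x y)"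
  by (induction l) (auto simp: consec_Cons)

lemma consec_pred: "x \<in> set l \<Longrightarrow> x = hd l \<or> (\<exists>y. consec l y x)"
proof (induction l)
  case (Cons z l)
  then show ?case by (cases l) (auto simp: consec_Cons)
qed simp

lemma not_consec_last: "distinct l \<Longrightarrow> \<not> consec l (last l) y"
  by (induction l) (auto simp: consec_Cons)

lemma cycle_of_list_nth:
  assumes "distinct l" "i < length l"
  shows "(cycle_of_list l ^^ k) (l ! i) = l ! ((k + i) mod length l)"
proof -
  have "(cycle_of_list l ^^ k) (l ! i) = map (cycle_of_list l ^^ k) l ! i"
    using assms by simp
  then show ?thesis
    using assms by (simp add: cyclic_rotation nth_rotate)
qed

lemma cycle_of_list_consec:
  assumes "distinct l" "consec l x y"
  shows "cycle_of_list l x = y"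
proof -
  obtain as bs where l: "l = as @ x # y # bs"
    using assms by (auto simp: consec_def)
  then have "cycle_of_list l (l ! length as) = l ! (Suc (length as) mod length l)"
    using cycle_of_list_nth[OF assms(1), of "length as" 1] by simp
  then show ?thesis by (simp add: l nth_append)
qed

lemma cycle_of_list_last:
  assumes "distinct l" "l \<noteq> []"
  shows "cycle_of_list l (last l) = hd l"
  using cycle_of_list_nth[OF assms(1), of "length l - 1" 1] assms(2)
  by (simp add: last_conv_nth hd_conv_nth)

lemma cyclic_on_cycle_of_list:
  assumes "distinct l" "l \<noteq> []"
  shows "cyclic_on (cycle_of_list l) (set l)"
proof -
  have f: "(cycle_of_list l ^^ k) (hd l) = l ! (k mod length l)" for k
    using cycle_of_list_nth[OF assms(1), of 0 k] assms(2) by (simp add: hd_conv_nth)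
  have "orbit (cycle_of_list l) (hd l) = set l"
  proof
    show "orbit (cycle_of_list l) (hd l) \<subseteq> set l"
      using assms(2) by (auto simp: orbit_altdef f)
    show "set l \<subseteq> orbit (cycle_of_list l) (hd l)"
    proof
      fix x assume "x \<in> set l"
      then obtain i where "i < length l" "x = l ! i" by (auto simp: in_set_conv_nth)
      then have "x = (cycle_of_list l ^^ (i + length l)) (hd l)" by (simp add: f)
      then show "x \<in> orbit (cycle_of_list l) (hd l)"
        using assms(2) unfolding orbit_altdef by blast
    qed
  qed
  then show ?thesis
    using assms(2) unfolding cyclic_on_def by (metis hd_in_set)
qed

lemma cycle_of_list_swap:
  "distinct (as @ bs) \<Longrightarrow> cycle_of_list (as @ bs) = cycle_of_list (bs @ as)"
  using cycle_of_list_rotate_independent[of "as @ bs" "length as"] by (simp add: rotate_append)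

text \<open>
  Any rotation of the list describes the same cycle, so the list may be taken to start with \<open>x\<close>.
\<close>

lemma sector_cycle_of_list:
  assumes cw: "cw M v = cycle_of_list l" and l: "l = x # bs @ y # cs" and d: "distinct l"
  shows "sector M v x y = set bs"
proof -
  define f where "f = cycle_of_list l"
  have f: "(f ^^ k) x = l ! (k mod length l)" for k
    using cycle_of_list_nth[OF d, of 0 k] by (simp add: l f_def)
  have y: "l ! Suc (length bs) = y" by (simp add: l)
  have "funpow_dist f (f x) y = length bs"
    unfolding funpow_dist_def
  proof (rule Least_equality)
    have "(f ^^ Suc (length bs)) x = y"
      unfolding f using y by (simp add: l)
    then show "(f ^^ length bs) (f x) = y" by (simp add: funpow_swap1)
    fix k assume "(f ^^ k) (f x) = y"
    then have k: "l ! (Suc k mod length l) = y"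
      using f[of "Suc k"] by (simp add: funpow_swap1)
    show "length bs \<le> k"
    proof (rule ccontr)
      assume "\<not> length bs \<le> k"
      then have "l ! Suc k = y" "Suc k < Suc (length bs)" "Suc (length bs) < length l"
        using k by (auto simp: l)
      then show False
        using y d nth_eq_iff_index_eq[OF d, of "Suc k" "Suc (length bs)"] by simp
    qed
  qed
  then have "sector M v x y = {l ! i |i. 0 < i \<and> i < Suc (length bs)}"
    unfolding sector_def cw f_def[symmetric] f by (intro Collect_cong ex_cong1) (auto simp: l)
  also have "\<dots> = {bs ! j |j. j < length bs}"
  proof safe
    fix i assume "0 < i" "i < Suc (length bs)"
    then show "\<exists>j. l ! i = bs ! j \<and> j < length bs"
      by (intro exI[of _ "i - 1"]) (auto simp: l nth_append)
  next
    fix j assume "j < length bs"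
    then show "\<exists>i. bs ! j = l ! i \<and> 0 < i \<and> i < Suc (length bs)"
      by (intro exI[of _ "Suc j"]) (auto simp: l nth_append)
  qed
  also have "\<dots> = set bs" by (simp add: set_conv_nth)
  finally show ?thesis .
qed

section \<open>Rotation systems and their triangular faces\<close>

lemma UNIV_colour: "(UNIV :: colour set) = {Blue, Green, Red}"
  using colour.exhaust by auto

lemma finite_colour [simp]: "finite (A :: colour set)"
  by (rule finite_subset[OF subset_UNIV]) (simp add: UNIV_colour)

lemma ex_colour: "(\<exists>c. P c) \<longleftrightarrow> P Blue \<or> P Green \<or> P Red"
  by (metis colour.exhaust)

text \<open>
  The part of \<^const>\<open>simple_planar_map\<close> that does not involve counting or connectedness; it is available
  for a map whose Euler characteristic is still to be computed.
\<close>

locale rotation_system =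
  fixes M :: "('v, 'z) plane_map_scheme"
  assumes finite_verts: "finite (verts M)"
    and darts_verts: "darts M \<subseteq> verts M \<times> verts M"
    and sym_darts: "(u, v) \<in> darts M \<Longrightarrow> (v, u) \<in> darts M"
    and irrefl_darts: "(v, v) \<notin> darts M"
    and cyclic_cw: "v \<in> verts M \<Longrightarrow> cyclic_on (cw M v) (nbrs M v)"
begin

lemma finite_darts: "finite (darts M)"
  using finite_subset[OF darts_verts] finite_verts by blast

lemma cw_dart: "(v, u) \<in> darts M \<Longrightarrow> (v, cw M v u) \<in> darts M"
  using cyclic_on_inI[OF cyclic_cw, of v u] darts_verts by (auto simp: nbrs_def)

lemma cw_inj:
  assumes "(v, x) \<in> darts M" "(v, y) \<in> darts M" "cw M v x = cw M v y"
  shows "x = y"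
proof -
  have v: "v \<in> verts M" using assms darts_verts by auto
  have "inj_on (cw M v) (nbrs M v)"
  proof (rule eq_card_imp_inj_on)
    show fin: "finite (nbrs M v)" using finite_cyclic_on[OF cyclic_cw[OF v]] .
    have "cw M v ` nbrs M v = nbrs M v"
    proof
      show "cw M v ` nbrs M v \<subseteq> nbrs M v"
        using cw_dart by (auto simp: nbrs_def)
      show "nbrs M v \<subseteq> cw M v ` nbrs M v"
      proof
        fix z assume z: "z \<in> nbrs M v"
        then have o: "orbit (cw M v) z = nbrs M v"
          using cyclic_cw[OF v] orbit_cyclic_eq3 by metis
        then have "z \<in> orbit (cw M v) z" using z by simp
        then show "z \<in> cw M v ` nbrs M v"
          by (cases rule: orbit.cases) (use o z in auto)
      qed
    qed
    then show "card (cw M v ` nbrs M v) = card (nbrs M v)" by simp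
  qed
  then show ?thesis using assms by (auto simp: nbrs_def inj_on_def)
qed

lemma face_succ_darts: "d \<in> darts M \<Longrightarrow> face_succ M d \<in> darts M"
  using sym_darts cw_dart by (cases d) (auto simp: face_succ_def)

lemma inj_on_face_succ: "inj_on (face_succ M) (darts M)"
proof (rule inj_onI)
  fix d e assume de: "d \<in> darts M" "e \<in> darts M" "face_succ M d = face_succ M e"
  obtain u v u' v' where *: "d = (u, v)" "e = (u', v')" by (cases d; cases e) auto
  with de(3) have "v' = v" "cw M v u = cw M v u'" by (auto simp: face_succ_def)
  then show "d = e" using de(1,2) cw_inj[of v u u'] sym_darts by (auto simp: *)
qed

lemma cyclic_on_face:
  assumes "d \<in> darts M"
  shows "cyclic_on (face_succ M) (orbit (face_succ M) d)" "orbit (face_succ M) d \<subseteq> darts M"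
    and in_own_face: "d \<in> orbit (face_succ M) d"
proof -
  let ?f = "face_succ M" and ?g = "perm_restrict (face_succ M) (darts M)"
  have "?f ` darts M = darts M"
    using finite_darts inj_on_face_succ face_succ_darts by (intro endo_inj_surj) auto
  then have "bij_betw ?f (darts M) (darts M)" using inj_on_face_succ by (simp add: bij_betw_def)
  then have "bij_betw ?g (darts M) (darts M)"
    by (subst bij_betw_cong[of _ _ ?f]) (simp_all add: perm_restrict_simps)
  then have g: "?g permutes darts M"
    by (rule bij_imp_permutes) (simp add: perm_restrict_simps)
  have o: "orbit ?f e = orbit ?g e" if "e \<in> darts M" for e
    using that face_succ_darts by (intro orbit_cong0[of _ "darts M"]) (auto simp: perm_restrict_simps)
  show sub: "orbit ?f d \<subseteq> darts M"
    unfolding o[OF assms] using g assms by (rule permutes_orbit_subset)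
  have c: "cyclic_on ?g (orbit ?g d)" using cyclic_on_orbit[OF g finite_darts] .
  have e: "cyclic_on ?g (orbit ?f d) = cyclic_on ?f (orbit ?f d)"
    using sub by (intro cyclic_cong) (auto simp: perm_restrict_simps)
  show "cyclic_on ?f (orbit ?f d)" using c e o[OF assms] by simp
  show "d \<in> orbit ?f d"
    unfolding o[OF assms] using g finite_darts
    by (intro permutation_self_in_orbit) (auto simp: permutation_permutes)
qed

lemma card_faces:
  assumes "\<forall>f\<in>faces M. card f = 3"
  shows "card (darts M) = 3 * card (faces M)"
proof -
  have U: "\<Union>(faces M) = darts M"
    unfolding faces_def using cyclic_on_face(2) in_own_face by blast
  have "3 * card (faces M) = card (\<Union>(faces M))"
  proof (rule card_partition)
    show "finite (\<Union>(faces M))" using U finite_darts by simp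
    then show "finite (faces M)" by (rule finite_UnionD)
    show "\<And>c. c \<in> faces M \<Longrightarrow> card c = 3" using assms by auto
    fix c1 c2 assume c: "c1 \<in> faces M" "c2 \<in> faces M" "c1 \<noteq> c2"
    have "cyclic_on (face_succ M) c1" "cyclic_on (face_succ M) c2"
      using c cyclic_on_face by (auto simp: faces_def)
    then show "c1 \<inter> c2 = {}" using c(3) orbit_cyclic_eq3 by (metis disjoint_iff)
  qed
  then show ?thesis using U by simp
qed

lemma card_edges: "card (darts M) = 2 * card (edges M)"
proof -
  let ?e = "\<lambda>(u, v). {u, v}"
  have e: "edges M = ?e ` darts M" by (auto simp: edges_def image_def)
  have "card {d \<in> darts M. ?e d = s} = 2" if s: "s \<in> edges M" for s
  proof -
    obtain u v where uv: "s = {u, v}" "(u, v) \<in> darts M" using s unfolding edges_def by blast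
    then have "{d \<in> darts M. ?e d = s} = {(u, v), (v, u)}"
      using sym_darts by (auto simp: doubleton_eq_iff)
    moreover have "u \<noteq> v" using uv irrefl_darts by auto
    ultimately show ?thesis by simp
  qed
  then have "(\<Sum>s\<in>?e ` darts M. \<Sum>d\<in>{d \<in> darts M. ?e d = s}. 1::nat) = (\<Sum>s\<in>edges M. 2)"
    by (simp add: e)
  then show ?thesis
    using sum.image_gen[OF finite_darts, of "\<lambda>_. 1::nat" ?e] by simp
qed

text \<open>
  The face to the left of \<open>(u, v)\<close> continues with \<open>(v, x)\<close> and \<open>(x, cw M x v)\<close>, where \<open>x = cw M v u\<close>.  It
  closes after three darts exactly if \<open>cw M x v = u\<close>, a condition that involves two vertices only.
\<close>

lemma faces_triangles_iff:
  "(\<forall>f\<in>faces M. card f = 3) \<longleftrightarrow> (\<forall>(v, u)\<in>darts M. cw M (cw M v u) v = u)"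
proof
  assume 3: "\<forall>f\<in>faces M. card f = 3"
  show "\<forall>(v, u)\<in>darts M. cw M (cw M v u) v = u"
  proof safe
    fix v u assume "(v, u) \<in> darts M"
    then have d: "(u, v) \<in> darts M" by (rule sym_darts)
    let ?f = "face_succ M" and ?d = "(u, v)"
    have "card ((\<lambda>n. (?f ^^ n) ?d) ` {0..<funpow_dist1 ?f ?d ?d}) = 3"
      using 3 d unfolding orbit_conv_funpow_dist1[OF in_own_face[OF d], symmetric]
      by (auto simp: faces_def)
    then have "funpow_dist1 ?f ?d ?d = 3"
      using card_image[OF inj_on_funpow_dist1[OF in_own_face[OF d]]] by simp
    then have "(?f ^^ 3) ?d = ?d"
      using funpow_dist1_prop[OF in_own_face[OF d]] by metis
    then show "cw M (cw M v u) v = u"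
      by (simp add: numeral_3_eq_3 face_succ_def)
  qed
next
  assume T: "\<forall>(v, u)\<in>darts M. cw M (cw M v u) v = u"
  show "\<forall>f\<in>faces M. card f = 3"
  proof
    fix f assume "f \<in> faces M"
    then obtain u v where f: "f = orbit (face_succ M) (u, v)" and uv: "(u, v) \<in> darts M"
      by (auto simp: faces_def)
    let ?x = "cw M v u"
    have vx: "(v, ?x) \<in> darts M" using uv sym_darts cw_dart by blast
    have "cw M ?x v = u" using T sym_darts[OF uv] by auto
    moreover have xu: "(?x, u) \<in> darts M"
      using cw_dart[OF sym_darts[OF vx]] calculation by simp
    moreover have "cw M u ?x = v"
      using T sym_darts[OF vx] calculation by fastforce
    ultimately have "(face_succ M ^^ 3) (u, v) = (u, v)"
      by (simp add: numeral_3_eq_3 face_succ_def)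
    then have "f = {(face_succ M ^^ m) (u, v) |m. m < 3}"
      unfolding f by (intro orbit_altdef_bounded) auto
    also have "\<dots> = {(u, v), (v, ?x), (?x, u)}"
      using \<open>cw M ?x v = u\<close> by (auto simp: numeral_3_eq_3 less_Suc_eq face_succ_def ex_disj_distrib
          conj_disj_distribL conj_disj_distribR)
    also have "card \<dots> = 3"
    proof -
      have "u \<noteq> v" "v \<noteq> ?x" "?x \<noteq> u" using uv vx xu irrefl_darts by metis+
      then show ?thesis by simp
    qed
    finally show "card f = 3" .
  qed
qed

end

lemma simple_planar_map_rotation_system: "simple_planar_map M \<Longrightarrow> rotation_system M"
  unfolding simple_planar_map_def by unfold_locales (auto dest: symD simp: irrefl_def)

text \<open>
  Six darts belong to the outer triangle and two to each arc.  As there are three darts in a face and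
  two in an edge, Euler's formula becomes a statement about the number of arcs.
\<close>

lemma card_darts_three_orientation:
  fixes S :: "'v wooded_map"
  assumes "rotation_system S" "inj (corner S)"
    and outer: "\<And>c c'. c \<noteq> c' \<Longrightarrow> (corner S c, corner S c') \<in> darts S"
    and or: "arcs S \<subseteq> inner_darts S"
      "\<forall>(u, v)\<in>inner_darts S. (u, v) \<in> arcs S \<longleftrightarrow> (v, u) \<notin> arcs S"
  shows "card (darts S) = 6 + 2 * card (arcs S)"
proof -
  interpret rotation_system S by fact
  let ?O = "{(corner S c, corner S c') |c c'. c \<noteq> c'}"
  have O: "?O = map_prod (corner S) (corner S) ` {(c, c'). c \<noteq> c'}" by auto
  have "{(c, c'). c \<noteq> c'} = {(Blue, Green), (Blue, Red), (Green, Blue), (Green, Red),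
      (Red, Blue), (Red, Green)}"
  proof (rule set_eqI, clarify)
    fix c c' :: colour
    show "(c, c') \<in> {(c, c'). c \<noteq> c'} \<longleftrightarrow> (c, c') \<in> {(Blue, Green), (Blue, Red), (Green, Blue),
      (Green, Red), (Red, Blue), (Red, Green)}"
      by (cases c; cases c'; simp)
  qed
  then have six: "card {(c :: colour, c'). c \<noteq> c'} = 6" by simp
  have "inj_on (map_prod (corner S) (corner S)) {(c, c'). c \<noteq> c'}"
    using inj_on_subset[OF prod.inj_map[OF assms(2,2)] subset_UNIV] .
  then have O6: "card ?O = 6"
    unfolding O using six card_image by metis
  have "inner_darts S = arcs S \<union> (arcs S)\<inverse>"
  proof -
    have "(v, u) \<in> inner_darts S" if "(u, v) \<in> inner_darts S" for u v
      using that sym_darts by (auto simp: inner_darts_def)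
    then show ?thesis using or by auto
  qed
  moreover have "arcs S \<inter> (arcs S)\<inverse> = {}"
    using or by auto
  moreover have "finite (arcs S)"
    using or(1) finite_darts by (auto simp: inner_darts_def intro: finite_subset)
  ultimately have "card (inner_darts S) = 2 * card (arcs S)"
    by (simp add: card_Un_disjoint)
  moreover have "card (darts S) = card (inner_darts S) + card ?O"
  proof -
    have U: "darts S = inner_darts S \<union> ?O" and D: "inner_darts S \<inter> ?O = {}"
      using outer by (auto simp: inner_darts_def)
    have "finite (inner_darts S)" "finite ?O"
      by (rule finite_subset[OF _ finite_darts], use U in blast)+
    then show ?thesis
      by (subst (1) U) (rule card_Un_disjoint[OF _ _ D])
  qed
  ultimately show ?thesis using O6 by simp
qed

lemma card_arcs_sum:
  assumes "finite V" "arcs S \<subseteq> V \<times> V"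
  shows "card (arcs S) = (\<Sum>v\<in>V. card {w. (v, w) \<in> arcs S})"
proof -
  have "arcs S = Sigma V (\<lambda>v. {w. (v, w) \<in> arcs S})" using assms(2) by auto
  moreover have "finite {w. (v, w) \<in> arcs S}" for v
    by (rule finite_subset[OF _ assms(1)]) (use assms(2) in auto)
  ultimately show ?thesis using assms(1) card_SigmaI by metis
qed

section \<open>Building a map along a sequence of moves\<close>

text \<open>
  The part of a map that has been built.  Vertex \<open>0\<close> is \<open>A\<^sub>b\<close>, vertex \<open>1\<close> is \<open>A\<^sub>g\<close>, and the others are
  numbered in the order of their appearance.  The neighbours of \<open>v\<close> in clockwise order form the list
  \<open>rot \<sigma> v\<close>.  For a vertex on the front it begins with the previous vertex of the front and ends with the
  next one, where these exist, so that further neighbours can be added at both ends.  The value \<open>out \<sigma> v Red\<close>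
  has a meaning only when \<open>v\<close> has left the front.
\<close>

record state =
  fresh :: nat
  rot :: "nat \<Rightarrow> nat list"
  out :: "nat \<Rightarrow> colour \<Rightarrow> nat"
  spine :: "nat list"
  stack :: "nat list"

definition start :: state where
  "start = \<lparr>fresh = 2, rot = (\<lambda>v. if v = 0 then [1] else [0]), out = (\<lambda>_ _. 0),
     spine = [0], stack = [1]\<rparr>"

text \<open>
  The vertices \<open>p\<close>, \<open>ys\<close>, \<open>s\<close> are consecutive on the front.  Seen from \<open>p\<close> and from \<open>ys\<close> the new vertex
  comes after all earlier neighbours, seen from \<open>s\<close> it comes before them.
\<close>

definition attach :: "nat \<Rightarrow> state \<Rightarrow> state" where
  "attach a \<sigma> =
     (let k = fresh \<sigma>; p = hd (spine \<sigma>); ys = take a (stack \<sigma>); s = stack \<sigma> ! a in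
        \<lparr>fresh = Suc k,
         rot = (\<lambda>v. if v = k then p # ys @ [s] else if v = s then k # rot \<sigma> v
           else if v = p \<or> v \<in> set ys then rot \<sigma> v @ [k] else rot \<sigma> v),
         out = (\<lambda>v c. if v = k then (if c = Green then s else p)
           else if v \<in> set ys \<and> c = Red then k else out \<sigma> v c),
         spine = k # spine \<sigma>, stack = drop a (stack \<sigma>)\<rparr>)"

definition retreat :: "state \<Rightarrow> state" where
  "retreat \<sigma> = \<sigma>\<lparr>spine := tl (spine \<sigma>), stack := hd (spine \<sigma>) # stack \<sigma>\<rparr>"

text \<open>
  The last vertex becomes \<open>A\<^sub>r\<close>; the entries for its blue and its green arc are edges of the outer
  triangle, not arcs.
\<close>

definition close :: "state \<Rightarrow> state" where
  "close \<sigma> = attach (length (stack \<sigma>) - 1) \<sigma>"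

fun run :: "state \<Rightarrow> move list \<Rightarrow> state" where
  "run \<sigma> [] = close \<sigma>"
| "run \<sigma> (Attach a # ms) = run (attach a \<sigma>) ms"
| "run \<sigma> (Retreat # ms) = run (retreat \<sigma>) ms"

text \<open>
  The stack without \<open>A\<^sub>g\<close> and the spine without \<open>A\<^sub>b\<close> give the position of the walk.
\<close>

abbreviation completes :: "state \<Rightarrow> move list \<Rightarrow> bool" where
  "completes \<sigma> ms \<equiv> fits (length (stack \<sigma>) - 1) (length (spine \<sigma>) - 1) ms"

definition front :: "state \<Rightarrow> nat list" where
  "front \<sigma> = rev (spine \<sigma>) @ stack \<sigma>"

text \<open>
  A vertex on the front has no red arc yet.
\<close>

definition into :: "state \<Rightarrow> nat \<Rightarrow> colour \<Rightarrow> nat set" where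
  "into \<sigma> v c = {u. 2 \<le> u \<and> u < fresh \<sigma> \<and> (c = Red \<longrightarrow> u \<notin> set (front \<sigma>)) \<and> out \<sigma> u c = v}"

text \<open>
  The clockwise successor as far as it is known: a vertex that has left the front is surrounded by
  triangles, while around a vertex of the front there is a gap between the last and the first entry.
\<close>

definition nxt :: "state \<Rightarrow> nat \<Rightarrow> nat \<Rightarrow> nat \<Rightarrow> bool" where
  "nxt \<sigma> v x y \<longleftrightarrow> v < fresh \<sigma> \<and>
     (consec (rot \<sigma> v) x y \<or> v \<notin> set (front \<sigma>) \<and> x = last (rot \<sigma> v) \<and> y = hd (rot \<sigma> v))"

text \<open>
  The assumption \<open>rot_inner\<close> is the clockwise order of a Schnyder wood, read from the outgoing red arc on:
  green in, blue out, red in, green out, blue in, red out.  The assumption \<open>nxt_rotate\<close> says that every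
  pair of neighbours known to be successive around a vertex spans a triangle with it.
\<close>

locale building =
  fixes \<sigma> :: state
  assumes fresh_ge: "2 \<le> fresh \<sigma>"
    and spine: "spine \<sigma> \<noteq> []" "last (spine \<sigma>) = 0"
    and stack: "stack \<sigma> \<noteq> []" "last (stack \<sigma>) = 1"
    and distinct_front: "distinct (front \<sigma>)"
    and front_less: "v \<in> set (front \<sigma>) \<Longrightarrow> v < fresh \<sigma>"
    and front_ends: "consec (front \<sigma>) x y \<Longrightarrow> last (rot \<sigma> x) = y \<and> hd (rot \<sigma> y) = x"
    and rot_Nil: "v < fresh \<sigma> \<Longrightarrow> rot \<sigma> v \<noteq> []"
    and distinct_rot: "v < fresh \<sigma> \<Longrightarrow> distinct (rot \<sigma> v)"
    and rot_less: "v < fresh \<sigma> \<Longrightarrow> x \<in> set (rot \<sigma> v) \<Longrightarrow> x < fresh \<sigma>"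
    and rot_sym: "v < fresh \<sigma> \<Longrightarrow> x < fresh \<sigma> \<Longrightarrow> x \<in> set (rot \<sigma> v) \<longleftrightarrow> v \<in> set (rot \<sigma> x)"
    and rot_irrefl: "v < fresh \<sigma> \<Longrightarrow> v \<notin> set (rot \<sigma> v)"
    and spine_out: "consec (spine \<sigma>) x y \<Longrightarrow> out \<sigma> x Blue = y"
    and out_less: "2 \<le> v \<Longrightarrow> v < fresh \<sigma> \<Longrightarrow> out \<sigma> v Blue < v \<and> out \<sigma> v Green < v"
    and rot_inner: "2 \<le> v \<Longrightarrow> v < fresh \<sigma> \<Longrightarrow>
      \<exists>gs rs bs. rot \<sigma> v = gs @ [out \<sigma> v Blue] @ rs @ [out \<sigma> v Green] @ bs @
          (if v \<in> set (front \<sigma>) then [] else [out \<sigma> v Red]) \<and>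
        set gs = into \<sigma> v Green \<and> set rs = into \<sigma> v Red \<and> set bs = into \<sigma> v Blue"
    and rot_0: "\<exists>bs. rot \<sigma> 0 = 1 # bs \<and> set bs = into \<sigma> 0 Blue"
    and rot_1: "\<exists>gs. rot \<sigma> 1 = gs @ [0] \<and> set gs = into \<sigma> 1 Green"
    and nxt_rotate: "nxt \<sigma> v x y \<Longrightarrow> nxt \<sigma> y v x"

lemma attach_fields:
  assumes "spine \<sigma> = p # sp" "stack \<sigma> = ys @ s # zs"
  defines "\<sigma>' \<equiv> attach (length ys) \<sigma>"
  shows "fresh \<sigma>' = Suc (fresh \<sigma>)"
    and "rot \<sigma>' = (\<lambda>v. if v = fresh \<sigma> then p # ys @ [s] else if v = s then fresh \<sigma> # rot \<sigma> v
           else if v = p \<or> v \<in> set ys then rot \<sigma> v @ [fresh \<sigma>] else rot \<sigma> v)"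
    and "out \<sigma>' = (\<lambda>v c. if v = fresh \<sigma> then (if c = Green then s else p)
           else if v \<in> set ys \<and> c = Red then fresh \<sigma> else out \<sigma> v c)"
    and "spine \<sigma>' = fresh \<sigma> # p # sp" and "stack \<sigma>' = s # zs"
    and "front \<sigma>' = rev sp @ [p, fresh \<sigma>, s] @ zs"
    and "front \<sigma> = rev sp @ (p # ys @ [s]) @ zs"
  using assms by (auto simp: attach_def front_def Let_def)

lemma building_start: "building start"
proof
  fix v x y
  show "nxt start v x y \<Longrightarrow> nxt start y v x"
    by (auto simp: nxt_def start_def front_def consec_Cons split: if_splits)
qed (auto simp: start_def front_def into_def consec_Cons split: if_splits)

lemma building_retreat:
  assumes "building \<sigma>" "1 < length (spine \<sigma>)"
  shows "building (retreat \<sigma>)"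
proof -
  interpret building \<sigma> by fact
  obtain p sp where p: "spine \<sigma> = p # sp" "sp \<noteq> []"
    using assms(2) by (cases "spine \<sigma>") auto
  have f: "fresh (retreat \<sigma>) = fresh \<sigma>" "rot (retreat \<sigma>) = rot \<sigma>" "out (retreat \<sigma>) = out \<sigma>"
    "front (retreat \<sigma>) = front \<sigma>" "spine (retreat \<sigma>) = sp" "stack (retreat \<sigma>) = p # stack \<sigma>"
    using p by (auto simp: retreat_def front_def)
  then have g: "into (retreat \<sigma>) = into \<sigma>" "nxt (retreat \<sigma>) = nxt \<sigma>"
    by (auto simp: into_def nxt_def fun_eq_iff)
  show ?thesis
  proof (rule building.intro, unfold f g)
    show "sp \<noteq> []" "last sp = 0" "p # stack \<sigma> \<noteq> []" "last (p # stack \<sigma>) = 1"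
      using p spine stack by auto
    show "out \<sigma> x Blue = y" if "consec sp x y" for x y
      using spine_out[of x y] that p by (simp add: consec_Cons)
  qed (rule fresh_ge distinct_front front_less front_ends rot_Nil distinct_rot rot_less rot_sym
      rot_irrefl out_less rot_inner rot_0 rot_1 nxt_rotate; assumption)+
qed

context building
begin

lemma attach_context:
  assumes sp: "spine \<sigma> = p # sp" and st: "stack \<sigma> = ys @ s # zs"
  shows "p < fresh \<sigma>" "s < fresh \<sigma>" "y \<in> set ys \<Longrightarrow> 2 \<le> y \<and> y < fresh \<sigma>"
    "p \<noteq> 1" "s \<noteq> 0" "p \<noteq> s" "p \<notin> set ys" "s \<notin> set ys" "distinct (p # ys @ [s])"
    "v \<in> set (p # ys) \<Longrightarrow> consec (p # ys @ [s]) v x \<longleftrightarrow> x = last (rot \<sigma> v)"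
    "v \<in> set (ys @ [s]) \<Longrightarrow> consec (p # ys @ [s]) x v \<longleftrightarrow> x = hd (rot \<sigma> v)"
proof -
  have fr: "front \<sigma> = rev sp @ (p # ys @ [s]) @ zs"
    using sp st by (simp add: front_def)
  show d: "distinct (p # ys @ [s])"
    using distinct_front by (auto simp: fr)
  then show "p \<noteq> s" "p \<notin> set ys" "s \<notin> set ys" by auto
  show "p < fresh \<sigma>" "s < fresh \<sigma>" using front_less by (auto simp: fr)
  have 0: "0 \<in> set (p # sp)" and 1: "1 \<in> set (s # zs)"
    using spine(2) stack(2) last_in_set[of "p # sp"] last_in_set[of "s # zs"]
    by (auto simp: sp st simp del: last.simps split: if_splits)
  show "p \<noteq> 1" "s \<noteq> 0" using 0 1 distinct_front by (auto simp: fr)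
  have "y \<noteq> 0" "y \<noteq> 1" if "y \<in> set ys"
    using that 0 1 distinct_front by (auto simp: fr)
  then show "2 \<le> y \<and> y < fresh \<sigma>" if "y \<in> set ys"
    using that front_less[of y] by (cases y; cases "y - 1") (auto simp: fr)
  have c: "consec (front \<sigma>) x y" if "consec (p # ys @ [s]) x y" for x y
    unfolding fr using that by (auto simp: consec_append simp del: append_Cons)
  show "consec (p # ys @ [s]) v x \<longleftrightarrow> x = last (rot \<sigma> v)" if v: "v \<in> set (p # ys)"
  proof -
    have "v \<noteq> last (p # ys @ [s])" using v d by auto
    then obtain y where y: "consec (p # ys @ [s]) v y"
      using v consec_succ[of v "p # ys @ [s]"] by auto
    then show ?thesis
      using consec_unique(1)[OF d y, of x] front_ends[OF c[OF y]] by simp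
  qed
  show "consec (p # ys @ [s]) x v \<longleftrightarrow> x = hd (rot \<sigma> v)" if v: "v \<in> set (ys @ [s])"
  proof -
    have "v \<noteq> hd (p # ys @ [s])" using v d by auto
    then obtain y where y: "consec (p # ys @ [s]) y v"
      using v consec_pred[of v "p # ys @ [s]"] by auto
    then show ?thesis
      using consec_unique(2)[OF d y, of x] front_ends[OF c[OF y]] by simp
  qed
qed

text \<open>
  The new successions are the three rotations of the triangles \<open>(k, x, y)\<close>, where \<open>x\<close> and \<open>y\<close> are
  consecutive in the segment of the front that the new vertex \<open>k\<close> sees.  The set of all successions
  thus stays invariant under rotation.
\<close>

lemma nxt_attach:
  assumes sp: "spine \<sigma> = p # sp" and st: "stack \<sigma> = ys @ s # zs"
  defines "l \<equiv> p # ys @ [s]" and "k \<equiv> fresh \<sigma>"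
  shows "nxt (attach (length ys) \<sigma>) v x y \<longleftrightarrow>
    nxt \<sigma> v x y \<or> v = k \<and> consec l x y \<or> x = k \<and> consec l y v \<or> y = k \<and> consec l v x"
proof -
  note f = attach_fields[OF sp st] and c = attach_context[OF sp st]
  have k: "k \<notin> set l" using c by (auto simp: l_def k_def)
  have nc: "consec l x y \<Longrightarrow> x \<noteq> k \<and> y \<noteq> k" for x y
    using k by (auto dest: consec_set)
  have dz: "v \<notin> set sp \<and> v \<notin> set zs" if "v \<in> set l" for v
    using distinct_front that by (auto simp: f(7) l_def)
  \<comment> \<open>The lists of \<open>s\<close> and \<open>p\<close> grow at one end, the lists of \<open>ys\<close> grow and become cycles.\<close>
  consider "v = k" | "v = s" | "v = p" | "v \<in> set ys" | "v \<notin> set l" "v \<noteq> k"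
    by (auto simp: l_def)
  then show ?thesis
  proof cases
    case 1
    then show ?thesis
      using nc by (auto simp: nxt_def f k_def[symmetric] l_def[symmetric])
  next
    case 2
    have "v \<noteq> k" using 2 c by (auto simp: k_def)
    moreover have "consec l y v \<longleftrightarrow> y = hd (rot \<sigma> v)" using 2 c(11)[of s y] by (simp add: l_def)
    moreover have "\<not> consec l v x" using c(9) 2 not_consec_last[of l x] by (simp add: l_def)
    ultimately show ?thesis
      using 2 rot_Nil[of v] c by (auto simp: nxt_def f k_def[symmetric] consec_Cons)
  next
    case 3
    have "v \<noteq> k" using 3 c by (auto simp: k_def)
    moreover have "consec l v x \<longleftrightarrow> x = last (rot \<sigma> v)" using 3 c(10)[of p x] by (simp add: l_def)
    moreover have "\<not> consec l y v" using c(9) 3 not_consec_hd[of l y] by (simp add: l_def)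
    ultimately show ?thesis
      using 3 rot_Nil[of v] c by (auto simp: nxt_def f k_def[symmetric] consec_append consec_Cons)
  next
    case 4
    have "v \<noteq> k" "v \<noteq> p" "v \<noteq> s" "v < Suc k" using 4 c(3)[of v] c(7,8) by (auto simp: k_def)
    moreover have "consec l v x \<longleftrightarrow> x = last (rot \<sigma> v)" using 4 c(10)[of v x] by (simp add: l_def)
    moreover have "consec l y v \<longleftrightarrow> y = hd (rot \<sigma> v)" using 4 c(11)[of v y] by (simp add: l_def)
    ultimately show ?thesis
      using 4 rot_Nil[of v] c(3)[of v] dz[of v]
      by (auto simp: nxt_def f l_def k_def[symmetric] consec_append[of "rot \<sigma> v"] consec_Cons[of k "[]"])
  next
    case 5
    then have "\<not> consec l v x" "\<not> consec l y v" by (auto dest: consec_set)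
    then show ?thesis using 5 by (auto simp: nxt_def f k_def[symmetric] l_def)
  qed
qed

lemma out_Red_less:
  assumes "2 \<le> v" "v < fresh \<sigma>" "v \<notin> set (front \<sigma>)"
  shows "out \<sigma> v Red < fresh \<sigma>"
  using rot_inner[OF assms(1,2)] assms(3) by (intro rot_less[OF assms(2)]) auto

lemma into_attach:
  assumes sp: "spine \<sigma> = p # sp" and st: "stack \<sigma> = ys @ s # zs"
  defines "\<sigma>' \<equiv> attach (length ys) \<sigma>" and "k \<equiv> fresh \<sigma>"
  shows "into \<sigma>' v Blue = into \<sigma> v Blue \<union> (if v = p then {k} else {})"
    and "into \<sigma>' v Green = into \<sigma> v Green \<union> (if v = s then {k} else {})"
    and "into \<sigma>' v Red = (if v = k then set ys else into \<sigma> v Red)"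
    and "into \<sigma> k c = {}"
proof -
  note f = attach_fields[OF sp st] and c = attach_context[OF sp st]
  have k: "2 \<le> k" using fresh_ge by (simp add: k_def)
  show "into \<sigma>' v Blue = into \<sigma> v Blue \<union> (if v = p then {k} else {})"
    using k by (auto simp: into_def \<sigma>'_def f k_def)
  show "into \<sigma>' v Green = into \<sigma> v Green \<union> (if v = s then {k} else {})"
    using k by (auto simp: into_def \<sigma>'_def f k_def)
  have *: "into \<sigma> k c = {}" for c
    using out_less out_Red_less by (cases c) (fastforce simp: into_def k_def)+
  then show "into \<sigma> k c = {}" .
  have d: "y \<notin> set sp \<and> y \<notin> set zs \<and> y \<noteq> p \<and> y \<noteq> s" if "y \<in> set ys" for y
    using that distinct_front by (auto simp: f)
  show "into \<sigma>' v Red = (if v = k then set ys else into \<sigma> v Red)"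
  proof (cases "v = k")
    case True
    have "u \<in> set ys" if "u \<in> into \<sigma>' k Red" for u
    proof (rule ccontr)
      assume "u \<notin> set ys"
      with that have "u \<in> into \<sigma> k Red"
        by (auto simp: into_def \<sigma>'_def f k_def)
      then show False using * by auto
    qed
    moreover have "y \<in> into \<sigma>' k Red" if "y \<in> set ys" for y
      using that c(3)[OF that] d[OF that] by (auto simp: into_def \<sigma>'_def f k_def)
    ultimately show ?thesis using True by auto
  next
    case False
    then show ?thesis
      by (auto simp: into_def \<sigma>'_def f k_def)
  qed
qed

end

lemma building_attach:
  assumes "building \<sigma>" "a < length (stack \<sigma>)"
  shows "building (attach a \<sigma>)"
proof -
  interpret building \<sigma> by fact
  obtain p sp where sp: "spine \<sigma> = p # sp"
    using spine by (cases "spine \<sigma>") auto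
  define ys where "ys = take a (stack \<sigma>)"
  obtain s zs where st: "stack \<sigma> = ys @ s # zs"
    using id_take_nth_drop[OF assms(2)] unfolding ys_def by blast
  have a: "a = length ys" using assms(2) by (simp add: ys_def)
  define k where "k = fresh \<sigma>"
  note f = attach_fields[OF sp st, folded a k_def] and c = attach_context[OF sp st, folded k_def]
    and i = into_attach[OF sp st, folded a k_def] and n = nxt_attach[OF sp st, folded a k_def]
  let ?\<sigma> = "attach a \<sigma>"
  have k2: "2 \<le> k" using fresh_ge by (simp add: k_def)
  have yk: "y < k" if "y \<in> set ys" for y using c(3)[OF that] by simp
  have rk: "k \<notin> set (rot \<sigma> v)" if "v < k" for v
    using rot_less[of v k] that by (auto simp: k_def)
  have fk: "k \<notin> set (front \<sigma>)" using front_less by (auto simp: k_def)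
  have df: "distinct (rev sp @ (p # ys @ [s]) @ zs)" using distinct_front by (simp add: f)
  show ?thesis
  proof
    show "2 \<le> fresh ?\<sigma>" using fresh_ge by (simp add: f k_def)
    show "spine ?\<sigma> \<noteq> []" "last (spine ?\<sigma>) = 0" "stack ?\<sigma> \<noteq> []" "last (stack ?\<sigma>) = 1"
      using spine stack by (auto simp: f sp st)
    show "distinct (front ?\<sigma>)" using df fk by (auto simp: f)
    show "v < fresh ?\<sigma>" if "v \<in> set (front ?\<sigma>)" for v
      using front_less[of v] that by (auto simp: f k_def)
    show "last (rot ?\<sigma> x) = y \<and> hd (rot ?\<sigma> y) = x" if xy: "consec (front ?\<sigma>) x y" for x y
    proof -
      have "x = p \<and> y = k \<or> x = k \<and> y = s \<or> consec (rev sp @ [p]) x y \<or> consec (s # zs) x y"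
        using xy by (auto simp: f consec_append consec_Cons)
      then consider "x = p" "y = k" | "x = k" "y = s" | "consec (rev sp @ [p]) x y"
        | "consec (s # zs) x y" by blast
      then show ?thesis
      proof cases
        case 3
        then have "x \<in> set sp" "y \<in> set (rev sp @ [p])"
          using not_consec_last[of "rev sp @ [p]" y] df last_in_set[of "rev sp"]
          by (auto dest: consec_set simp: consec_append consec_Cons)
        moreover from this have "x \<notin> set (p # ys @ [s])" "y \<notin> set (ys @ [s])" "x \<noteq> k" "y \<noteq> k"
          using df fk by (auto simp: f)
        moreover have "consec (front \<sigma>) x y"
          using 3 unfolding f by (auto simp: consec_append consec_Cons)
        ultimately show ?thesis
          using front_ends[of x y] front_less[of y] rot_Nil[of y] by (auto simp: f consec_set)
      next
        case 4
        then have "y \<in> set zs" "x \<in> set (s # zs)"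
          using not_consec_hd[of "s # zs" x] df by (auto dest: consec_set simp: consec_Cons)
        moreover from this have "x \<notin> set (p # ys)" "y \<notin> set (p # ys @ [s])" "x \<noteq> k" "y \<noteq> k"
          using df fk by (auto simp: f)
        moreover have "consec (front \<sigma>) x y"
          using 4 unfolding f by (auto simp: consec_append consec_Cons)
        ultimately show ?thesis
          using front_ends[of x y] front_less[of x] rot_Nil[of x] by (auto simp: f consec_set)
      qed (use c in \<open>auto simp: f k_def\<close>)
    qed
    show "rot ?\<sigma> v \<noteq> []" if "v < fresh ?\<sigma>" for v
      using rot_Nil[of v] that by (auto simp: f k_def)
    show "distinct (rot ?\<sigma> v)" if "v < fresh ?\<sigma>" for v
      using distinct_rot[of v] rk[of v] that c by (auto simp: f k_def less_Suc_eq)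
    show "x < fresh ?\<sigma>" if "v < fresh ?\<sigma>" "x \<in> set (rot ?\<sigma> v)" for v x
      using rot_less[of v x] that c yk by (auto simp: f k_def less_Suc_eq split: if_splits)
    show "x \<in> set (rot ?\<sigma> v) \<longleftrightarrow> v \<in> set (rot ?\<sigma> x)" if "v < fresh ?\<sigma>" "x < fresh ?\<sigma>" for v x
    proof -
      have "v \<le> k" "x \<le> k" using that by (auto simp: f)
      then consider "v = k" "x = k" | "v = k" "x < k" | "v < k" "x = k" | "v < k" "x < k"
        by linarith
      then show ?thesis
      proof cases
        case 2
        then show ?thesis using rk[of x] by (auto simp: f)
      next
        case 3
        then show ?thesis using rk[of v] by (auto simp: f)
      next
        case 4
        then show ?thesis using rot_sym[of v x] by (auto simp: f k_def)
      qed simp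
    qed
    show "v \<notin> set (rot ?\<sigma> v)" if "v < fresh ?\<sigma>" for v
      using rot_irrefl[of v] c that yk by (auto simp: f k_def less_Suc_eq)
    show "out ?\<sigma> x Blue = y" if "consec (spine ?\<sigma>) x y" for x y
    proof (cases "x = k")
      case True
      then show ?thesis
        using that consec_set[of "p # sp" x y] fk by (auto simp: f consec_Cons dest: consec_set)
    next
      case False
      then show ?thesis
        using that spine_out[of x y] by (auto simp: f sp consec_Cons)
    qed
    show "out ?\<sigma> v Blue < v \<and> out ?\<sigma> v Green < v" if "2 \<le> v" "v < fresh ?\<sigma>" for v
      using out_less[of v] that c by (auto simp: f k_def less_Suc_eq)
    show "\<exists>bs. rot ?\<sigma> 0 = 1 # bs \<and> set bs = into ?\<sigma> 0 Blue"
      using rot_0 c(3)[of 0] c(5) k2 by (auto simp: f i)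
    show "\<exists>gs. rot ?\<sigma> 1 = gs @ [0] \<and> set gs = into ?\<sigma> 1 Green"
    proof -
      obtain gs where gs: "rot \<sigma> 1 = gs @ [0]" "set gs = into \<sigma> 1 Green" using rot_1 by auto
      have ne: "1 \<notin> set ys" "p \<noteq> 1" "k \<noteq> 1" using c(3)[of 1] c(4) k2 by auto
      show ?thesis
      proof (cases "s = 1")
        case True
        then show ?thesis using gs ne by (intro exI[of _ "k # gs"]) (auto simp: f i)
      next
        case False
        then show ?thesis using gs ne by (intro exI[of _ gs]) (auto simp: f i)
      qed
    qed
    show "nxt ?\<sigma> y v x" if "nxt ?\<sigma> v x y" for v x y
      using that nxt_rotate[of v x y] unfolding n by blast
    show "\<exists>gs rs bs. rot ?\<sigma> v = gs @ [out ?\<sigma> v Blue] @ rs @ [out ?\<sigma> v Green] @ bs @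
          (if v \<in> set (front ?\<sigma>) then [] else [out ?\<sigma> v Red]) \<and>
        set gs = into ?\<sigma> v Green \<and> set rs = into ?\<sigma> v Red \<and> set bs = into ?\<sigma> v Blue"
      if v2: "2 \<le> v" and vk: "v < fresh ?\<sigma>" for v
    proof (cases "v = k")
      case True
      have "k \<noteq> p" "k \<noteq> s" using c by auto
      then show ?thesis
        by (intro exI[of _ "[]"] exI[of _ ys] exI[of _ "[]"]) (auto simp: True f i)
    next
      case False
      then have "v < k" using vk by (simp add: f)
      then obtain gs rs bs where r: "rot \<sigma> v = gs @ [out \<sigma> v Blue] @ rs @ [out \<sigma> v Green] @ bs @
          (if v \<in> set (front \<sigma>) then [] else [out \<sigma> v Red])"
        "set gs = into \<sigma> v Green" "set rs = into \<sigma> v Red" "set bs = into \<sigma> v Blue"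
        using rot_inner[OF v2] unfolding k_def by blast
      consider "v = p" | "v = s" | "v \<in> set ys" | "v \<notin> set (p # ys @ [s])" by auto
      then show ?thesis
      proof cases
        case 1
        then have "v \<in> set (front \<sigma>)" "v \<in> set (front ?\<sigma>)" by (auto simp: f)
        then show ?thesis
          using 1 r False c by (intro exI[of _ gs] exI[of _ rs] exI[of _ "bs @ [k]"]) (auto simp: f i)
      next
        case 2
        then have "v \<in> set (front \<sigma>)" "v \<in> set (front ?\<sigma>)" by (auto simp: f)
        then show ?thesis
          using 2 r False c by (intro exI[of _ "k # gs"] exI[of _ rs] exI[of _ bs]) (auto simp: f i)
      next
        case 3
        then have "v \<in> set (front \<sigma>)" "v \<notin> set (front ?\<sigma>)" using df False by (auto simp: f)
        then show ?thesis
          using 3 r False c by (intro exI[of _ gs] exI[of _ rs] exI[of _ bs]) (auto simp: f i)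
      next
        case 4
        then have "v \<in> set (front \<sigma>) \<longleftrightarrow> v \<in> set (front ?\<sigma>)" using False by (auto simp: f)
        then show ?thesis
          using 4 r False by (intro exI[of _ gs] exI[of _ rs] exI[of _ bs]) (auto simp: f i)
      qed
    qed
  qed
qed

context building
begin

lemma last_rot_hd_spine: "last (rot \<sigma> (hd (spine \<sigma>))) = hd (stack \<sigma>)"
proof -
  have "consec (front \<sigma>) (hd (spine \<sigma>)) (hd (stack \<sigma>))"
    using spine stack by (simp add: front_def consec_append last_rev)
  then show ?thesis using front_ends by simp
qed

lemma spine_neq_1: "v \<in> set (spine \<sigma>) \<Longrightarrow> v \<noteq> 1"
  using distinct_front stack last_in_set[of "stack \<sigma>"] by (auto simp: front_def)

lemma spine_less: "v \<in> set (spine \<sigma>) \<Longrightarrow> v < fresh \<sigma>"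
  using front_less[of v] by (simp add: front_def)

lemma stack_less: "y \<in> set (stack \<sigma>) \<Longrightarrow> y < fresh \<sigma>"
  using front_less[of y] by (simp add: front_def)

lemma stack_ge: "y \<in> set (stack \<sigma>) \<Longrightarrow> y \<noteq> 1 \<Longrightarrow> 2 \<le> y \<and> y < fresh \<sigma> \<and> y \<notin> set (spine \<sigma>)"
proof -
  assume y: "y \<in> set (stack \<sigma>)" "y \<noteq> 1"
  have "0 \<in> set (spine \<sigma>)" using spine last_in_set by metis
  then have "y \<noteq> 0" using distinct_front y by (auto simp: front_def)
  then show ?thesis using y front_less[of y] distinct_front by (auto simp: front_def)
qed

end

section \<open>The built map is a wooded triangulation\<close>

locale closed = building +
  assumes front_eq: "front \<sigma> = [0, fresh \<sigma> - 1, 1]"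

lemma building_close:
  assumes "building \<sigma>" "length (spine \<sigma>) = 1"
  shows "closed (close \<sigma>)" "fresh (close \<sigma>) = Suc (fresh \<sigma>)"
proof -
  interpret building \<sigma> by fact
  have sp: "spine \<sigma> = [0]" using assms(2) spine by (cases "spine \<sigma>") auto
  have st: "stack \<sigma> = butlast (stack \<sigma>) @ 1 # []"
    using stack append_butlast_last_id[of "stack \<sigma>"] by simp
  note f = attach_fields[OF sp st]
  have c: "close \<sigma> = attach (length (butlast (stack \<sigma>))) \<sigma>" by (simp add: close_def)
  show fr: "fresh (close \<sigma>) = Suc (fresh \<sigma>)" unfolding c f ..
  have "front (close \<sigma>) = [0, fresh \<sigma>, 1]" unfolding c f by simp
  moreover have "building (close \<sigma>)"
    unfolding close_def using assms(1) stack by (intro building_attach) auto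
  ultimately show "closed (close \<sigma>)" using fr by (simp add: closed_def closed_axioms_def)
qed

lemma building_run:
  "building \<sigma> \<Longrightarrow> completes \<sigma> ms \<Longrightarrow>
    closed (run \<sigma> ms) \<and> fresh (run \<sigma> ms) = fresh \<sigma> + attachments ms + 1"
proof (induction \<sigma> ms rule: run.induct)
  case (1 \<sigma>)
  then interpret building \<sigma> by simp
  have "length (spine \<sigma>) = 1" using 1(2) spine by (cases "spine \<sigma>") auto
  then show ?case using building_close[OF 1(1)] by simp
next
  case (2 \<sigma> a ms)
  interpret building \<sigma> by fact
  have a: "a < length (stack \<sigma>)" using 2(3) stack(1) by (cases "stack \<sigma>") auto
  have "length (stack (attach a \<sigma>)) = length (stack \<sigma>) - a" "fresh (attach a \<sigma>) = Suc (fresh \<sigma>)"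
    "length (spine (attach a \<sigma>)) = Suc (length (spine \<sigma>))"
    by (simp_all add: attach_def Let_def)
  moreover have "length (spine \<sigma>) > 0" using spine by simp
  ultimately show ?case
    using 2(1)[OF building_attach[OF 2(2) a]] 2(3) by (simp add: diff_right_commute)
next
  case (3 \<sigma> ms)
  interpret building \<sigma> by fact
  have a: "1 < length (spine \<sigma>)" using 3(3) by auto
  have "length (stack (retreat \<sigma>)) = Suc (length (stack \<sigma>))" "fresh (retreat \<sigma>) = fresh \<sigma>"
    "length (spine (retreat \<sigma>)) = length (spine \<sigma>) - 1"
    by (simp_all add: retreat_def)
  moreover have "length (stack \<sigma>) > 0" using stack by simp
  ultimately show ?case
    using 3(1)[OF building_retreat[OF 3(2) a]] 3(3) by simp
qed

text \<open>
  Arcs start from inner vertices only, which drops the outer edges recorded for \<open>A\<^sub>r\<close>.  The function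
  \<open>out \<sigma> v\<close> is injective at these vertices, so that its inverse recovers the colour of an arc.
\<close>

definition wooded_of :: "state \<Rightarrow> nat wooded_map" where
  "wooded_of \<sigma> =
     \<lparr>verts = {..<fresh \<sigma>}, darts = {(v, x). v < fresh \<sigma> \<and> x \<in> set (rot \<sigma> v)},
      cw = (\<lambda>v. cycle_of_list (rot \<sigma> v)), corner = case_colour 0 1 (fresh \<sigma> - 1),
      arcs = {(v, out \<sigma> v c) |v c. 2 \<le> v \<and> v < fresh \<sigma> - 1},
      col = (\<lambda>(v, x). inv (out \<sigma> v) x)\<rparr>"

lemma wooded_of_simps [simp]:
  "verts (wooded_of \<sigma>) = {..<fresh \<sigma>}"
  "darts (wooded_of \<sigma>) = {(v, x). v < fresh \<sigma> \<and> x \<in> set (rot \<sigma> v)}"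
  "cw (wooded_of \<sigma>) v = cycle_of_list (rot \<sigma> v)"
  "corner (wooded_of \<sigma>) Blue = 0"
  "corner (wooded_of \<sigma>) Green = 1"
  "corner (wooded_of \<sigma>) Red = fresh \<sigma> - 1"
  "arcs (wooded_of \<sigma>) = {(v, out \<sigma> v c) |v c. 2 \<le> v \<and> v < fresh \<sigma> - 1}"
  "col (wooded_of \<sigma>) (v, x) = inv (out \<sigma> v) x"
  by (simp_all add: wooded_of_def)

context closed
begin

abbreviation "r \<equiv> fresh \<sigma> - 1"

lemma r_ge: "2 \<le> r" and less_fresh_iff: "v < fresh \<sigma> \<longleftrightarrow> v < r \<or> v = r"
  using distinct_front fresh_ge by (auto simp: front_eq)

lemma in_front_iff: "v \<in> set (front \<sigma>) \<longleftrightarrow> v = 0 \<or> v = 1 \<or> v = r"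
  by (auto simp: front_eq)

lemma rot_ends:
  "last (rot \<sigma> 0) = r" "hd (rot \<sigma> r) = 0" "last (rot \<sigma> r) = 1" "hd (rot \<sigma> 1) = r"
  "hd (rot \<sigma> 0) = 1" "last (rot \<sigma> 1) = 0"
  using front_ends[of 0 r] front_ends[of r 1] rot_0 rot_1
  by (auto simp: front_eq consec_Cons)

lemma cw_nxt: "nxt \<sigma> v x y \<Longrightarrow> cycle_of_list (rot \<sigma> v) x = y"
  using cycle_of_list_consec[OF distinct_rot] cycle_of_list_last[OF distinct_rot rot_Nil]
  by (auto simp: nxt_def)

lemma cw_corners:
  "cycle_of_list (rot \<sigma> 0) r = 1" "cycle_of_list (rot \<sigma> 1) 0 = r" "cycle_of_list (rot \<sigma> r) 1 = 0"
  using cycle_of_list_last[OF distinct_rot rot_Nil, of 0] cycle_of_list_last[OF distinct_rot rot_Nil, of 1]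
    cycle_of_list_last[OF distinct_rot rot_Nil, of r] rot_ends r_ge
  by auto

text \<open>
  At the three corners the list is closed up by an outer edge, and the outer face is a triangle as well.
\<close>

lemma cw_cw:
  assumes "v < fresh \<sigma>" "x \<in> set (rot \<sigma> v)"
  shows "cycle_of_list (rot \<sigma> (cycle_of_list (rot \<sigma> v) x)) v = x"
proof (cases "\<exists>y. nxt \<sigma> v x y")
  case True
  then obtain y where y: "nxt \<sigma> v x y" by blast
  then show ?thesis using cw_nxt[OF y] cw_nxt[OF nxt_rotate[OF y]] by simp
next
  case False
  then have "x = last (rot \<sigma> v)" "v \<in> set (front \<sigma>)"
    using consec_succ[OF assms(2)] assms(1) by (auto simp: nxt_def)
  then show ?thesis using rot_ends cw_corners by (auto simp: in_front_iff)
qed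

text \<open>
  The list around \<open>A\<^sub>r\<close> begins with \<open>0\<close> and ends with \<open>1\<close>, whereas tails of arcs are at least \<open>2\<close>; this
  leaves no room for green or blue arcs into \<open>A\<^sub>r\<close>.
\<close>

lemma rot_r: "\<exists>rs. rot \<sigma> r = [0] @ rs @ [1] \<and> set rs = into \<sigma> r Red"
    "out \<sigma> r Blue = 0" "out \<sigma> r Green = 1"
proof -
  obtain gs rs bs where r: "rot \<sigma> r = gs @ [out \<sigma> r Blue] @ rs @ [out \<sigma> r Green] @ bs"
    "set gs = into \<sigma> r Green" "set rs = into \<sigma> r Red" "set bs = into \<sigma> r Blue"
    using rot_inner[of r] r_ge by (auto simp: in_front_iff)
  have "gs = []"
    using rot_ends(2) r(1,2) hd_in_set[of gs] by (auto simp: into_def hd_append split: if_splits)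
  moreover have "bs = []"
    using rot_ends(3) r(1,4) last_in_set[of bs] by (auto simp: into_def split: if_splits)
  ultimately show "\<exists>rs. rot \<sigma> r = [0] @ rs @ [1] \<and> set rs = into \<sigma> r Red"
    "out \<sigma> r Blue = 0" "out \<sigma> r Green = 1"
    using r rot_ends by auto
qed

lemma inner_rot:
  assumes "2 \<le> v" "v < r"
  obtains gs rs bs where
    "rot \<sigma> v = gs @ [out \<sigma> v Blue] @ rs @ [out \<sigma> v Green] @ bs @ [out \<sigma> v Red]"
    "set gs = into \<sigma> v Green" "set rs = into \<sigma> v Red" "set bs = into \<sigma> v Blue"
proof -
  have "v < fresh \<sigma>" "v \<notin> set (front \<sigma>)" using assms by (auto simp: in_front_iff)
  then show ?thesis using rot_inner[OF assms(1)] that by auto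
qed

lemma inj_out:
  assumes "2 \<le> v" "v < r"
  shows "inj (out \<sigma> v)"
proof -
  obtain gs rs bs where "rot \<sigma> v = gs @ [out \<sigma> v Blue] @ rs @ [out \<sigma> v Green] @ bs @ [out \<sigma> v Red]"
    by (rule inner_rot[OF assms])
  then have "distinct [out \<sigma> v Blue, out \<sigma> v Green, out \<sigma> v Red]"
    using distinct_rot[of v] assms by auto
  then show ?thesis
    by (intro injI) (metis colour.exhaust distinct_length_2_or_more)
qed

lemma out_rot: "2 \<le> v \<Longrightarrow> v < r \<Longrightarrow> out \<sigma> v c \<in> set (rot \<sigma> v)"
  by (erule (1) inner_rot) (cases c; simp)

lemma col_out: "2 \<le> v \<Longrightarrow> v < r \<Longrightarrow> inv (out \<sigma> v) (out \<sigma> v c) = c"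
  by (simp add: inj_out)

lemma into_inner: "2 \<le> v \<Longrightarrow> into \<sigma> v c = {u. 2 \<le> u \<and> u < r \<and> out \<sigma> u c = v}"
  using rot_r(2,3) by (cases c) (auto simp: into_def in_front_iff less_fresh_iff)

lemma arcs_iff: "(u, v) \<in> arcs (wooded_of \<sigma>) \<longleftrightarrow> 2 \<le> u \<and> u < r \<and> (\<exists>c. v = out \<sigma> u c)"
  by auto

text \<open>
  The tail of an arc into a corner occurs in the rotation around that corner, which lists only tails of
  arcs of its own colour besides the other corners.
\<close>

lemma into_corner:
  assumes "2 \<le> u" "u < r" "out \<sigma> u c = corner (wooded_of \<sigma>) c'"
  shows "c = c'"
proof -
  let ?v = "corner (wooded_of \<sigma>) c'"
  have v: "?v < fresh \<sigma>" using r_ge by (cases c') auto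
  have "u \<in> set (rot \<sigma> ?v)"
    using out_rot[OF assms(1,2), of c] rot_sym[OF v, of u] assms by auto
  then have "u \<in> into \<sigma> ?v c'"
    using assms(1,2) rot_0 rot_1 rot_r(1) by (cases c') force+
  then have "out \<sigma> u c' = ?v" by (simp add: into_def)
  then show ?thesis using assms(3) injD[OF inj_out[OF assms(1,2)]] by simp
qed

text \<open>
  Heads of arcs from \<open>v\<close> and tails of arcs into \<open>v\<close> are disjoint parts of the repetition-free list
  \<open>rot \<sigma> v\<close>, and together they fill it.
\<close>

lemma one_orientation:
  assumes "2 \<le> v" "v < r" "x \<in> set (rot \<sigma> v)"
  shows "(v, x) \<in> arcs (wooded_of \<sigma>) \<longleftrightarrow> (x, v) \<notin> arcs (wooded_of \<sigma>)"
proof -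
  obtain gs rs bs where r: "rot \<sigma> v = gs @ [out \<sigma> v Blue] @ rs @ [out \<sigma> v Green] @ bs @ [out \<sigma> v Red]"
    "set gs = into \<sigma> v Green" "set rs = into \<sigma> v Red" "set bs = into \<sigma> v Blue"
    by (rule inner_rot[OF assms(1,2)])
  have d: "distinct (rot \<sigma> v)" using distinct_rot assms(2) by simp
  have 1: "(v, x) \<in> arcs (wooded_of \<sigma>) \<longleftrightarrow> x \<in> {out \<sigma> v Blue, out \<sigma> v Green, out \<sigma> v Red}"
    unfolding arcs_iff ex_colour using assms by simp
  have 2: "(x, v) \<in> arcs (wooded_of \<sigma>) \<longleftrightarrow> x \<in> set (gs @ rs @ bs)"
  proof -
    have "(x, v) \<in> arcs (wooded_of \<sigma>) \<longleftrightarrow> (\<exists>c. x \<in> into \<sigma> v c)"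
      unfolding arcs_iff into_inner[OF assms(1)] by auto
    also have "\<dots> \<longleftrightarrow> x \<in> into \<sigma> v Green \<or> x \<in> into \<sigma> v Red \<or> x \<in> into \<sigma> v Blue"
      unfolding ex_colour by blast
    finally show ?thesis by (simp add: r(2-4))
  qed
  show ?thesis unfolding 1 2 using d assms(3) unfolding r(1) by auto
qed

lemma rotation_system: "rotation_system (wooded_of \<sigma>)"
proof
  show "cyclic_on (cw (wooded_of \<sigma>) v) (nbrs (wooded_of \<sigma>) v)" if "v \<in> verts (wooded_of \<sigma>)" for v
    using cyclic_on_cycle_of_list[OF distinct_rot rot_Nil, of v] that by (simp add: nbrs_def)
qed (use rot_less rot_sym rot_irrefl in auto)

lemma inner_verts: "inner_verts (wooded_of \<sigma>) = {2..<r}"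
  using r_ge by (auto simp: inner_verts_def UNIV_colour)

lemma corner_darts: "c \<noteq> c' \<Longrightarrow> (corner (wooded_of \<sigma>) c, corner (wooded_of \<sigma>) c') \<in> darts (wooded_of \<sigma>)"
  using rot_ends r_ge rot_Nil[of 0] rot_Nil[of 1] rot_Nil[of r]
    hd_in_set[of "rot \<sigma> 0"] hd_in_set[of "rot \<sigma> 1"] hd_in_set[of "rot \<sigma> r"]
    last_in_set[of "rot \<sigma> 0"] last_in_set[of "rot \<sigma> 1"] last_in_set[of "rot \<sigma> r"]
  by (cases c; cases c') auto

lemma inj_corner: "inj (corner (wooded_of \<sigma>))"
proof (rule injI)
  fix c c' assume "corner (wooded_of \<sigma>) c = corner (wooded_of \<sigma>) c'"
  then show "c = c'" using r_ge by (cases c; cases c') auto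
qed

lemma inner_dartsD:
  assumes "(u, v) \<in> inner_darts (wooded_of \<sigma>)"
  shows "u < fresh \<sigma> \<and> v \<in> set (rot \<sigma> u) \<and> v < fresh \<sigma> \<and> u \<in> set (rot \<sigma> v) \<and> (2 \<le> u \<and> u < r \<or> 2 \<le> v \<and> v < r)"
proof -
  have d: "u < fresh \<sigma>" "v \<in> set (rot \<sigma> u)" using assms by (auto simp: inner_darts_def)
  from rot_less[OF this] have v: "v < fresh \<sigma>" "u \<in> set (rot \<sigma> v)"
    using rot_sym[of u v] d by blast+
  have "\<exists>c. w = corner (wooded_of \<sigma>) c" if "\<not> (2 \<le> w \<and> w < r)" "w < fresh \<sigma>" for w
  proof -
    have "w = 0 \<or> w = 1 \<or> w = r" using that by auto
    then show ?thesis by (metis wooded_of_simps(4-6))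
  qed
  moreover have "u \<noteq> v" using rot_irrefl[of u] d by auto
  moreover have "\<not> (\<exists>c c'. c \<noteq> c' \<and> u = corner (wooded_of \<sigma>) c \<and> v = corner (wooded_of \<sigma>) c')"
    using assms by (auto simp: inner_darts_def)
  ultimately show ?thesis using d v by metis
qed

lemma arcs_inner_darts: "arcs (wooded_of \<sigma>) \<subseteq> inner_darts (wooded_of \<sigma>)"
proof safe
  fix u v assume "(u, v) \<in> arcs (wooded_of \<sigma>)"
  then obtain c where u: "2 \<le> u" "u < r" "v = out \<sigma> u c" by (auto simp: arcs_iff)
  moreover have "u \<noteq> corner (wooded_of \<sigma>) c" for c using u by (cases c) auto
  ultimately show "(u, v) \<in> inner_darts (wooded_of \<sigma>)"
    using out_rot[OF u(1,2), of c] by (auto simp: inner_darts_def)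
qed

lemma three_orientation: "three_orientation (wooded_of \<sigma>)"
  unfolding three_orientation_def
proof (intro conjI)
  show "arcs (wooded_of \<sigma>) \<subseteq> inner_darts (wooded_of \<sigma>)" by (rule arcs_inner_darts)
  show "\<forall>(u, v)\<in>inner_darts (wooded_of \<sigma>).
    (u, v) \<in> arcs (wooded_of \<sigma>) \<longleftrightarrow> (v, u) \<notin> arcs (wooded_of \<sigma>)"
    using inner_dartsD one_orientation by blast
  show "\<forall>v\<in>inner_verts (wooded_of \<sigma>). card {w. (v, w) \<in> arcs (wooded_of \<sigma>)} = 3"
  proof
    fix v assume "v \<in> inner_verts (wooded_of \<sigma>)"
    then have v: "2 \<le> v" "v < r" by (auto simp: inner_verts)
    then have "{w. (v, w) \<in> arcs (wooded_of \<sigma>)} = range (out \<sigma> v)" by auto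
    then show "card {w. (v, w) \<in> arcs (wooded_of \<sigma>)} = 3"
      using card_image[OF inj_out[OF v]] by (simp add: UNIV_colour)
  qed
qed

lemma schnyder_at:
  assumes "2 \<le> v" "v < r"
  shows "schnyder_at (wooded_of \<sigma>) v"
proof -
  obtain gs rs bs where r: "rot \<sigma> v = gs @ [out \<sigma> v Blue] @ rs @ [out \<sigma> v Green] @ bs @ [out \<sigma> v Red]"
    "set gs = into \<sigma> v Green" "set rs = into \<sigma> v Red" "set bs = into \<sigma> v Blue"
    by (rule inner_rot[OF assms])
  let ?M = "wooded_of \<sigma>" and ?B = "out \<sigma> v Blue" and ?G = "out \<sigma> v Green" and ?R = "out \<sigma> v Red"
  have d: "distinct (rot \<sigma> v)" using distinct_rot assms(2) by simp
  have 1: "cw ?M v = cycle_of_list (?B # (rs @ ?G # bs) @ ?R # gs)"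
    using cycle_of_list_swap[of gs] d by (simp add: r(1) fun_eq_iff)
  have 2: "cw ?M v = cycle_of_list (?G # bs @ ?R # gs @ ?B # rs)"
    using cycle_of_list_swap[of "gs @ ?B # rs"] d by (simp add: r(1) fun_eq_iff)
  have 3: "cw ?M v = cycle_of_list (?R # gs @ ?B # rs @ ?G # bs)"
    using cycle_of_list_swap[of "gs @ ?B # rs @ ?G # bs" "[?R]"] d by (simp add: r(1) fun_eq_iff)
  have 4: "cw ?M v = cycle_of_list (?B # rs @ ?G # bs @ ?R # gs)" using 1 by simp
  have s1: "sector ?M v ?B ?R = set (rs @ ?G # bs)"
    by (rule sector_cycle_of_list[OF 1 refl]) (use d in \<open>auto simp: r(1)\<close>)
  have s2: "sector ?M v ?B ?G = set rs"
    by (rule sector_cycle_of_list[OF 4 refl]) (use d in \<open>auto simp: r(1)\<close>)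
  have s3: "sector ?M v ?G ?R = set bs"
    by (rule sector_cycle_of_list[OF 2 refl]) (use d in \<open>auto simp: r(1)\<close>)
  have s4: "sector ?M v ?R ?B = set gs"
    by (rule sector_cycle_of_list[OF 3 refl]) (use d in \<open>auto simp: r(1)\<close>)
  note s = s1 s2 s3 s4
  show ?thesis
    unfolding schnyder_at_def
  proof (intro exI[of _ "out \<sigma> v"] conjI allI impI)
    show "{w. (v, w) \<in> arcs ?M} = range (out \<sigma> v)" using assms by auto
    show "col ?M (v, out \<sigma> v c) = c" for c using col_out[OF assms] by simp
    show "?G \<in> sector ?M v ?B ?R" by (simp add: s)
    fix u assume "(u, v) \<in> arcs ?M"
    then obtain c where u: "2 \<le> u" "u < r" "v = out \<sigma> u c" unfolding arcs_iff by blast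
    then have "u \<in> into \<sigma> v c" using into_inner[OF assms(1)] by simp
    moreover have "col ?M (u, v) = c" using col_out[OF u(1,2)] u(3) by simp
    ultimately show "case col ?M (u, v) of Blue \<Rightarrow> u \<in> sector ?M v ?G ?R
        | Green \<Rightarrow> u \<in> sector ?M v ?R ?B | Red \<Rightarrow> u \<in> sector ?M v ?B ?G"
      unfolding s using r(2-4) by (cases c) auto
  qed
qed

lemma schnyder_wood: "schnyder_wood (wooded_of \<sigma>)"
  unfolding schnyder_wood_def
proof (intro conjI)
  show "three_orientation (wooded_of \<sigma>)" by (rule three_orientation)
  show "\<forall>v\<in>inner_verts (wooded_of \<sigma>). schnyder_at (wooded_of \<sigma>) v"
    using schnyder_at by (auto simp: inner_verts)
  have "col (wooded_of \<sigma>) (u, v) = c"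
    if a: "(u, v) \<in> arcs (wooded_of \<sigma>)"
      and uv: "u = corner (wooded_of \<sigma>) c \<or> v = corner (wooded_of \<sigma>) c" for u v c
  proof -
    obtain c' where u: "2 \<le> u" "u < r" "v = out \<sigma> u c'" using a unfolding arcs_iff by blast
    have "u \<noteq> corner (wooded_of \<sigma>) c" using u by (cases c) auto
    then have "c' = c" using uv into_corner[OF u(1,2), of c' c] u(3) by simp
    then show ?thesis using col_out[OF u(1,2)] unfolding u(3) wooded_of_simps by simp
  qed
  then show "\<forall>(u, v)\<in>arcs (wooded_of \<sigma>). \<forall>c. u = corner (wooded_of \<sigma>) c \<or> v = corner (wooded_of \<sigma>) c
    \<longrightarrow> col (wooded_of \<sigma>) (u, v) = c"
    by blast
qed

lemma connected:
  assumes "u < fresh \<sigma>" "v < fresh \<sigma>"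
  shows "(u, v) \<in> (darts (wooded_of \<sigma>))\<^sup>*"
proof -
  have 0: "(v, 0) \<in> (darts (wooded_of \<sigma>))\<^sup>*" if "v < fresh \<sigma>" for v
    using that
  proof (induction v rule: less_induct)
    case (less v)
    consider "v = 0" | "v = 1" | "2 \<le> v" by linarith
    then show ?case
    proof cases
      case 2
      then show ?thesis using corner_darts[of Green Blue] by auto
    next
      case 3
      then have b: "out \<sigma> v Blue < v" using out_less less by blast
      have "out \<sigma> v Blue \<in> set (rot \<sigma> v)" using rot_inner[OF 3] less by auto
      then have "(v, out \<sigma> v Blue) \<in> darts (wooded_of \<sigma>)" using less.prems by simp
      then show ?thesis using less.IH[OF b] b less.prems by (simp add: converse_rtrancl_into_rtrancl)
    qed simp
  qed
  have "sym (darts (wooded_of \<sigma>))"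
    using rotation_system.sym_darts[OF rotation_system] by (blast intro: symI)
  then have "(0, v) \<in> (darts (wooded_of \<sigma>))\<^sup>*"
    using 0[OF assms(2)] by (metis sym_rtrancl symD)
  then show ?thesis using 0[OF assms(1)] by (rule rtrancl_trans[rotated])
qed

lemma triangles: "\<forall>f\<in>faces (wooded_of \<sigma>). card f = 3"
  unfolding rotation_system.faces_triangles_iff[OF rotation_system] using cw_cw by auto

lemma euler: "card (verts (wooded_of \<sigma>)) + card (faces (wooded_of \<sigma>)) = card (edges (wooded_of \<sigma>)) + 2"
proof -
  let ?M = "wooded_of \<sigma>"
  have "card (arcs ?M) = (\<Sum>v<fresh \<sigma>. card {w. (v, w) \<in> arcs ?M})"
  proof (rule card_arcs_sum)
    show "arcs ?M \<subseteq> {..<fresh \<sigma>} \<times> {..<fresh \<sigma>}"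
      using rotation_system.darts_verts[OF rotation_system] arcs_inner_darts
      unfolding inner_darts_def wooded_of_simps(1) by blast
  qed simp
  also have "\<dots> = (\<Sum>v<fresh \<sigma>. if v \<in> {2..<r} then 3 else 0)"
  proof (rule sum.cong)
    fix v
    show "card {w. (v, w) \<in> arcs ?M} = (if v \<in> {2..<r} then 3 else 0)"
      using three_orientation unfolding three_orientation_def inner_verts by auto
  qed simp
  also have "\<dots> = (\<Sum>v\<in>{2..<r}. 3)"
    by (rule sum.mono_neutral_cong_right) auto
  also have "\<dots> = 3 * (r - 2)" by simp
  finally have "card (arcs ?M) = 3 * (r - 2)" .
  moreover have "card (darts ?M) = 6 + 2 * card (arcs ?M)"
    using three_orientation unfolding three_orientation_def
    by (intro card_darts_three_orientation[OF rotation_system inj_corner corner_darts]) blast+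
  ultimately have "card (darts ?M) = 6 + 2 * (3 * (r - 2))" by simp
  moreover have "card (darts ?M) = 3 * card (faces ?M)" "card (darts ?M) = 2 * card (edges ?M)"
    using rotation_system.card_faces[OF rotation_system triangles]
      rotation_system.card_edges[OF rotation_system] by auto
  moreover have "card (verts ?M) = r + 1" using r_ge by simp
  ultimately show ?thesis using r_ge by linarith
qed

lemma simple_planar_map: "simple_planar_map (wooded_of \<sigma>)"
proof -
  interpret M: rotation_system "wooded_of \<sigma>" by (rule rotation_system)
  have "sym (darts (wooded_of \<sigma>))" "irrefl (darts (wooded_of \<sigma>))"
    by (rule symI, erule M.sym_darts) (rule irreflI, rule M.irrefl_darts)
  moreover have "0 \<in> verts (wooded_of \<sigma>)" using r_ge by simp
  then have "verts (wooded_of \<sigma>) \<noteq> {}" by blast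
  ultimately show ?thesis
    unfolding simple_planar_map_def
    using M.finite_verts M.darts_verts M.cyclic_cw euler connected
    by (intro conjI ballI) (simp_all only: wooded_of_simps(1) lessThan_iff not_False_eq_True)
qed

lemma wooded_of_triangulation: "wooded_triangulation (fresh \<sigma> - 3) (wooded_of \<sigma>)"
proof -
  let ?M = "wooded_of \<sigma>"
  have "orbit (face_succ ?M) (0, 1) = {(face_succ ?M ^^ m) (0, 1) |m. m < 3}"
    using cw_corners by (intro orbit_altdef_bounded) (simp_all add: numeral_3_eq_3 face_succ_def)
  also have "\<dots> = {(0, 1), (1, r), (r, 0)}"
    using cw_corners by (auto simp: numeral_3_eq_3 less_Suc_eq face_succ_def ex_disj_distrib
      conj_disj_distribL conj_disj_distribR)
  finally have "{(0, 1), (1, r), (r, 0)} \<in> faces ?M"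
    using corner_darts[of Blue Green] unfolding faces_def
    by (intro CollectI exI[of _ "(0, 1)"]) simp
  moreover have "card (inner_verts ?M) = fresh \<sigma> - 3" by (simp add: inner_verts)
  ultimately show ?thesis
    using simple_planar_map triangles schnyder_wood
    by (simp add: wooded_triangulation_def simple_triangulation_def)
qed

end

section \<open>Turning around a vertex of a Schnyder wood\<close>

locale wooded =
  fixes n :: nat and S :: "'v wooded_map"
  assumes wooded: "wooded_triangulation n S"
begin

lemma planar: "simple_planar_map S" and triangulation: "simple_triangulation n S"
  and wood: "schnyder_wood S"
  using wooded by (auto simp: wooded_triangulation_def simple_triangulation_def)

sublocale rotation_system S
  using planar by (rule simple_planar_map_rotation_system)

lemma cw_cw: "(v, u) \<in> darts S \<Longrightarrow> cw S (cw S v u) v = u"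
  using triangulation faces_triangles_iff by (auto simp: simple_triangulation_def)

abbreviation "b \<equiv> corner S Blue"
abbreviation "g \<equiv> corner S Green"
abbreviation "r \<equiv> corner S Red"

lemma outer_darts: "(b, g) \<in> darts S" "(g, r) \<in> darts S" "(r, b) \<in> darts S"
  and cw_outer: "cw S g b = r" "cw S r g = b" "cw S b r = g"
  and distinct_corners: "b \<noteq> g" "g \<noteq> r" "r \<noteq> b"
proof -
  obtain d where d: "d \<in> darts S" and o: "{(b, g), (g, r), (r, b)} = orbit (face_succ S) d"
    using triangulation by (auto simp: simple_triangulation_def faces_def)
  show od: "(b, g) \<in> darts S" "(g, r) \<in> darts S" "(r, b) \<in> darts S"
    using cyclic_on_face(2)[OF d] unfolding o[symmetric] by auto
  then show ne: "b \<noteq> g" "g \<noteq> r" "r \<noteq> b" using irrefl_darts by metis+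
  have f: "face_succ S e \<in> {(b, g), (g, r), (r, b)}" if "e \<in> {(b, g), (g, r), (r, b)}" for e
    using that unfolding o by (rule orbit.step)
  show "cw S g b = r" "cw S r g = b" "cw S b r = g"
    using f[of "(b, g)"] f[of "(g, r)"] f[of "(r, b)"] ne by (auto simp: face_succ_def)
qed

lemma inj_corner: "inj (corner S)"
proof (rule injI)
  fix c c' assume "corner S c = corner S c'"
  then show "c = c'" using distinct_corners by (cases c; cases c') auto
qed

lemma corner_darts: "c \<noteq> c' \<Longrightarrow> (corner S c, corner S c') \<in> darts S"
  using outer_darts sym_darts by (cases c; cases c') auto

lemma orientation:
  "arcs S \<subseteq> inner_darts S"
  "\<forall>(u, v)\<in>inner_darts S. (u, v) \<in> arcs S \<longleftrightarrow> (v, u) \<notin> arcs S"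
  "\<forall>v\<in>inner_verts S. card {w. (v, w) \<in> arcs S} = 3"
  using wood by (auto simp: schnyder_wood_def three_orientation_def)

lemma arc_dart: "(u, v) \<in> arcs S \<Longrightarrow> (u, v) \<in> darts S"
  using orientation(1) by (auto simp: inner_darts_def)

lemma corner_verts: "corner S c \<in> verts S"
  using wooded_triangulationD(3)[OF wooded] by auto

lemma card_verts: "card (verts S) = n + 3"
proof -
  have "card (range (corner S)) = 3"
    using card_image[OF inj_corner] by (simp add: UNIV_colour)
  then show ?thesis
    using triangulation corner_verts finite_verts card_Diff_subset[of "range (corner S)" "verts S"]
      card_mono[of "verts S" "range (corner S)"]
    by (auto simp: simple_triangulation_def inner_verts_def image_subset_iff)
qed

text \<open>
  Euler's formula leaves \<open>3 * n\<close> inner edges, and the inner vertices already account for \<open>3 * n\<close> arcs.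
\<close>

lemma arc_tail:
  assumes "(u, v) \<in> arcs S"
  shows "u \<in> inner_verts S"
proof (rule ccontr)
  assume u: "u \<notin> inner_verts S"
  let ?f = "\<lambda>v. card {w. (v, w) \<in> arcs S}"
  have sub: "arcs S \<subseteq> verts S \<times> verts S" using arc_dart darts_verts by auto
  have fin: "finite {w. (v, w) \<in> arcs S}" for v
    by (rule finite_subset[OF _ finite_verts]) (use sub in auto)
  have uv: "u \<in> verts S" using assms sub by auto
  have "card (arcs S) = sum ?f (verts S)"
    by (rule card_arcs_sum[OF finite_verts sub])
  also have "\<dots> = sum ?f (inner_verts S) + sum ?f (verts S - inner_verts S)"
    by (subst add.commute, rule sum.subset_diff) (use finite_verts in \<open>auto simp: inner_verts_def\<close>)
  also have "sum ?f (inner_verts S) = 3 * n"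
    using orientation(3) triangulation by (simp add: simple_triangulation_def)
  finally have "card (arcs S) \<ge> 3 * n + ?f u"
    using member_le_sum[of u "verts S - inner_verts S" ?f] u uv finite_verts by simp
  moreover have "?f u > 0" using assms fin by (auto simp: card_gt_0_iff)
  ultimately have A: "card (arcs S) > 3 * n" by simp
  have "card (verts S) + card (faces S) = card (edges S) + 2"
    using planar by (auto simp: simple_planar_map_def)
  moreover have "card (darts S) = 3 * card (faces S)"
    using card_faces triangulation by (auto simp: simple_triangulation_def)
  moreover have "card (darts S) = 6 + 2 * card (arcs S)"
    by (rule card_darts_three_orientation[OF rotation_system_axioms inj_corner corner_darts orientation(1,2)])
  ultimately show False using A card_edges card_verts by linarith
qed

lemma inner_vertsD: "v \<in> inner_verts S \<Longrightarrow> v \<in> verts S \<and> v \<noteq> corner S c"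
  by (auto simp: inner_verts_def)

lemma inner_dart_arc:
  assumes "(u, v) \<in> darts S" "u \<in> inner_verts S"
  shows "(u, v) \<in> arcs S \<or> (v, u) \<in> arcs S"
proof -
  have "(u, v) \<in> inner_darts S" using assms by (auto simp: inner_darts_def inner_verts_def)
  then show ?thesis using orientation(2) by auto
qed

lemma corner_arc: "(u, corner S c) \<in> arcs S \<Longrightarrow> col S (u, corner S c) = c"
  using wood by (auto simp: schnyder_wood_def)

definition arc_of :: "colour \<Rightarrow> ('v \<times> 'v) set" where
  "arc_of c = {a \<in> arcs S. col S a = c}"

lemma arc_of_arcs: "a \<in> arc_of c \<Longrightarrow> a \<in> arcs S"
  by (simp add: arc_of_def)

text \<open>
  Number the neighbours of \<open>v\<close> clockwise, starting with the head of its blue arc, and let the heads of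
  the green and the red arc have the numbers \<open>i\<close> and \<open>j\<close>.  Then the three sectors of the Schnyder
  condition are intervals of numbers, and an edge strictly inside an interval must be an incoming arc of
  the colour that belongs there.  Hence, turning clockwise, only incoming red arcs come between the
  outgoing blue and the outgoing green arc, and only incoming blue arcs between the outgoing green and
  the outgoing red one.
\<close>

lemma turning:
  assumes v: "v \<in> inner_verts S"
  shows arc_of_unique: "(v, x) \<in> arc_of c \<Longrightarrow> (v, y) \<in> arc_of c \<Longrightarrow> x = y"
    and cw_Blue_Green: "(v, x) \<in> arc_of Blue \<or> (x, v) \<in> arc_of Red \<Longrightarrow>
      (cw S v x, v) \<in> arc_of Red \<or> (v, cw S v x) \<in> arc_of Green"
    and cw_Green_Red: "(v, x) \<in> arc_of Green \<or> (x, v) \<in> arc_of Blue \<Longrightarrow>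
      (cw S v x, v) \<in> arc_of Blue \<or> (v, cw S v x) \<in> arc_of Red"
proof -
  obtain out where out: "{w. (v, w) \<in> arcs S} = range out" "\<And>c. col S (v, out c) = c"
    and G: "out Green \<in> sector S v (out Blue) (out Red)"
    and into: "\<And>u. (u, v) \<in> arcs S \<Longrightarrow>
       (case col S (u, v) of
              Blue \<Rightarrow> u \<in> sector S v (out Green) (out Red)
            | Red \<Rightarrow> u \<in> sector S v (out Blue) (out Green)
            | Green \<Rightarrow> u \<in> sector S v (out Red) (out Blue))"
    using wood v unfolding schnyder_wood_def schnyder_at_def by blast
  have arc_out: "(v, x) \<in> arc_of c \<longleftrightarrow> x = out c" for x c
  proof -
    have "(v, x) \<in> arcs S \<longleftrightarrow> (\<exists>c'. x = out c')" using out(1) by blast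
    then show ?thesis using out(2) by (auto simp: arc_of_def)
  qed
  show "(v, x) \<in> arc_of c \<Longrightarrow> (v, y) \<in> arc_of c \<Longrightarrow> x = y"
    by (simp add: arc_out)
  have inj: "out c = out c' \<longleftrightarrow> c = c'" for c c' using out(2) by metis
  define f where "f = cw S v"
  have cyc: "cyclic_on f (nbrs S v)" using cyclic_cw v by (auto simp: f_def inner_verts_def)
  have nbr: "out c \<in> nbrs S v" for c
    using out(1) arc_dart by (auto simp: nbrs_def)
  then have orb: "orbit f (out c) = nbrs S v" for c using orbit_cyclic_eq3[OF cyc] by simp
  let ?B = "out Blue" and ?G = "out Green" and ?R = "out Red"
  \<comment> \<open>The neighbours are \<open>X 0, \<dots>, X (d - 1)\<close>; the green arc ends at \<open>X i\<close>, the red one at \<open>X j\<close>.\<close>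
  define X where "X i = (f ^^ i) ?B" for i
  define d where "d = funpow_dist1 f ?B ?B"
  define j where "j = funpow_dist1 f ?B ?R"
  define i where "i = funpow_dist1 f ?B ?G"
  have XB: "X d = ?B" "X 0 = ?B" and XR: "X j = ?R" and XG: "X i = ?G"
    using funpow_dist1_prop[of _ f ?B] orb nbr unfolding X_def d_def j_def i_def by auto
  have X_inj: "X a = X a' \<longleftrightarrow> a = a'" if "a < d" "a' < d" for a a'
    using inj_on_funpow_dist1[of ?B f ?B] that orb nbr unfolding X_def d_def inj_on_def by auto
  obtain m where m: "?G = X m" "0 < m" "m < j"
    using G unfolding sector_def X_def j_def f_def by blast
  have "\<not> m < i"
    using funpow_dist1_least[of m f ?B ?G] m unfolding i_def X_def by metis
  then have ij: "i < j" using m by simp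
  have "j \<le> d"
    unfolding j_def d_def
    by (rule funpow_dist1_le_self)
      (use XB orb nbr in \<open>auto simp: X_def d_def\<close>)
  moreover have "j \<noteq> d" using XB XR inj[of Blue Red] by auto
  ultimately have jd: "j < d" by simp
  have i0: "0 < i" by (simp add: i_def)
  have "j = i + funpow_dist1 f ?G ?R"
    unfolding j_def i_def by (rule funpow_dist1_dist) (use ij orb nbr in \<open>auto simp: i_def j_def\<close>)
  then have GR: "funpow_dist1 f ?G ?R = j - i" by simp
  have "d = j + funpow_dist1 f ?R ?B"
    unfolding d_def j_def by (rule funpow_dist1_dist) (use jd orb nbr in \<open>auto simp: d_def j_def\<close>)
  then have RB: "funpow_dist1 f ?R ?B = d - j" by simp
  have shift: "(f ^^ k) (X a) = X (k + a)" for k a by (simp add: X_def funpow_add)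
  have sBG: "sector S v ?B ?G = {X a |a. 0 < a \<and> a < i}"
    by (simp add: sector_def f_def[symmetric] i_def X_def)
  have sGR: "sector S v ?G ?R = {X a |a. i < a \<and> a < j}"
  proof -
    have "sector S v ?G ?R = {(f ^^ k) (X i) |k. 0 < k \<and> k < j - i}"
      by (simp only: sector_def f_def[symmetric] GR XG)
    also have "\<dots> = {X a |a. i < a \<and> a < j}"
      unfolding shift
    proof safe
      fix a assume "i < a" "a < j"
      then show "\<exists>k. X a = X (k + i) \<and> 0 < k \<and> k < j - i" by (intro exI[of _ "a - i"]) auto
    qed auto
    finally show ?thesis .
  qed
  have sRB: "sector S v ?R ?B = {X a |a. j < a \<and> a < d}"
  proof -
    have "sector S v ?R ?B = {(f ^^ k) (X j) |k. 0 < k \<and> k < d - j}"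
      by (simp only: sector_def f_def[symmetric] RB XR)
    also have "\<dots> = {X a |a. j < a \<and> a < d}"
      unfolding shift
    proof safe
      fix a assume "j < a" "a < d"
      then show "\<exists>k. X a = X (k + j) \<and> 0 < k \<and> k < d - j" by (intro exI[of _ "a - j"]) auto
    qed auto
    finally show ?thesis .
  qed
  have arc_X: "(v, X a) \<in> arcs S \<longleftrightarrow> a = 0 \<or> a = i \<or> a = j" if "a < d" for a
  proof -
    have "(v, X a) \<in> arcs S \<longleftrightarrow> (\<exists>c. X a = out c)" using out(1) by blast
    also have "\<dots> \<longleftrightarrow> X a = X 0 \<or> X a = X i \<or> X a = X j"
      unfolding ex_colour XB XR XG by blast
    finally show ?thesis using X_inj that ij jd i0 by auto
  qed
  have into_X: "case col S (X a, v) of Blue \<Rightarrow> i < a \<and> a < j | Red \<Rightarrow> 0 < a \<and> a < i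
      | Green \<Rightarrow> j < a \<and> a < d" if a: "a < d" and arc: "(X a, v) \<in> arcs S" for a
  proof (cases "col S (X a, v)")
    case Blue
    then obtain a' where "X a = X a'" "i < a'" "a' < j" using into[OF arc] sGR by auto
    then show ?thesis using X_inj[of a a'] a jd Blue by simp
  next
    case Green
    then obtain a' where "X a = X a'" "j < a'" "a' < d" using into[OF arc] sRB by auto
    then show ?thesis using X_inj[of a a'] a Green by simp
  next
    case Red
    then obtain a' where "X a = X a'" "0 < a'" "a' < i" using into[OF arc] sBG by auto
    then show ?thesis using X_inj[of a a'] a ij jd Red by simp
  qed
  have X_nbr: "(v, X a) \<in> darts S" for a
    using cyclic_on_funpow_in[OF cyc nbr[of Blue], of a] by (simp add: X_def nbrs_def)
  have next_X: "cw S v (X a) = X (Suc a)" for a by (simp add: X_def f_def)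
  have red: "(X a, v) \<in> arc_of Red" if "0 < a" "a < i" for a
  proof -
    have "(X a, v) \<in> arcs S"
      using inner_dart_arc[OF X_nbr v] arc_X[of a] that ij jd by auto
    then show ?thesis using into_X[of a] that ij jd by (auto simp: arc_of_def split: colour.splits)
  qed
  have blue: "(X a, v) \<in> arc_of Blue" if "i < a" "a < j" for a
  proof -
    have "(X a, v) \<in> arcs S"
      using inner_dart_arc[OF X_nbr v] arc_X[of a] that ij jd by auto
    then show ?thesis using into_X[of a] that ij jd by (auto simp: arc_of_def split: colour.splits)
  qed
  show "(cw S v x, v) \<in> arc_of Red \<or> (v, cw S v x) \<in> arc_of Green"
    if x: "(v, x) \<in> arc_of Blue \<or> (x, v) \<in> arc_of Red"
  proof -
    have "\<exists>a<i. x = X a"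
      using x
    proof
      assume "(v, x) \<in> arc_of Blue"
      then show ?thesis using i0 XB by (auto simp: arc_out)
    next
      assume "(x, v) \<in> arc_of Red"
      then show ?thesis using into[of x] sBG by (auto simp: arc_of_def)
    qed
    then obtain a where a: "a < i" "x = X a" by blast
    then show ?thesis
      using red[of "Suc a"] XG by (cases "Suc a = i") (auto simp: next_X arc_out)
  qed
  show "(cw S v x, v) \<in> arc_of Blue \<or> (v, cw S v x) \<in> arc_of Red"
    if x: "(v, x) \<in> arc_of Green \<or> (x, v) \<in> arc_of Blue"
  proof -
    have "\<exists>a. i \<le> a \<and> a < j \<and> x = X a"
      using x
    proof
      assume "(v, x) \<in> arc_of Green"
      then show ?thesis using ij XG by (auto simp: arc_out)
    next
      assume "(x, v) \<in> arc_of Blue"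
      then show ?thesis using into[of x] sGR by (auto simp: arc_of_def intro: less_imp_le)
    qed
    then obtain a where a: "i \<le> a" "a < j" "x = X a" by blast
    then show ?thesis
      using blue[of "Suc a"] XR by (cases "Suc a = j") (auto simp: next_X arc_out)
  qed
qed

end

section \<open>Every wooded triangulation is built by some moves\<close>

context wooded
begin

definition embeds :: "(nat \<Rightarrow> 'v) \<Rightarrow> state \<Rightarrow> bool" where
  "embeds h \<sigma> \<longleftrightarrow> inj_on h {..<fresh \<sigma>} \<and>
     (\<forall>v<fresh \<sigma>. \<forall>x\<in>set (rot \<sigma> v). (h v, h x) \<in> darts S) \<and>
     (\<forall>v x y. nxt \<sigma> v x y \<longrightarrow> cw S (h v) (h x) = h y)"

lemma nxt_less:
  assumes "building \<sigma>" "nxt \<sigma> v x y"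
  shows "v < fresh \<sigma>" "x \<in> set (rot \<sigma> v)" "y \<in> set (rot \<sigma> v)" "x < fresh \<sigma>" "y < fresh \<sigma>"
proof -
  interpret building \<sigma> by fact
  show v: "v < fresh \<sigma>" using assms by (simp add: nxt_def)
  show xy: "x \<in> set (rot \<sigma> v)" "y \<in> set (rot \<sigma> v)"
    using assms(2) rot_Nil[OF v] by (auto simp: nxt_def dest: consec_set)
  show "x < fresh \<sigma>" "y < fresh \<sigma>" using rot_less[OF v] xy by auto
qed

text \<open>
  A triangle of \<open>S\<close> can be read off at each of its three corners by \<open>cw_cw\<close>.  The rotation around the
  new vertex \<open>z\<close> therefore determines all successions that appear at its neighbours.
\<close>

lemma embeds_attach:
  assumes "building \<sigma>" and sp: "spine \<sigma> = p # sp" and st: "stack \<sigma> = ys @ s # zs"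
    and e: "embeds h \<sigma>" and z: "z \<notin> h ` {..<fresh \<sigma>}"
    and zd: "\<And>x. x \<in> set (p # ys @ [s]) \<Longrightarrow> (z, h x) \<in> darts S"
    and zc: "\<And>x y. consec (p # ys @ [s]) x y \<Longrightarrow> cw S z (h x) = h y"
  shows "embeds (h(fresh \<sigma> := z)) (attach (length ys) \<sigma>)"
proof -
  interpret building \<sigma> by fact
  note f = attach_fields[OF sp st] and c = attach_context[OF sp st] and n = nxt_attach[OF sp st]
  let ?l = "p # ys @ [s]" and ?k = "fresh \<sigma>" and ?\<sigma> = "attach (length ys) \<sigma>"
  let ?h = "h(?k := z)"
  have lk: "x < ?k" if "x \<in> set ?l" for x using c(1,2) c(3)[of x] that by auto
  have hl: "?h x = h x" if "x < ?k" for x using that by simp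
  show ?thesis
    unfolding embeds_def
  proof (intro conjI allI impI ballI)
    show "inj_on ?h {..<fresh ?\<sigma>}"
      using e z by (auto simp: f embeds_def lessThan_Suc inj_on_def)
    show "(?h v, ?h x) \<in> darts S" if vx: "v < fresh ?\<sigma>" "x \<in> set (rot ?\<sigma> v)" for v x
    proof -
      have *: "(h v, h x) \<in> darts S" if "v < ?k" "x \<in> set (rot \<sigma> v)" for v x
        using that e by (auto simp: embeds_def)
      consider "v = ?k" "x \<in> set ?l" | "v < ?k" "x \<in> set (rot \<sigma> v)" | "v \<in> set ?l" "x = ?k"
        using vx by (auto simp: f split: if_splits)
      then show ?thesis
      proof cases
        case 1
        then show ?thesis using zd[of x] lk[of x] by auto
      next
        case 2
        then show ?thesis using *[of v x] rot_less[of v x] by auto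
      next
        case 3
        then show ?thesis using zd[of v] lk[of v] sym_darts by auto
      qed
    qed
    show "cw S (?h v) (?h x) = ?h y" if vxy: "nxt ?\<sigma> v x y" for v x y
    proof -
      consider "nxt \<sigma> v x y" | "v = ?k" "consec ?l x y" | "x = ?k" "consec ?l y v"
        | "y = ?k" "consec ?l v x"
        using vxy unfolding n by blast
      then show ?thesis
      proof cases
        case 1
        then show ?thesis
          using nxt_less[OF assms(1) 1] e by (auto simp: embeds_def)
      next
        case 2
        then show ?thesis using zc[OF 2(2)] consec_set[OF 2(2)] lk[of x] lk[of y] by auto
      next
        case 3
        then have "cw S (cw S z (h y)) z = h y" using consec_set[OF 3(2)] cw_cw zd by blast
        then show ?thesis
          using zc[OF 3(2)] consec_set[OF 3(2)] lk[of v] lk[of y] 3(1) by auto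
      next
        case 4
        have "(z, h v) \<in> darts S" "(z, h x) \<in> darts S" using consec_set[OF 4(2)] zd by blast+
        moreover have "cw S (h x) z = h v"
          using cw_cw[OF calculation(1)] zc[OF 4(2)] by simp
        ultimately have "cw S (h v) (h x) = z"
          using cw_cw sym_darts by metis
        then show ?thesis
          using consec_set[OF 4(2)] lk[of v] lk[of x] 4(1) by auto
      qed
    qed
  qed
qed

text \<open>
  The last clause says that the contour has left a stack vertex \<open>y\<close> when only its red arc was next:
  in \<open>S\<close> this arc follows the last neighbour of \<open>y\<close> that has been built.
\<close>

definition simulates :: "(nat \<Rightarrow> 'v) \<Rightarrow> state \<Rightarrow> bool" where
  "simulates h \<sigma> \<longleftrightarrow> building \<sigma> \<and> embeds h \<sigma> \<and> h 0 = b \<and> h 1 = g \<and> r \<notin> h ` {..<fresh \<sigma>} \<and>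
     (\<forall>v c. 2 \<le> v \<and> v < fresh \<sigma> \<and> (c = Red \<longrightarrow> v \<notin> set (front \<sigma>)) \<longrightarrow>
        (h v, h (out \<sigma> v c)) \<in> arc_of c) \<and>
     (\<forall>y\<in>set (stack \<sigma>). y \<noteq> 1 \<longrightarrow> (h y, cw S (h y) (h (last (rot \<sigma> y)))) \<in> arc_of Red)"

lemma simulates_start: "simulates (\<lambda>v. if v = 0 then b else g) start"
proof -
  let ?h = "\<lambda>v :: nat. if v = 0 then b else g"
  have "embeds ?h start"
    unfolding embeds_def
  proof (intro conjI)
    show "inj_on ?h {..<fresh start}"
      using distinct_corners(1) by (auto simp: start_def inj_on_def)
    show "\<forall>v<fresh start. \<forall>x\<in>set (rot start v). (?h v, ?h x) \<in> darts S"
      using outer_darts(1) sym_darts by (auto simp: start_def)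
  qed (auto simp: nxt_def start_def front_def consec_Cons)
  moreover have "r \<notin> ?h ` {..<fresh start}"
    using distinct_corners by (auto split: if_splits)
  ultimately show ?thesis
    using building_start by (auto simp: simulates_def start_def)
qed

end

locale simulation = wooded n S + building \<sigma> for n and S :: "'v wooded_map" and \<sigma> +
  fixes h :: "nat \<Rightarrow> 'v"
  assumes simulates: "simulates h \<sigma>"
begin

lemma inj_h: "x < fresh \<sigma> \<Longrightarrow> y < fresh \<sigma> \<Longrightarrow> h x = h y \<longleftrightarrow> x = y"
  and dart_h: "v < fresh \<sigma> \<Longrightarrow> x \<in> set (rot \<sigma> v) \<Longrightarrow> (h v, h x) \<in> darts S"
  and cw_h: "nxt \<sigma> v x y \<Longrightarrow> cw S (h v) (h x) = h y"
  and h0: "h 0 = b" and h1: "h 1 = g" and r_h: "r \<notin> h ` {..<fresh \<sigma>}"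
  and arc_h: "2 \<le> v \<Longrightarrow> v < fresh \<sigma> \<Longrightarrow> (c = Red \<Longrightarrow> v \<notin> set (front \<sigma>)) \<Longrightarrow>
    (h v, h (out \<sigma> v c)) \<in> arc_of c"
  and stack_h: "y \<in> set (stack \<sigma>) \<Longrightarrow> y \<noteq> 1 \<Longrightarrow>
    (h y, cw S (h y) (h (last (rot \<sigma> y)))) \<in> arc_of Red"
  using simulates by (auto simp: simulates_def embeds_def inj_on_def)

lemma h_verts: "v < fresh \<sigma> \<Longrightarrow> h v \<in> verts S"
  using dart_h[of v "hd (rot \<sigma> v)"] rot_Nil[of v] darts_verts by auto

lemma h_inner: "2 \<le> v \<Longrightarrow> v < fresh \<sigma> \<Longrightarrow> h v \<in> inner_verts S"
proof -
  assume v: "2 \<le> v" "v < fresh \<sigma>"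
  then have "h v \<noteq> h 0" "h v \<noteq> h 1" "h v \<in> h ` {..<fresh \<sigma>}"
    using inj_h[of v 0] inj_h[of v 1] by auto
  then have "h v \<noteq> h 0" "h v \<noteq> h 1" "h v \<noteq> r" using r_h by metis+
  then have "h v \<noteq> corner S c" for c
    using h0 h1 by (cases c) auto
  then show ?thesis using h_verts[OF v(2)] by (auto simp: inner_verts_def)
qed

lemma inner_h_ge: "v < fresh \<sigma> \<Longrightarrow> h v \<in> inner_verts S \<Longrightarrow> 2 \<le> v"
  using h0 h1 inner_vertsD[of "h v"] by (cases "v = 0"; cases "v = 1") auto

lemma stack_last: "stack \<sigma> = pre @ y # y' # rest \<Longrightarrow> last (rot \<sigma> y) = y'"
  using front_ends[of y y'] by (auto simp: front_def consec_append consec_Cons)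

text \<open>
  The only red arc of \<open>y\<close> comes directly after its last neighbour, so this neighbour, \<open>y\<close> and the head
  \<open>z\<close> of the arc form a triangle.
\<close>

lemma cw_stack:
  assumes "y \<in> set (stack \<sigma>)" "y \<noteq> 1" "(h y, z) \<in> arc_of Red"
  shows "cw S z (h y) = h (last (rot \<sigma> y))"
proof -
  have y: "2 \<le> y" "y < fresh \<sigma>" using stack_ge stack_less assms by auto
  have "z = cw S (h y) (h (last (rot \<sigma> y)))"
    using arc_of_unique[OF h_inner[OF y] assms(3) stack_h[OF assms(1,2)]] .
  moreover have "(h y, h (last (rot \<sigma> y))) \<in> darts S"
    using dart_h[OF y(2)] rot_Nil[OF y(2)] by simp
  ultimately show ?thesis using cw_cw by simp
qed

text \<open>
  Behind its blue arc, \<open>z\<close> meets incoming red arcs until its green arc is reached.  The tail of an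
  incoming red arc is the top of the remaining stack, and the triangle of \<open>cw_stack\<close> shows that the next
  neighbour of \<open>z\<close> is the vertex below it.
\<close>

lemma fan:
  assumes z: "z \<in> inner_verts S"
  shows "stack \<sigma> = pre @ rest \<Longrightarrow> rest \<noteq> [] \<Longrightarrow> cw S z (h x) = h (hd rest) \<Longrightarrow>
    (z, h x) \<in> arc_of Blue \<or> (h x, z) \<in> arc_of Red \<Longrightarrow>
    \<exists>ys s zs. rest = ys @ s # zs \<and> (\<forall>u w. consec (x # ys @ [s]) u w \<longrightarrow> cw S z (h u) = h w) \<and>
      (\<forall>y\<in>set ys. (h y, z) \<in> arc_of Red) \<and> (z, h s) \<in> arc_of Green"
proof (induction rest arbitrary: pre x)
  case (Cons y rest)
  have y: "y \<in> set (stack \<sigma>)" using Cons.prems by simp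
  have "(h y, z) \<in> arc_of Red \<or> (z, h y) \<in> arc_of Green"
    using cw_Blue_Green[OF z Cons.prems(4)] Cons.prems(3) by simp
  then show ?case
  proof
    assume "(z, h y) \<in> arc_of Green"
    then show ?thesis
      using Cons.prems(3)
      by - (rule exI[of _ "[]"], rule exI[of _ y], rule exI[of _ rest], auto simp: consec_Cons)
  next
    assume red: "(h y, z) \<in> arc_of Red"
    then have y1: "y \<noteq> 1"
      using arc_tail[OF arc_of_arcs[OF red]] h1 inner_vertsD by auto
    then obtain y' rest' where rest: "rest = y' # rest'"
      using stack(2) Cons.prems(1) by (cases rest) auto
    have "cw S z (h y) = h y'"
      using cw_stack[OF y y1 red] stack_last[of pre y y' rest'] Cons.prems(1) rest by simp
    then obtain ys s zs where r: "rest = ys @ s # zs"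
      "\<forall>u w. consec (y # ys @ [s]) u w \<longrightarrow> cw S z (h u) = h w"
      "\<forall>y\<in>set ys. (h y, z) \<in> arc_of Red" "(z, h s) \<in> arc_of Green"
      using Cons.IH[of "pre @ [y]" y] Cons.prems(1) rest red by auto
    show ?thesis
    proof (rule exI[of _ "y # ys"], rule exI[of _ s], rule exI[of _ zs], intro conjI allI impI ballI)
      show "cw S z (h u) = h w" if "consec (x # (y # ys) @ [s]) u w" for u w
        using that r(2) Cons.prems(3) by (auto simp: consec_Cons[of x])
    qed (use r red in auto)
  qed
qed simp

text \<open>
  As corners have no outgoing arcs, an inner edge at \<open>A\<^sub>r\<close> is a red arc into \<open>A\<^sub>r\<close>, and the triangles of
  \<open>cw_stack\<close> lead down the whole stack.
\<close>

lemma last_fan: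
  "stack \<sigma> = pre @ rest \<Longrightarrow> rest \<noteq> [] \<Longrightarrow> (r, h (hd rest)) \<in> darts S \<Longrightarrow>
    (\<forall>y\<in>set rest. (r, h y) \<in> darts S) \<and> (\<forall>u w. consec rest u w \<longrightarrow> cw S r (h u) = h w) \<and>
    (\<forall>y\<in>set rest. y \<noteq> 1 \<longrightarrow> (h y, r) \<in> arc_of Red)"
proof (induction rest arbitrary: pre)
  case (Cons y rest)
  have y: "y \<in> set (stack \<sigma>)" using Cons.prems by simp
  show ?case
  proof (cases rest)
    case Nil
    then have "y = 1" using Cons.prems(1) stack(2) by simp
    then show ?thesis using Nil Cons.prems(3) by (simp add: consec_Cons)
  next
    case (Cons y' rest')
    have st: "stack \<sigma> = pre @ y # y' # rest'" using Cons Cons.prems(1) by simp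
    have "1 \<in> set (y' # rest')" using stack(2) st last_in_set[of "y' # rest'"] by auto
    then have y1: "y \<noteq> 1" using distinct_front st by (auto simp: front_def)
    have yi: "h y \<in> inner_verts S" using h_inner[of y] stack_ge[OF y y1] by simp
    have "(h y, r) \<in> darts S" using Cons.prems(3) sym_darts by simp
    moreover have "(r, h y) \<notin> arcs S" using arc_tail inner_vertsD by blast
    ultimately have "(h y, r) \<in> arcs S" using inner_dart_arc yi by blast
    then have red: "(h y, r) \<in> arc_of Red" using corner_arc by (simp add: arc_of_def)
    have c: "cw S r (h y) = h y'"
      using cw_stack[OF y y1 red] stack_last[OF st] by simp
    then have "(r, h y') \<in> darts S" using cw_dart[OF Cons.prems(3)] by simp
    then have "(\<forall>y\<in>set rest. (r, h y) \<in> darts S) \<and> (\<forall>u w. consec rest u w \<longrightarrow> cw S r (h u) = h w) \<and>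
      (\<forall>y\<in>set rest. y \<noteq> 1 \<longrightarrow> (h y, r) \<in> arc_of Red)"
      using Cons.IH[of "pre @ [y]"] st Cons by simp
    then show ?thesis using c red Cons Cons.prems(3) by (auto simp: consec_Cons[of y])
  qed
qed simp

text \<open>
  The current vertex and the neighbour of its image at which the exploration of \<open>S\<close> arrives next.
\<close>

abbreviation "p \<equiv> hd (spine \<sigma>)"
abbreviation "z \<equiv> cw S (h p) (h (hd (stack \<sigma>)))"

lemma p_front: "p \<in> set (front \<sigma>)" "p < fresh \<sigma>" "p \<noteq> 1" "last (rot \<sigma> p) = hd (stack \<sigma>)"
  using spine spine_less[of p] spine_neq_1[of p] last_rot_hd_spine by (auto simp: front_def)

lemma z_dart: "(h p, z) \<in> darts S"
  using cw_dart[OF dart_h[OF p_front(2), of "hd (stack \<sigma>)"]] p_front(4)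
    last_in_set[OF rot_Nil[OF p_front(2)]] by simp

text \<open>
  The last neighbour of an inner current vertex is the head of its green arc or the tail of a blue arc
  into it, to which \<open>cw_Green_Red\<close> applies.  At \<open>A\<^sub>b\<close> all inner edges are blue arcs into \<open>A\<^sub>b\<close>.
\<close>

lemma next_cases:
  obtains (retreat) "1 < length (spine \<sigma>)" "(h p, z) \<in> arc_of Red"
  | (attach) "(z, h p) \<in> arc_of Blue"
  | (close) "spine \<sigma> = [0]" "z = r"
proof (cases "p = 0")
  case True
  then obtain q where q: "spine \<sigma> = 0 # q" using spine by (cases "spine \<sigma>") auto
  have "q = []"
  proof (rule ccontr)
    assume "q \<noteq> []"
    then have "0 \<in> set q" using spine(2) q last_in_set[of q] by (metis last_ConsR)
    then show False using distinct_front q by (simp add: front_def)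
  qed
  then have sp: "spine \<sigma> = [0]" using q by simp
  show ?thesis
  proof (cases "z = r")
    case z: False
    have "z \<noteq> g"
    proof
      assume "z = g"
      then have "cw S b (h (hd (stack \<sigma>))) = cw S b r" using cw_outer True h0 by simp
      moreover have "(b, h (hd (stack \<sigma>))) \<in> darts S"
        using dart_h[OF p_front(2), of "hd (stack \<sigma>)"] p_front(4) True h0
          last_in_set[OF rot_Nil[OF p_front(2)]] by simp
      ultimately have "h (hd (stack \<sigma>)) = r" using cw_inj outer_darts(3) sym_darts by metis
      then show False using r_h stack_less[OF hd_in_set[OF stack(1)]] by force
    qed
    moreover have bz: "(b, z) \<in> darts S" using z_dart True h0 by simp
    moreover have "z \<noteq> b" using bz irrefl_darts by metis
    ultimately have "z \<noteq> corner S c" for c using z by (cases c) auto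
    then have "z \<in> inner_verts S" using bz darts_verts by (auto simp: inner_verts_def)
    moreover have "(b, z) \<notin> arcs S" using arc_tail inner_vertsD by blast
    ultimately have "(z, b) \<in> arcs S" using inner_dart_arc bz sym_darts by blast
    then have "(z, h p) \<in> arc_of Blue" using corner_arc True h0 by (simp add: arc_of_def)
    then show ?thesis by (rule attach)
  qed (use close sp in blast)
next
  case False
  then have p: "2 \<le> p" using p_front(3) by simp
  obtain gs rs bs where rp: "rot \<sigma> p = gs @ [out \<sigma> p Blue] @ rs @ [out \<sigma> p Green] @ bs"
    "set bs = into \<sigma> p Blue"
    using rot_inner[OF p p_front(2)] p_front(1) by auto
  have "(h p, h (hd (stack \<sigma>))) \<in> arc_of Green \<or> (h (hd (stack \<sigma>)), h p) \<in> arc_of Blue"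
  proof (cases "bs = []")
    case True
    then show ?thesis using rp p_front(4) arc_h[OF p p_front(2), of Green] by simp
  next
    case False
    then have "hd (stack \<sigma>) \<in> into \<sigma> p Blue"
      using rp p_front(4) last_in_set[OF False] by simp
    then show ?thesis using arc_h[of "hd (stack \<sigma>)" Blue] by (auto simp: into_def)
  qed
  from cw_Green_Red[OF h_inner[OF p p_front(2)] this] show ?thesis
  proof
    assume "(h p, z) \<in> arc_of Red"
    moreover have "1 < length (spine \<sigma>)"
      using False spine by (cases "spine \<sigma>") (auto split: if_splits)
    ultimately show ?thesis by (rule retreat[rotated])
  qed (rule attach)
qed

text \<open>
  If \<open>z\<close> had been built before, its blue arc would be known and \<open>z\<close> would already occur around the
  current vertex.  As \<open>z\<close> succeeds the last entry of the list there, it could only be the first entry,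
  but this is the previous vertex of the spine, which is older than \<open>p\<close>, or \<open>A\<^sub>g\<close> in case \<open>p\<close> is \<open>A\<^sub>b\<close>.
\<close>

lemma z_new:
  assumes "(z, h p) \<in> arc_of Blue"
  shows "z \<notin> h ` {..<fresh \<sigma>}"
proof
  assume "z \<in> h ` {..<fresh \<sigma>}"
  then obtain x where x: "x < fresh \<sigma>" "z = h x" by auto
  have zi: "z \<in> inner_verts S" using arc_tail[OF arc_of_arcs[OF assms]] .
  then have x2: "2 \<le> x" using inner_h_ge x by simp
  have "h (out \<sigma> x Blue) = h p"
    using arc_of_unique[OF zi assms, of "h (out \<sigma> x Blue)"] arc_h[OF x2 x(1), of Blue] x(2) by simp
  moreover have ox: "out \<sigma> x Blue < x" using out_less[OF x2 x(1)] by simp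
  ultimately have px: "out \<sigma> x Blue = p" using inj_h x(1) p_front(2) by simp
  then have xin: "x \<in> into \<sigma> p Blue" using x x2 by (simp add: into_def)
  have x_rot: "x \<in> set (rot \<sigma> p)"
  proof (cases "p = 0")
    case True then show ?thesis using rot_0 xin by auto
  next
    case False
    then show ?thesis using rot_inner[OF _ p_front(2)] p_front(3) xin by force
  qed
  have hdp: "x \<noteq> hd (rot \<sigma> p)"
  proof (cases "p = 0")
    case True
    then show ?thesis using rot_0 x2 by auto
  next
    case False
    obtain p' where p': "p' = p" by simp
    then obtain q sp where sp: "spine \<sigma> = p' # q # sp"
      using spine False by (cases "spine \<sigma>"; cases "tl (spine \<sigma>)") auto
    then have "consec (front \<sigma>) q p'" "consec (spine \<sigma>) p' q"
      by (auto simp: front_def consec_append consec_Cons)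
    then have "consec (front \<sigma>) q p" "consec (spine \<sigma>) p q" unfolding p' .
    then have "hd (rot \<sigma> p) = q" "out \<sigma> p Blue = q" using front_ends spine_out by auto
    moreover have "2 \<le> p" using False p_front(3) by simp
    ultimately show ?thesis using out_less[OF _ p_front(2)] ox px by auto
  qed
  then obtain x' where x': "consec (rot \<sigma> p) x' x" using consec_pred[OF x_rot] by auto
  then have "nxt \<sigma> p x' x" using p_front(2) by (simp add: nxt_def)
  then have "cw S (h p) (h x') = z" using cw_h x(2) by simp
  moreover have "(h p, h x') \<in> darts S" "(h p, h (hd (stack \<sigma>))) \<in> darts S"
    using dart_h[OF p_front(2)] consec_set[OF x'] p_front(4) last_in_set[OF rot_Nil[OF p_front(2)]]
    by auto
  ultimately have "h x' = h (hd (stack \<sigma>))" using cw_inj by metis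
  then have "x' = last (rot \<sigma> p)"
    using inj_h rot_less[OF p_front(2)] consec_set[OF x'] stack_less[OF hd_in_set[OF stack(1)]] p_front(4)
    by simp
  then show False using not_consec_last[OF distinct_rot[OF p_front(2)]] x' by simp
qed

lemma simulates_retreat:
  assumes "1 < length (spine \<sigma>)" "(h p, z) \<in> arc_of Red"
  shows "simulates h (retreat \<sigma>)"
proof -
  have f: "fresh (retreat \<sigma>) = fresh \<sigma>" "rot (retreat \<sigma>) = rot \<sigma>" "out (retreat \<sigma>) = out \<sigma>"
    "front (retreat \<sigma>) = front \<sigma>" "stack (retreat \<sigma>) = p # stack \<sigma>"
    using spine by (auto simp: retreat_def front_def rev_append[symmetric] simp flip: rev.simps(2))
  have "nxt (retreat \<sigma>) = nxt \<sigma>" by (simp add: fun_eq_iff nxt_def f)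
  then show ?thesis
    using simulates building_retreat[OF building_axioms assms(1)] assms(2) p_front(4)
    by (simp add: simulates_def embeds_def f)
qed

lemma attachment:
  assumes blue: "(z, h p) \<in> arc_of Blue"
  shows "\<exists>a<length (stack \<sigma>). simulates (h(fresh \<sigma> := z)) (attach a \<sigma>)"
proof -
  have zi: "z \<in> inner_verts S" using arc_tail[OF arc_of_arcs[OF blue]] .
  have "cw S z (h p) = h (hd (stack \<sigma>))"
    using cw_cw[OF dart_h[OF p_front(2), of "hd (stack \<sigma>)"]] p_front(4)
      last_in_set[OF rot_Nil[OF p_front(2)]] by simp
  then obtain ys s zs where st: "stack \<sigma> = ys @ s # zs"
    and zc: "\<And>u w. consec (p # ys @ [s]) u w \<Longrightarrow> cw S z (h u) = h w"
    and red: "\<And>y. y \<in> set ys \<Longrightarrow> (h y, z) \<in> arc_of Red" and green: "(z, h s) \<in> arc_of Green"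
    using fan[OF zi, of "[]" "stack \<sigma>" p] stack(1) blue by auto
  obtain sp where sp: "spine \<sigma> = p # sp" using spine by (cases "spine \<sigma>") auto
  note f = attach_fields[OF sp st] and c = attach_context[OF sp st]
  let ?\<sigma> = "attach (length ys) \<sigma>" and ?h = "h(fresh \<sigma> := z)"
  have zd: "(z, h x) \<in> darts S" if "x \<in> set (p # ys @ [s])" for x
    using that arc_dart[OF arc_of_arcs[OF blue]] arc_dart[OF arc_of_arcs[OF green]]
      arc_dart[OF arc_of_arcs[OF red]] sym_darts by auto
  have e: "embeds ?h ?\<sigma>"
    using simulates z_new[OF blue] zd zc
    by (intro embeds_attach[OF building_axioms sp st]) (auto simp: simulates_def)
  have "simulates ?h ?\<sigma>"
    unfolding simulates_def
  proof (intro conjI e allI impI ballI)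
    show "building ?\<sigma>" by (rule building_attach[OF building_axioms]) (simp add: st)
    show "?h 0 = b" "?h 1 = g" using h0 h1 fresh_ge by auto
    show "r \<notin> ?h ` {..<fresh ?\<sigma>}"
      using r_h inner_vertsD[OF zi, of Red] by (auto simp: f less_Suc_eq)
    show "(?h v, ?h (out ?\<sigma> v c)) \<in> arc_of c"
      if v: "2 \<le> v \<and> v < fresh ?\<sigma> \<and> (c = Red \<longrightarrow> v \<notin> set (front ?\<sigma>))" for v c
    proof -
      consider "v = fresh \<sigma>" | "v \<in> set ys" "c = Red" | "v < fresh \<sigma>" "\<not> (v \<in> set ys \<and> c = Red)"
        using v by (auto simp: f less_Suc_eq)
      then show ?thesis
      proof cases
        case 1
        then have "c \<noteq> Red" using v by (auto simp: f)
        then show ?thesis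
          using 1 blue green c(1,2) by (cases c) (auto simp: f)
      next
        case 2
        then show ?thesis using red[of v] attach_context(3)[OF sp st, of v] by (auto simp: f)
      next
        case 3
        have nf: "v \<notin> set (front \<sigma>)" if "c = Red"
          using 3 v that by (auto simp: f)
        have "out \<sigma> v c < fresh \<sigma>"
          using out_less[of v] out_Red_less[of v] nf 3 v by (cases c) auto
        then show ?thesis using arc_h[of v c] nf 3 v by (auto simp: f)
      qed
    qed
    show "(?h y, cw S (?h y) (?h (last (rot ?\<sigma> y)))) \<in> arc_of Red"
      if y: "y \<in> set (stack ?\<sigma>)" "y \<noteq> 1" for y
    proof -
      have ys: "y \<in> set (stack \<sigma>)" using y by (auto simp: f st)
      then have yl: "y < fresh \<sigma>" by (rule stack_less)
      have "y \<noteq> p" "y \<notin> set ys"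
        using y distinct_front by (auto simp: f)
      then have "last (rot ?\<sigma> y) = last (rot \<sigma> y)"
        using rot_Nil[OF yl] yl by (auto simp: f)
      moreover have "last (rot \<sigma> y) < fresh \<sigma>"
        using rot_less[OF yl] rot_Nil[OF yl] by simp
      ultimately show ?thesis using stack_h[OF ys y(2)] yl by simp
    qed
  qed
  then show ?thesis by (intro exI[of _ "length ys"]) (simp add: st)
qed

end

context wooded
begin

text \<open>
  The image of the rotation around \<open>v\<close> is closed under \<open>cw S\<close> and thus contains all neighbours; as \<open>S\<close>
  is connected, all vertices are reached.  The arcs agree because \<open>S\<close> has only one arc of each colour
  from an inner vertex.
\<close>

lemma embeds_iso:
  assumes "closed \<tau>" and e: "embeds h \<tau>"
    and h: "h 0 = b" "h 1 = g" "h (fresh \<tau> - 1) = r"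
    and arc: "\<And>v c. 2 \<le> v \<Longrightarrow> v < fresh \<tau> - 1 \<Longrightarrow> (h v, h (out \<tau> v c)) \<in> arc_of c"
  shows "wooded_iso h (wooded_of \<tau>) S"
proof -
  interpret C: closed \<tau> by fact
  have inj: "h x = h y \<longleftrightarrow> x = y" if "x < fresh \<tau>" "y < fresh \<tau>" for x y
    using e that by (auto simp: embeds_def inj_on_def)
  have dart: "(h v, h x) \<in> darts S" if "v < fresh \<tau>" "x \<in> set (rot \<tau> v)" for v x
    using e that by (auto simp: embeds_def)
  have hc: "h (corner (wooded_of \<tau>) c) = corner S c" for c
    using h by (cases c) auto
  have vert: "h v \<in> verts S" if "v < fresh \<tau>" for v
    using dart[OF that hd_in_set[OF C.rot_Nil[OF that]]] darts_verts by auto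
  have inner: "h v \<in> inner_verts S \<Longrightarrow> 2 \<le> v \<and> v < C.r" if "v < fresh \<tau>" for v
  proof (rule ccontr)
    assume hv: "h v \<in> inner_verts S" and "\<not> (2 \<le> v \<and> v < C.r)"
    then have "v = 0 \<or> v = 1 \<or> v = C.r" using that by auto
    then have "\<exists>c. h v = corner S c" using h by auto
    then show False using inner_vertsD[OF hv] by auto
  qed
  have cw: "cw S (h v) (h x) = h (cycle_of_list (rot \<tau> v) x)"
    if v: "v < fresh \<tau>" and x: "x \<in> set (rot \<tau> v)" for v x
  proof (cases "\<exists>y. nxt \<tau> v x y")
    case True
    then show ?thesis using C.cw_nxt e by (auto simp: embeds_def)
  next
    case False
    then have "x = last (rot \<tau> v)" "v = 0 \<or> v = 1 \<or> v = C.r"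
      using consec_succ[OF x] v by (auto simp: nxt_def C.in_front_iff)
    then show ?thesis using C.rot_ends C.cw_corners cw_outer h by auto
  qed
  have nbr: "w \<in> h ` set (rot \<tau> v)" if v: "v < fresh \<tau>" and w: "(h v, w) \<in> darts S" for v w
  proof -
    have hv: "h v \<in> verts S" by (rule vert[OF v])
    let ?x = "hd (rot \<tau> v)"
    have x: "?x \<in> set (rot \<tau> v)" using C.rot_Nil[OF v] by simp
    have "h ?x \<in> nbrs S (h v)" using dart[OF v x] by (simp add: nbrs_def)
    then have "orbit (cw S (h v)) (h ?x) = nbrs S (h v)"
      by (rule orbit_cyclic_eq3[OF cyclic_cw[OF hv]])
    then have "w \<in> orbit (cw S (h v)) (h ?x)" using w by (simp add: nbrs_def)
    then show ?thesis
    proof induction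
      case base
      then show ?case
        using cw[OF v x] rotation_system.cw_dart[OF C.rotation_system, of v ?x] v x by simp
    next
      case (step w)
      then obtain y where y: "y \<in> set (rot \<tau> v)" "w = h y" by auto
      then show ?case
        using cw[OF v y(1)] rotation_system.cw_dart[OF C.rotation_system, of v y] v by simp
    qed
  qed
  have verts: "h ` {..<fresh \<tau>} = verts S"
  proof
    show "h ` {..<fresh \<tau>} \<subseteq> verts S" using vert by auto
    show "verts S \<subseteq> h ` {..<fresh \<tau>}"
    proof
      fix w assume "w \<in> verts S"
      then have "(b, w) \<in> (darts S)\<^sup>*"
        using planar corner_verts[of Blue] by (auto simp: simple_planar_map_def)
      then show "w \<in> h ` {..<fresh \<tau>}"
      proof induction
        case base
        then show ?case using h(1) C.fresh_ge by (intro image_eqI[of _ _ 0]) auto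
      next
        case (step y w)
        then obtain v where v: "v < fresh \<tau>" "y = h v" by auto
        then show ?case using nbr[OF v(1)] step C.rot_less[OF v(1)] by auto
      qed
    qed
  qed
  show ?thesis
    unfolding wooded_iso_def
  proof (intro conjI ballI allI)
    show "bij_betw h (verts (wooded_of \<tau>)) (verts S)"
      using e verts by (simp add: bij_betw_def embeds_def)
    show "(u, v) \<in> darts (wooded_of \<tau>) \<longleftrightarrow> (h u, h v) \<in> darts S"
      if "u \<in> verts (wooded_of \<tau>)" "v \<in> verts (wooded_of \<tau>)" for u v
    proof
      assume "(h u, h v) \<in> darts S"
      then obtain x where "x \<in> set (rot \<tau> u)" "h v = h x" using nbr[of u "h v"] \<open>u \<in> _\<close> by auto
      then show "(u, v) \<in> darts (wooded_of \<tau>)" using that inj[of v x] C.rot_less[of u x] by auto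
    qed (use dart in auto)
    show "case d of (v, u) \<Rightarrow> h (cw (wooded_of \<tau>) v u) = cw S (h v) (h u)"
      if "d \<in> darts (wooded_of \<tau>)" for d
      using that cw by (auto split: prod.splits)
    show "h (corner (wooded_of \<tau>) c) = corner S c" for c by (rule hc)
    show "(u, v) \<in> arcs (wooded_of \<tau>) \<longleftrightarrow> (h u, h v) \<in> arcs S"
      if uv: "u \<in> verts (wooded_of \<tau>)" "v \<in> verts (wooded_of \<tau>)" for u v
    proof
      assume "(u, v) \<in> arcs (wooded_of \<tau>)"
      then show "(h u, h v) \<in> arcs S" using arc arc_of_arcs unfolding C.arcs_iff by blast
    next
      assume a: "(h u, h v) \<in> arcs S"
      have hu: "h u \<in> inner_verts S" by (rule arc_tail[OF a])
      then have u: "2 \<le> u" "u < C.r" using inner uv by auto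
      let ?c = "col S (h u, h v)"
      have "h v = h (out \<tau> u ?c)"
        using arc_of_unique[OF hu _ arc[OF u], of "h v" ?c] a by (simp add: arc_of_def)
      moreover have "out \<tau> u ?c < fresh \<tau>" using C.rot_less[of u] C.out_rot[OF u] u by simp
      ultimately have "v = out \<tau> u ?c" using inj uv by simp
      then show "(u, v) \<in> arcs (wooded_of \<tau>)" using u unfolding C.arcs_iff by blast
    qed
    show "case d of (u, v) \<Rightarrow> col S (h u, h v) = col (wooded_of \<tau>) (u, v)"
      if da: "d \<in> arcs (wooded_of \<tau>)" for d
    proof -
      obtain u c where d: "d = (u, out \<tau> u c)" "2 \<le> u" "u < C.r" using da by auto
      then show ?thesis using arc[of u c] C.col_out[of u c] by (simp add: arc_of_def)
    qed
  qed
qed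

end

context simulation
begin

lemma closing:
  assumes sp: "spine \<sigma> = [0]" and z: "z = r"
  shows "\<exists>h'. wooded_iso h' (wooded_of (close \<sigma>)) S"
proof -
  define ys where "ys = butlast (stack \<sigma>)"
  have st: "stack \<sigma> = ys @ 1 # []"
    using stack append_butlast_last_id[of "stack \<sigma>"] by (simp add: ys_def)
  note f = attach_fields[OF sp st]
  have cl: "close \<sigma> = attach (length ys) \<sigma>" by (simp add: close_def st)
  let ?h = "h(fresh \<sigma> := r)"
  have bd: "(b, h (hd (stack \<sigma>))) \<in> darts S"
    using dart_h[OF p_front(2), of "hd (stack \<sigma>)"] p_front(4) sp h0
      last_in_set[OF rot_Nil[OF p_front(2)]] by simp
  have cb: "cw S r b = h (hd (stack \<sigma>))"
    using cw_cw[OF bd] z sp h0 by simp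
  then have "(r, h (hd (stack \<sigma>))) \<in> darts S" using cw_dart[OF outer_darts(3)] by simp
  from last_fan[of "[]", OF _ stack(1) this]
  have fan: "\<And>y. y \<in> set (stack \<sigma>) \<Longrightarrow> (r, h y) \<in> darts S"
    "\<And>u w. consec (stack \<sigma>) u w \<Longrightarrow> cw S r (h u) = h w"
    "\<And>y. y \<in> set (stack \<sigma>) \<Longrightarrow> y \<noteq> 1 \<Longrightarrow> (h y, r) \<in> arc_of Red"
    by auto
  have e: "embeds ?h (close \<sigma>)"
    unfolding cl
  proof (rule embeds_attach[OF building_axioms sp st _ r_h])
    show "embeds h \<sigma>" using simulates by (simp add: simulates_def)
    show "(r, h x) \<in> darts S" if "x \<in> set (0 # ys @ [1])" for x
      using that fan(1)[of x] outer_darts(3) h0 by (auto simp: st)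
    show "cw S r (h x) = h y" if "consec (0 # ys @ [1]) x y" for x y
      using that fan(2)[of x y] cb h0 stack(1) by (auto simp: consec_Cons[of 0] st)
  qed
  have "wooded_iso ?h (wooded_of (close \<sigma>)) S"
  proof (rule embeds_iso[OF _ e])
    show "closed (close \<sigma>)" using building_close[OF building_axioms] sp by simp
    show "?h 0 = b" "?h 1 = g" using h0 h1 fresh_ge by auto
    show "?h (fresh (close \<sigma>) - 1) = r" by (simp add: cl f)
    show "(?h v, ?h (out (close \<sigma>) v c)) \<in> arc_of c" if v: "2 \<le> v" "v < fresh (close \<sigma>) - 1" for v c
    proof (cases "v \<in> set ys \<and> c = Red")
      case True
      then show ?thesis using fan(3)[of v] v by (auto simp: cl f st)
    next
      case False
      have vk: "v < fresh \<sigma>" using v by (simp add: cl f)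
      have nf: "v \<notin> set (front \<sigma>)" if "c = Red" using False that v by (auto simp: f)
      have "out \<sigma> v c < fresh \<sigma>"
        using out_less[of v] out_Red_less[of v] nf vk v by (cases c) auto
      then show ?thesis using arc_h[of v c] nf vk v False by (auto simp: cl f)
    qed
  qed
  then show ?thesis by blast
qed

lemma fresh_le: "fresh \<sigma> \<le> card (verts S)"
proof -
  have "card (h ` {..<fresh \<sigma>}) \<le> card (verts S)"
    using h_verts finite_verts by (intro card_mono) auto
  moreover have "inj_on h {..<fresh \<sigma>}" using inj_h by (auto simp: inj_on_def)
  ultimately show ?thesis by (simp add: card_image)
qed

end

context wooded
begin

text \<open>
  Every move raises \<open>2 * fresh \<sigma> - length (spine \<sigma>)\<close> by one, and \<open>fresh \<sigma>\<close> is bounded by the number of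
  vertices of \<open>S\<close>.
\<close>

lemma moves_from:
  "simulates h \<sigma> \<Longrightarrow> \<exists>ms h'. completes \<sigma> ms \<and>
     wooded_iso h' (wooded_of (run \<sigma> ms)) S"
proof (induction "2 * card (verts S) + length (spine \<sigma>) - 2 * fresh \<sigma>" arbitrary: h \<sigma> rule: less_induct)
  case less
  interpret building \<sigma> using less.prems by (simp add: simulates_def)
  interpret simulation n S \<sigma> h by unfold_locales (fact less.prems)
  have le: "2 * fresh \<sigma> \<le> 2 * card (verts S)" using fresh_le by simp
  have lens: "0 < length (spine \<sigma>)" "0 < length (stack \<sigma>)" using spine stack by auto
  show ?case
  proof (cases rule: next_cases)
    case retreat
    have f: "length (spine (retreat \<sigma>)) = length (spine \<sigma>) - 1" "fresh (retreat \<sigma>) = fresh \<sigma>"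
      "length (stack (retreat \<sigma>)) = Suc (length (stack \<sigma>))"
      by (simp_all add: retreat_def)
    then have "2 * card (verts S) + length (spine (retreat \<sigma>)) - 2 * fresh (retreat \<sigma>)
      < 2 * card (verts S) + length (spine \<sigma>) - 2 * fresh \<sigma>"
      using le lens by linarith
    then obtain ms h' where "completes (retreat \<sigma>) ms"
      "wooded_iso h' (wooded_of (run (retreat \<sigma>) ms)) S"
      using less.hyps[OF _ simulates_retreat[OF retreat]] by blast
    then show ?thesis
      using retreat(1) lens by (intro exI[of _ "Retreat # ms"] exI[of _ h']) (simp add: f)
  next
    case attach
    then obtain a where a: "a < length (stack \<sigma>)"
      and sim: "simulates (h(fresh \<sigma> := z)) (attach a \<sigma>)"
      using attachment by blast
    have f: "length (spine (attach a \<sigma>)) = Suc (length (spine \<sigma>))" "fresh (attach a \<sigma>) = Suc (fresh \<sigma>)"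
      "length (stack (attach a \<sigma>)) = length (stack \<sigma>) - a"
      by (simp_all add: attach_def Let_def)
    have "simulation n S (attach a \<sigma>) (h(fresh \<sigma> := z))"
      using sim wooded_axioms
      by (auto simp: simulation_def simulation_axioms_def simulates_def)
    then have "fresh (attach a \<sigma>) \<le> card (verts S)" by (rule simulation.fresh_le)
    then have "2 * card (verts S) + length (spine (attach a \<sigma>)) - 2 * fresh (attach a \<sigma>)
      < 2 * card (verts S) + length (spine \<sigma>) - 2 * fresh \<sigma>"
      using f by linarith
    then obtain ms h' where "completes (attach a \<sigma>) ms"
      "wooded_iso h' (wooded_of (run (attach a \<sigma>) ms)) S"
      using less.hyps[OF _ sim] by blast
    then show ?thesis
      using a lens by (intro exI[of _ "Attach a # ms"] exI[of _ h']) (simp add: f diff_right_commute)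
  next
    case close
    obtain h' where "wooded_iso h' (wooded_of (close \<sigma>)) S" using closing[OF close] by blast
    then show ?thesis using close(1) by (intro exI[of _ "[]"] exI[of _ h']) simp
  qed
qed

lemma moves_exist:
  obtains ms h where "fits 0 0 ms" "attachments ms = n" "wooded_iso h (wooded_of (run start ms)) S"
proof -
  obtain ms h where m: "fits 0 0 ms" and iso: "wooded_iso h (wooded_of (run start ms)) S"
    using moves_from[OF simulates_start] by (auto simp: start_def)
  have "card (verts (wooded_of (run start ms))) = card (verts S)"
    using iso bij_betw_same_card unfolding wooded_iso_def by blast
  moreover have "fresh (run start ms) = attachments ms + 3"
    using building_run[OF building_start, of ms] m by (simp add: start_def)
  ultimately have "attachments ms = n" using card_verts by simp
  then show ?thesis using that m iso by blast
qed

end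

section \<open>The contour of the blue tree of a built map\<close>

lemma run_induct [consumes 2, case_names close attach retreat]:
  assumes "building \<sigma>" "completes \<sigma> ms"
    and close: "\<And>\<sigma> ys. building \<sigma> \<Longrightarrow> spine \<sigma> = [0] \<Longrightarrow> stack \<sigma> = ys @ [1] \<Longrightarrow> P \<sigma> []"
    and attach: "\<And>\<sigma> p sp ys s zs ms. building \<sigma> \<Longrightarrow> spine \<sigma> = p # sp \<Longrightarrow> stack \<sigma> = ys @ s # zs \<Longrightarrow>
      building (attach (length ys) \<sigma>) \<Longrightarrow>
      completes (attach (length ys) \<sigma>) ms \<Longrightarrow>
      closed (run (attach (length ys) \<sigma>) ms) \<Longrightarrow>
      P (attach (length ys) \<sigma>) ms \<Longrightarrow> P \<sigma> (Attach (length ys) # ms)"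
    and retreat: "\<And>\<sigma> p q sp ms. building \<sigma> \<Longrightarrow> spine \<sigma> = p # q # sp \<Longrightarrow>
      building (retreat \<sigma>) \<Longrightarrow>
      completes (retreat \<sigma>) ms \<Longrightarrow>
      closed (run (retreat \<sigma>) ms) \<Longrightarrow>
      P (retreat \<sigma>) ms \<Longrightarrow> P \<sigma> (Retreat # ms)"
  shows "P \<sigma> ms"
  using assms(1,2)
proof (induction \<sigma> ms rule: run.induct)
  case (1 \<sigma>)
  interpret building \<sigma> by fact
  have "spine \<sigma> = [0]" using 1(2) spine by (cases "spine \<sigma>") auto
  moreover have "stack \<sigma> = butlast (stack \<sigma>) @ [1]"
    using stack append_butlast_last_id[of "stack \<sigma>"] by simp
  ultimately show ?case using close[OF 1(1)] by blast
next
  case (2 \<sigma> a ms)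
  interpret building \<sigma> by fact
  have a: "a < length (stack \<sigma>)" using 2(3) stack(1) by (cases "stack \<sigma>") auto
  obtain p sp where sp: "spine \<sigma> = p # sp" using spine by (cases "spine \<sigma>") auto
  obtain ys s zs where st: "stack \<sigma> = ys @ s # zs" "a = length ys"
    using id_take_nth_drop[OF a] a by (metis length_take min.absorb4)
  have b: "building (attach a \<sigma>)" by (rule building_attach[OF 2(2) a])
  have "length (stack (attach a \<sigma>)) = length (stack \<sigma>) - a"
    "length (spine (attach a \<sigma>)) = Suc (length (spine \<sigma>))"
    by (simp_all add: attach_def Let_def)
  then have f: "completes (attach a \<sigma>) ms"
    using 2(3) sp by (simp add: diff_right_commute)
  show ?case
    using attach[OF 2(2) sp st(1)] b f 2(1)[OF b f] building_run[OF b f] st(2) by simp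
next
  case (3 \<sigma> ms)
  interpret building \<sigma> by fact
  have a: "1 < length (spine \<sigma>)" using 3(3) by auto
  then obtain p q sp where sp: "spine \<sigma> = p # q # sp"
    by (cases "spine \<sigma>"; cases "tl (spine \<sigma>)") auto
  have b: "building (retreat \<sigma>)" by (rule building_retreat[OF 3(2) a])
  have "length (stack (retreat \<sigma>)) = Suc (length (stack \<sigma>))"
    "length (spine (retreat \<sigma>)) = length (spine \<sigma>) - 1"
    by (simp_all add: retreat_def)
  then have f: "completes (retreat \<sigma>) ms"
    using 3(3) sp stack(1) by (cases "stack \<sigma>") auto
  show ?case
    using retreat[OF 3(2) sp b f] 3(1)[OF b f] building_run[OF b f] by simp
qed

text \<open>
  How a state survives in later ones: rotations are extended at their ends, by newer vertices only, and
  nothing changes any more at a vertex that has left the front.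
\<close>

definition grows :: "state \<Rightarrow> state \<Rightarrow> bool" where
  "grows \<sigma> \<tau> \<longleftrightarrow> fresh \<sigma> \<le> fresh \<tau> \<and>
     (\<forall>v<fresh \<sigma>. \<exists>xs ys. rot \<tau> v = xs @ rot \<sigma> v @ ys \<and> (\<forall>x\<in>set (xs @ ys). fresh \<sigma> \<le> x)) \<and>
     (\<forall>v. 2 \<le> v \<and> v < fresh \<sigma> \<longrightarrow>
        out \<tau> v Blue = out \<sigma> v Blue \<and> out \<tau> v Green = out \<sigma> v Green \<and>
        (v \<notin> set (front \<sigma>) \<longrightarrow> v \<notin> set (front \<tau>) \<and> rot \<tau> v = rot \<sigma> v \<and> out \<tau> v Red = out \<sigma> v Red))"

lemma grows_trans:
  assumes "grows \<rho> \<sigma>" "grows \<sigma> \<tau>"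
  shows "grows \<rho> \<tau>"
proof -
  have le: "fresh \<rho> \<le> fresh \<sigma>" "fresh \<sigma> \<le> fresh \<tau>" using assms by (auto simp: grows_def)
  have "\<exists>xs ys. rot \<tau> v = xs @ rot \<rho> v @ ys \<and> (\<forall>x\<in>set (xs @ ys). fresh \<rho> \<le> x)"
    if v: "v < fresh \<rho>" for v
  proof -
    obtain xs ys where 1: "rot \<sigma> v = xs @ rot \<rho> v @ ys" "\<forall>x\<in>set (xs @ ys). fresh \<rho> \<le> x"
      using assms(1) v unfolding grows_def by blast
    have "v < fresh \<sigma>" using v le by simp
    then obtain xs' ys' where 2: "rot \<tau> v = xs' @ rot \<sigma> v @ ys'" "\<forall>x\<in>set (xs' @ ys'). fresh \<sigma> \<le> x"
      using assms(2) unfolding grows_def by blast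
    show ?thesis
      by (rule exI[of _ "xs' @ xs"], rule exI[of _ "ys @ ys'"]) (use 1 2 le in \<open>auto intro: le_trans\<close>)
  qed
  then show ?thesis using assms le by (auto simp: grows_def)
qed

lemma grows_attach:
  assumes "building \<sigma>" and sp: "spine \<sigma> = p # sp" and st: "stack \<sigma> = ys @ s # zs"
  shows "grows \<sigma> (attach (length ys) \<sigma>)"
proof -
  interpret building \<sigma> by fact
  note f = attach_fields[OF sp st]
  have "\<exists>xs ys'. rot (attach (length ys) \<sigma>) v = xs @ rot \<sigma> v @ ys' \<and> (\<forall>x\<in>set (xs @ ys'). fresh \<sigma> \<le> x)"
    if v: "v < fresh \<sigma>" for v
  proof -
    consider "v = s" | "v \<noteq> s" "v = p \<or> v \<in> set ys" | "v \<noteq> s" "\<not> (v = p \<or> v \<in> set ys)" by blast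
    then show ?thesis
    proof cases
      case 1
      then show ?thesis using v
        by - (rule exI[of _ "[fresh \<sigma>]"], rule exI[of _ "[]"], auto simp: f)
    next
      case 2
      then show ?thesis using v
        by - (rule exI[of _ "[]"], rule exI[of _ "[fresh \<sigma>]"], auto simp: f)
    next
      case 3
      then show ?thesis using v
        by - (rule exI[of _ "[]"], rule exI[of _ "[]"], auto simp: f)
    qed
  qed
  then show ?thesis by (auto simp: grows_def f)
qed

lemma grows_retreat:
  assumes "spine \<sigma> \<noteq> []"
  shows "grows \<sigma> (retreat \<sigma>)"
proof -
  have "set (front (retreat \<sigma>)) = set (front \<sigma>)"
    using assms by (cases "spine \<sigma>") (auto simp: front_def retreat_def)
  moreover have "\<exists>xs ys. rot \<sigma> v = xs @ rot \<sigma> v @ ys \<and> (\<forall>x\<in>set (xs @ ys). fresh \<sigma> \<le> x)" for v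
    by (rule exI[of _ "[]"], rule exI[of _ "[]"]) simp
  ultimately show ?thesis by (simp add: grows_def retreat_def)
qed

lemma grows_run:
  assumes "building \<sigma>" "completes \<sigma> ms"
  shows "grows \<sigma> (run \<sigma> ms) \<and> fresh \<sigma> < fresh (run \<sigma> ms)"
  using assms
proof (induction \<sigma> ms rule: run_induct)
  case (close \<sigma> ys)
  then show ?case
    using grows_attach[OF close(1-3)] attach_fields(1)[OF close(2,3)] by (simp add: close_def)
next
  case (attach \<sigma> p sp ys s zs ms)
  then show ?case
    using grows_attach[OF attach(1-3)] grows_trans attach_fields(1)[OF attach(2,3)] by auto
next
  case (retreat \<sigma> p q sp ms)
  then show ?case
    using grows_retreat[of \<sigma>] grows_trans[of \<sigma> "retreat \<sigma>"] by (auto simp: retreat_def)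
qed

text \<open>
  A stack vertex receives green arcs, in front of its list, until its own red arc completes the list.
\<close>

lemma rot_run_stack:
  assumes "building \<sigma>" "completes \<sigma> ms"
  shows "\<forall>v\<in>set (stack \<sigma>). v \<noteq> 1 \<longrightarrow> (\<exists>xs. rot (run \<sigma> ms) v = xs @ rot \<sigma> v @ [out (run \<sigma> ms) v Red] \<and>
    (\<forall>x\<in>set (out (run \<sigma> ms) v Red # xs). fresh \<sigma> \<le> x))"
  using assms
proof (induction \<sigma> ms rule: run_induct)
  case (close \<sigma> ys)
  interpret building \<sigma> by fact
  note f = attach_fields[OF close(2,3)] and c = attach_context[OF close(2,3)]
  show ?case using c(3) by (auto simp: close_def close(3) f)
next
  case (attach \<sigma> p sp ys s zs ms)
  interpret building \<sigma> by fact
  note f = attach_fields[OF attach(2,3)] and c = attach_context[OF attach(2,3)]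
  let ?\<sigma> = "attach (length ys) \<sigma>"
  let ?F = "run ?\<sigma> ms"
  have "\<exists>xs. rot ?F v = xs @ rot \<sigma> v @ [out ?F v Red] \<and>
    (\<forall>x\<in>set (out ?F v Red # xs). fresh \<sigma> \<le> x)" if v: "v \<in> set (stack \<sigma>)" "v \<noteq> 1" for v
  proof (cases "v \<in> set ys")
    case True
    have "v \<notin> set (front ?\<sigma>)"
      using distinct_front True c(3)[OF True] by (auto simp: f)
    then have "rot ?F v = rot ?\<sigma> v \<and> out ?F v Red = out ?\<sigma> v Red"
      using grows_run[OF attach(4,5)] c(3)[OF True] by (auto simp: grows_def f)
    then show ?thesis
      using True c(3)[OF True] c(7,8) by (auto simp: f)
  next
    case False
    then have vs: "v \<in> set (stack ?\<sigma>)" using v attach(3) by (auto simp: f)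
    have vk: "v < fresh \<sigma>" using front_less[of v] v by (simp add: front_def)
    have vp: "v \<noteq> p" using distinct_front v attach(2) by (auto simp: front_def)
    obtain xs where xs: "rot ?F v = xs @ rot ?\<sigma> v @ [out ?F v Red]"
      "\<forall>x\<in>set (out ?F v Red # xs). fresh ?\<sigma> \<le> x"
      using attach(7) vs v(2) by blast
    show ?thesis
    proof (cases "v = s")
      case True
      then show ?thesis
        using xs vk by - (rule exI[of _ "xs @ [fresh \<sigma>]"], auto simp: f)
    next
      case False
      then show ?thesis
        using xs vk vp \<open>v \<notin> set ys\<close> by - (rule exI[of _ xs], auto simp: f)
    qed
  qed
  then show ?case by simp
next
  case (retreat \<sigma> p q sp ms)
  then show ?case by (auto simp: retreat_def)
qed

text \<open>
  The darts met before are collected in \<open>A\<close>.  The path meets an edge for the second time when the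
  reversed dart has been met.
\<close>

fun second_visits :: "('a \<times> 'a \<Rightarrow> colour) \<Rightarrow> ('a \<times> 'a) set \<Rightarrow> ('a \<times> 'a) list \<Rightarrow> colour list" where
  "second_visits f A [] = []"
| "second_visits f A ((v, x) # ds) =
     (if (x, v) \<in> A then [f (v, x)] else []) @ second_visits f (insert (v, x) A) ds"

lemma second_visits_append:
  "second_visits f A (ds @ es) = second_visits f A ds @ second_visits f (A \<union> set ds) es"
  by (induction f A ds rule: second_visits.induct) auto

lemma second_visits_all:
  "\<forall>(v, x)\<in>set ds. (x, v) \<in> A \<and> f (v, x) = c \<Longrightarrow> second_visits f A ds = replicate (length ds) c"
  by (induction f A ds rule: second_visits.induct) auto

lemma second_visits_none:
  "\<forall>(v, x)\<in>set ds. (x, v) \<notin> A \<union> set ds \<Longrightarrow> second_visits f A ds = []"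
  by (induction f A ds rule: second_visits.induct) auto

lemma successively_consec: "successively P l \<longleftrightarrow> (\<forall>x y. consec l x y \<longrightarrow> P x y)"
proof (induction l)
  case (Cons z l)
  then show ?case by (cases l) (auto simp: consec_Cons)
qed simp

text \<open>
  The exploration of the blue tree from the state \<open>\<sigma>\<close> on, in the finished map \<open>\<tau>\<close>.  \<open>Attach a\<close> enters the
  new vertex along its blue edge and crosses its incoming red and its outgoing green edge.  \<open>Retreat\<close>
  crosses the outgoing red edge of the current vertex and its incoming green edges, which stand before
  the blue entry in \<open>rot \<tau> p\<close>, and goes back along the blue edge.
\<close>

fun contour :: "state \<Rightarrow> state \<Rightarrow> move list \<Rightarrow> (nat \<times> nat) list" where
  "contour \<tau> \<sigma> [] = []"
| "contour \<tau> \<sigma> (Attach a # ms) =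
     (hd (spine \<sigma>), fresh \<sigma>) # map (Pair (fresh \<sigma>)) (take (Suc a) (stack \<sigma>)) @
     contour \<tau> (attach a \<sigma>) ms"
| "contour \<tau> \<sigma> (Retreat # ms) =
     (let p = hd (spine \<sigma>) in
        (p, out \<tau> p Red) # map (Pair p) (takeWhile (\<lambda>x. x \<noteq> out \<tau> p Blue) (rot \<tau> p) @ [out \<tau> p Blue]) @
        contour \<tau> (retreat \<sigma>) ms)"

lemma (in closed) edge_col_out:
  assumes "2 \<le> u" "u < r"
  shows "edge_col (wooded_of \<sigma>) (u, out \<sigma> u c) = c" "edge_col (wooded_of \<sigma>) (out \<sigma> u c, u) = c"
proof -
  have "(u, out \<sigma> u c) \<in> arcs (wooded_of \<sigma>)" using assms unfolding arcs_iff by blast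
  moreover from this have "(out \<sigma> u c, u) \<notin> arcs (wooded_of \<sigma>)"
    using one_orientation[OF assms out_rot[OF assms]] by blast
  ultimately show "edge_col (wooded_of \<sigma>) (u, out \<sigma> u c) = c"
    "edge_col (wooded_of \<sigma>) (out \<sigma> u c, u) = c"
    using col_out[OF assms] by (simp_all only: edge_col_def prod.case if_True if_False wooded_of_simps)
qed

text \<open>
  In the finished map the neighbours that a vertex is attached to still form a block of its list, and
  nothing has been added around the vertices that it covers.
\<close>

lemma attach_final:
  assumes "building \<sigma>" and sp: "spine \<sigma> = p # sp" and st: "stack \<sigma> = ys @ s # zs"
    and "building (attach (length ys) \<sigma>)"
    and fit: "completes (attach (length ys) \<sigma>) ms"
    and "closed (run (attach (length ys) \<sigma>) ms)"
  defines "\<tau> \<equiv> run (attach (length ys) \<sigma>) ms" and "k \<equiv> fresh \<sigma>"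
  shows "2 \<le> k" "k < fresh \<tau> - 1" "out \<tau> k Blue = p" "out \<tau> k Green = s"
    "y \<in> set ys \<Longrightarrow> 2 \<le> y \<and> y < fresh \<tau> - 1 \<and> out \<tau> y Red = k"
    "consec (p # ys @ [s]) x y \<Longrightarrow> cycle_of_list (rot \<tau> k) x = y"
    "cycle_of_list (rot \<tau> p) (hd (stack \<sigma>)) = k"
    "x \<in> set (p # ys @ [s]) \<Longrightarrow> k \<in> set (rot \<tau> x)"
proof -
  interpret building \<sigma> by fact
  interpret F: closed \<tau> using assms(6) by (simp add: \<tau>_def)
  note f = attach_fields[OF sp st] and c = attach_context[OF sp st]
  let ?\<sigma> = "attach (length ys) \<sigma>"
  have g: "grows ?\<sigma> \<tau>" "Suc k < fresh \<tau>"
    using grows_run[OF assms(4) fit] by (auto simp: \<tau>_def k_def f)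
  show k: "2 \<le> k" "k < fresh \<tau> - 1" using fresh_ge g by (auto simp: k_def)
  show "out \<tau> k Blue = p" "out \<tau> k Green = s"
    using g k by (auto simp: grows_def f k_def)
  show "2 \<le> y \<and> y < fresh \<tau> - 1 \<and> out \<tau> y Red = k" if y: "y \<in> set ys"
  proof -
    have "y \<notin> set (front ?\<sigma>)"
      using distinct_front y c(3)[OF y] by (auto simp: f)
    then show ?thesis using g(1) c(3)[OF y] k y by (auto simp: grows_def f k_def)
  qed
  have rot_k: "rot ?\<sigma> k = p # ys @ [s]" by (simp add: f k_def)
  have fr: "fresh ?\<sigma> = Suc k" by (simp add: f k_def)
  have sub: "\<exists>xs ys. rot \<tau> v = xs @ rot ?\<sigma> v @ ys" if "v < Suc k" for v
    using g(1) that unfolding grows_def fr by blast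
  have cw: "cycle_of_list (rot \<tau> v) x = y" if v: "v < Suc k" and "consec (rot ?\<sigma> v) x y" for v x y
  proof -
    have "consec (rot \<tau> v) x y" using sub[OF v] that(2) by (auto simp: consec_append)
    then show ?thesis using F.distinct_rot[of v] v k by (intro cycle_of_list_consec) auto
  qed
  show "cycle_of_list (rot \<tau> k) x = y" if "consec (p # ys @ [s]) x y"
    using cw[of k x y] that by (simp add: rot_k)
  have pk: "p < k" using c(1) by (simp add: k_def)
  have "rot ?\<sigma> p = rot \<sigma> p @ [k]" using c(6) pk by (simp add: f k_def)
  then have "consec (rot ?\<sigma> p) (hd (stack \<sigma>)) k"
    using last_rot_hd_spine sp rot_Nil[of p] pk by (simp add: consec_append k_def)
  then show "cycle_of_list (rot \<tau> p) (hd (stack \<sigma>)) = k" using cw[of p] pk by simp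
  show "k \<in> set (rot \<tau> x)" if x: "x \<in> set (p # ys @ [s])"
  proof -
    have "x \<in> set (rot \<tau> k)" using sub[of k] x by (auto simp: rot_k)
    moreover have "x < fresh \<tau>" using F.rot_less[of k x] calculation k by simp
    ultimately show ?thesis using F.rot_sym[of k x] k by simp
  qed
qed

text \<open>
  What is found in the finished map around a vertex that the contour leaves: before its blue arc there
  are exactly the green arcs which it receives while it is on the stack.
\<close>

lemma retreat_final:
  assumes "building \<sigma>" and sp: "spine \<sigma> = p # q # sp"
    and "building (retreat \<sigma>)"
    and fit: "completes (retreat \<sigma>) ms"
    and "closed (run (retreat \<sigma>) ms)"
  defines "\<tau> \<equiv> run (retreat \<sigma>) ms"
  obtains gs where "2 \<le> p" "p < fresh \<tau> - 1" "out \<tau> p Blue = q" "out \<sigma> p Blue = q" "q < p"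
    "rot \<tau> p = gs @ rot \<sigma> p @ [out \<tau> p Red]" "hd (rot \<sigma> p) = q"
    "\<And>x. x \<in> set gs \<Longrightarrow> fresh \<sigma> \<le> x \<and> x < fresh \<tau> - 1 \<and> out \<tau> x Green = p"
    "fresh \<sigma> \<le> out \<tau> p Red" "takeWhile (\<lambda>x. x \<noteq> q) (rot \<tau> p) = gs"
proof -
  interpret building \<sigma> by fact
  interpret F: closed \<tau> using assms(5) by (simp add: \<tau>_def)
  have f: "fresh (retreat \<sigma>) = fresh \<sigma>" "rot (retreat \<sigma>) = rot \<sigma>" "out (retreat \<sigma>) = out \<sigma>"
    "stack (retreat \<sigma>) = p # stack \<sigma>"
    using sp by (auto simp: retreat_def)
  have g: "grows (retreat \<sigma>) \<tau>" "fresh \<sigma> < fresh \<tau>"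
    using grows_run[OF assms(3) fit] by (auto simp: \<tau>_def f)
  have ps: "p \<in> set (spine \<sigma>)" using sp by simp
  have p1: "p \<noteq> 1" "p < fresh \<sigma>" using spine_neq_1[OF ps] spine_less[OF ps] by auto
  have "0 \<in> set (q # sp)" using spine sp last_in_set[of "q # sp"] by (auto split: if_splits)
  then have "p \<noteq> 0" using distinct_front sp by (auto simp: front_def)
  then have p: "2 \<le> p" "p < fresh \<tau> - 1" using p1 g by auto
  have oq: "out \<sigma> p Blue = q" using spine_out[of p q] sp by (simp add: consec_Cons)
  then have ot: "out \<tau> p Blue = q" using g(1) p(1) p1 by (simp add: grows_def f)
  have qp: "q < p" using out_less[OF p(1) p1(2)] oq by simp
  have hd: "hd (rot \<sigma> p) = q"
    using front_ends[of q p] sp by (simp add: front_def consec_append consec_Cons)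
  obtain gs where gs: "rot \<tau> p = gs @ rot \<sigma> p @ [out \<tau> p Red]" "fresh \<sigma> \<le> out \<tau> p Red"
    "\<And>x. x \<in> set gs \<Longrightarrow> fresh \<sigma> \<le> x"
    using rot_run_stack[OF assms(3) fit] p1(1) unfolding f \<tau>_def by force
  obtain l where l: "rot \<sigma> p = q # l" using hd rot_Nil[OF p1(2)] by (cases "rot \<sigma> p") auto
  have tw: "takeWhile (\<lambda>x. x \<noteq> q) (xs @ q # ys) = xs" if "q \<notin> set xs" for xs ys
    using that by (induction xs) auto
  have d: "distinct (rot \<tau> p)" using F.distinct_rot[of p] p by simp
  have t1: "takeWhile (\<lambda>x. x \<noteq> q) (rot \<tau> p) = gs"
    using d unfolding gs(1) l by (subst append_Cons, intro tw) auto
  obtain gs' rs bs where r: "rot \<tau> p = gs' @ [out \<tau> p Blue] @ rs @ [out \<tau> p Green] @ bs @ [out \<tau> p Red]"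
    "set gs' = into \<tau> p Green"
    by (rule F.inner_rot[OF p])
  have r': "rot \<tau> p = gs' @ q # rs @ out \<tau> p Green # bs @ [out \<tau> p Red]"
    using r(1) ot by simp
  then have "q \<notin> set gs'" using d by auto
  then have "takeWhile (\<lambda>x. x \<noteq> q) (rot \<tau> p) = gs'" unfolding r' by (rule tw)
  then have "set gs = into \<tau> p Green" using t1 r(2) by simp
  then have "x < fresh \<tau> - 1 \<and> out \<tau> x Green = p" if "x \<in> set gs" for x
    using that F.into_inner[OF p(1)] by auto
  then show ?thesis using that[of gs] p ot oq qp gs hd t1 by blast
qed

text \<open>
  Between two moves the path is at the current vertex and about to meet the edge behind the top of the
  stack; the segments of the contour fit together at these places.
\<close>

lemma contour_explores:
  assumes "building \<sigma>" "completes \<sigma> ms"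
  shows "let \<tau> = run \<sigma> ms; ds = contour \<tau> \<sigma> ms @ [(0, fresh \<tau> - 1)] in
    hd ds = (hd (spine \<sigma>), cycle_of_list (rot \<tau> (hd (spine \<sigma>))) (hd (stack \<sigma>))) \<and>
    successively (\<lambda>d e. explore (wooded_of \<tau>) d = e) ds"
  using assms
proof (induction \<sigma> ms rule: run_induct)
  case (close \<sigma> ys)
  interpret building \<sigma> by fact
  have cl: "closed (close \<sigma>)" using building_close[OF close(1)] close(2) by simp
  interpret F: closed "close \<sigma>" by fact
  note f = attach_fields[OF close(2,3)]
  have "rot (close \<sigma>) 0 = rot \<sigma> 0 @ [fresh \<sigma>]"
    using fresh_ge by (simp add: close_def close(3) f)
  then have "consec (rot (close \<sigma>) 0) (hd (stack \<sigma>)) (fresh \<sigma>)"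
    using last_rot_hd_spine rot_Nil[of 0] fresh_ge close(2) by (simp add: consec_append)
  then have "cycle_of_list (rot (close \<sigma>) 0) (hd (stack \<sigma>)) = fresh \<sigma>"
    using F.distinct_rot[of 0] F.fresh_ge by (intro cycle_of_list_consec) auto
  moreover have "fresh (close \<sigma>) = Suc (fresh \<sigma>)" using building_close[OF close(1)] close(2) by simp
  ultimately show ?case by (simp add: close(2))
next
  case (attach \<sigma> p sp ys s zs ms)
  interpret building \<sigma> by fact
  let ?\<sigma> = "attach (length ys) \<sigma>"
  define \<tau> where "\<tau> = run ?\<sigma> ms"
  interpret F: closed \<tau> using attach(6) by (simp add: \<tau>_def)
  note fin = attach_final[OF attach(1-6), folded \<tau>_def]
  let ?M = "wooded_of \<tau>" and ?k = "fresh \<sigma>"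
  note f = attach_fields[OF attach(2,3)]
  define ds where "ds = contour \<tau> ?\<sigma> ms @ [(0, fresh \<tau> - 1)]"
  have IH: "hd ds = (?k, cycle_of_list (rot \<tau> ?k) s)" "successively (\<lambda>d e. explore ?M d = e) ds"
    using attach(7) by (auto simp: ds_def \<tau>_def f Let_def)
  have nB: "edge_col ?M (?k, x) \<noteq> Blue" if "x \<in> set (ys @ [s])" for x
    using that F.edge_col_out(1)[OF fin(1,2), of Green] F.edge_col_out(2)[of x Red] fin(4) fin(5)[of x]
    by auto
  have B: "edge_col ?M (p, ?k) = Blue" using F.edge_col_out(2)[OF fin(1,2), of Blue] fin(3) by simp
  have E: "explore ?M (?k, x) = (?k, cycle_of_list (rot \<tau> ?k) x)" if "x \<in> set (ys @ [s])" for x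
    using nB[OF that] by (simp add: explore_def)
  have EB: "explore ?M (p, ?k) = (?k, hd (ys @ [s]))"
    using B fin(6)[of p "hd (ys @ [s])"] by (simp add: explore_def consec_Cons)
  have tk: "take (Suc (length ys)) (stack \<sigma>) = ys @ [s]" using attach(3) by simp
  have whole: "contour \<tau> \<sigma> (Attach (length ys) # ms) @ [(0, fresh \<tau> - 1)]
    = (p, ?k) # map (Pair ?k) (ys @ [s]) @ ds"
    using tk attach(2) by (simp add: ds_def)
  have "explore ?M (?k, x) = (?k, y)" if xy: "consec (ys @ [s]) x y" for x y
    using E[of x] consec_set[OF xy] fin(6)[of x y] xy by (auto simp: consec_Cons[of p])
  then have "successively (\<lambda>d e. explore ?M d = e) (map (Pair ?k) (ys @ [s]))"
    unfolding successively_map by (simp only: successively_consec) blast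
  then have "successively (\<lambda>d e. explore ?M d = e) (map (Pair ?k) (ys @ [s]) @ ds)"
    using IH E[of s] by (auto simp: successively_append_iff successively_Cons)
  moreover have "hd (map (Pair ?k) (ys @ [s]) @ ds) = explore ?M (p, ?k)"
    unfolding EB by (cases ys) auto
  ultimately have "successively (\<lambda>d e. explore ?M d = e) ((p, ?k) # map (Pair ?k) (ys @ [s]) @ ds)"
    by (simp add: successively_Cons)
  then show ?case
    using fin(7) attach(2) whole by (simp add: Let_def flip: \<tau>_def)
next
  case (retreat \<sigma> p q sp ms)
  interpret building \<sigma> by fact
  define \<tau> where "\<tau> = run (retreat \<sigma>) ms"
  interpret F: closed \<tau> using retreat(5) by (simp add: \<tau>_def)
  obtain gs where fin: "2 \<le> p" "p < fresh \<tau> - 1" "out \<tau> p Blue = q" "out \<sigma> p Blue = q" "q < p"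
    "rot \<tau> p = gs @ rot \<sigma> p @ [out \<tau> p Red]" "hd (rot \<sigma> p) = q"
    "\<And>x. x \<in> set gs \<Longrightarrow> fresh \<sigma> \<le> x \<and> x < fresh \<tau> - 1 \<and> out \<tau> x Green = p"
    "fresh \<sigma> \<le> out \<tau> p Red" "takeWhile (\<lambda>x. x \<noteq> q) (rot \<tau> p) = gs"
    using retreat_final[OF retreat(1-5), folded \<tau>_def] by blast
  let ?M = "wooded_of \<tau>" and ?R = "out \<tau> p Red"
  define ds where "ds = contour \<tau> (retreat \<sigma>) ms @ [(0, fresh \<tau> - 1)]"
  have IH: "hd ds = (q, cycle_of_list (rot \<tau> q) p)" "successively (\<lambda>d e. explore ?M d = e) ds"
    using retreat(6) retreat(2) by (auto simp: ds_def \<tau>_def Let_def retreat_def)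
  have d: "distinct (rot \<tau> p)" "rot \<tau> p \<noteq> []" using F.distinct_rot[of p] F.rot_Nil[of p] fin(2) by auto
  have pf: "p < fresh \<sigma>" using spine_less retreat(2) by simp
  obtain l where l: "rot \<sigma> p = q # l" using fin(7) rot_Nil[OF pf] by (cases "rot \<sigma> p") auto
  have c: "cycle_of_list (rot \<tau> p) (hd (stack \<sigma>)) = ?R"
  proof (rule cycle_of_list_consec[OF d(1)])
    have "consec (rot \<sigma> p @ [?R]) (hd (stack \<sigma>)) ?R"
      using last_rot_hd_spine retreat(2) rot_Nil[OF pf] by (simp add: consec_append)
    then show "consec (rot \<tau> p) (hd (stack \<sigma>)) ?R"
      by (subst fin(6)) (subst consec_append, blast)
  qed
  have ER: "explore ?M (p, ?R) = (p, hd (gs @ [q]))"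
    using F.edge_col_out(1)[OF fin(1,2), of Red] cycle_of_list_last[OF d] l fin(6)
    by (cases gs) (auto simp: explore_def)
  have EB: "explore ?M (p, q) = (q, cycle_of_list (rot \<tau> q) p)"
    using F.edge_col_out(1)[OF fin(1,2), of Blue] fin(3) by (simp add: explore_def)
  have EG: "explore ?M (p, x) = (p, cycle_of_list (rot \<tau> p) x)" if "x \<in> set gs" for x
    using F.edge_col_out(2)[of x Green] fin(8)[OF that] fresh_ge by (simp add: explore_def)
  have whole: "contour \<tau> \<sigma> (Retreat # ms) @ [(0, fresh \<tau> - 1)]
    = (p, ?R) # map (Pair p) (gs @ [q]) @ ds"
    using retreat(2) fin(3,10) by (simp add: ds_def Let_def)
  have "explore ?M (p, x) = (p, y)" if xy: "consec (gs @ [q]) x y" for x y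
  proof -
    have "x \<in> set gs"
      using xy by (auto simp: consec_append consec_Cons dest: consec_set)
    moreover have "cycle_of_list (rot \<tau> p) x = y"
      using xy by (intro cycle_of_list_consec[OF d(1)]) (auto simp: fin(6) l consec_append consec_Cons)
    ultimately show "explore ?M (p, x) = (p, y)" using EG by simp
  qed
  then have "successively (\<lambda>d e. explore ?M d = e) (map (Pair p) (gs @ [q]))"
    unfolding successively_map by (simp only: successively_consec) blast
  then have "successively (\<lambda>d e. explore ?M d = e) (map (Pair p) (gs @ [q]) @ ds)"
    using IH EB by (auto simp: successively_append_iff successively_Cons)
  moreover have "hd (map (Pair p) (gs @ [q]) @ ds) = explore ?M (p, ?R)"
    unfolding ER by (cases gs) auto
  ultimately have "successively (\<lambda>d e. explore ?M d = e) ((p, ?R) # map (Pair p) (gs @ [q]) @ ds)"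
    by (simp add: successively_Cons)
  then show ?case
    using c retreat(2) whole by (simp add: Let_def flip: \<tau>_def)
qed

text \<open>
  The darts met before the state \<open>\<sigma>\<close> is reached.  At a vertex of the spine the edge to its parent, or the
  outer edge to \<open>A\<^sub>g\<close>, is still to come; at the vertices that the contour has left all edges have been met.
  The third part consists of the inner edges at \<open>A\<^sub>g\<close>, which are crossed first.
\<close>

definition explored :: "state \<Rightarrow> state \<Rightarrow> (nat \<times> nat) set" where
  "explored \<tau> \<sigma> =
     {(v, x). v \<in> set (spine \<sigma>) \<and> x \<in> set (rot \<sigma> v) \<and> x \<noteq> (if v = 0 then 1 else out \<sigma> v Blue)} \<union>
     {(v, x). 2 \<le> v \<and> v < fresh \<sigma> \<and> v \<notin> set (spine \<sigma>) \<and> x \<in> set (rot \<tau> v)} \<union>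
     {(1, x) |x. x \<in> set (rot \<tau> 1) \<and> 2 \<le> x \<and> x < fresh \<tau> - 1}"

abbreviation contour_dart :: "state \<Rightarrow> nat \<Rightarrow> nat \<Rightarrow> bool" where
  "contour_dart \<tau> v x \<equiv> (v, x) \<in> darts (wooded_of \<tau>) \<and>
       (2 \<le> v \<and> v < fresh \<tau> - 1 \<or> 2 \<le> x \<and> x < fresh \<tau> - 1) \<and> v \<noteq> 1 \<and> v \<noteq> fresh \<tau> - 1"

text \<open>
  A vertex attached to the map is new, so its blue edge is met for the first time.  Its other neighbours
  are \<open>A\<^sub>g\<close> or have been left by the contour, so the red edges and the green edge are met for the second
  time.  On a retreat the red and the green edges lead to vertices that are still to be built, and only
  the blue edge to the parent has been met.
\<close>

lemma contour_second_visits: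
  assumes "building \<sigma>" "completes \<sigma> ms"
  shows "let \<tau> = run \<sigma> ms; ds = contour \<tau> \<sigma> ms; r = fresh \<tau> - 1 in
    distinct ds \<and> set ds \<inter> explored \<tau> \<sigma> = {} \<and>
    (\<forall>(v, x)\<in>set ds. contour_dart \<tau> v x) \<and>
    second_visits (edge_col (wooded_of \<tau>)) (explored \<tau> \<sigma>)
      (ds @ map (Pair r) (tl (butlast (rot \<tau> r)))) = word (length (stack \<sigma>) - 1) ms"
  using assms
proof (induction \<sigma> ms rule: run_induct)
  case (close \<sigma> ys)
  interpret building \<sigma> by fact
  have cl: "closed (close \<sigma>)" and fr: "fresh (close \<sigma>) = Suc (fresh \<sigma>)"
    using building_close[OF close(1)] close(2) by auto
  interpret F: closed "close \<sigma>" by fact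
  note f = attach_fields[OF close(2,3)] and c = attach_context[OF close(2,3)]
  have rr: "rot (close \<sigma>) (fresh \<sigma>) = 0 # ys @ [1]" by (simp add: close_def close(3) f)
  have y: "(y, fresh \<sigma>) \<in> explored (close \<sigma>) \<sigma> \<and> edge_col (wooded_of (close \<sigma>)) (fresh \<sigma>, y) = Red"
    if "y \<in> set ys" for y
  proof -
    have "fresh \<sigma> \<in> set (rot (close \<sigma>) y)" "out (close \<sigma>) y Red = fresh \<sigma>"
      using that c(3)[OF that] c(7,8) by (auto simp: close_def close(3) f)
    then show ?thesis
      using c(3)[OF that] c(7) that F.edge_col_out(2)[of y Red]
      by (auto simp: explored_def close(2) fr)
  qed
  have "second_visits (edge_col (wooded_of (close \<sigma>))) (explored (close \<sigma>) \<sigma>) (map (Pair (fresh \<sigma>)) ys)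
    = replicate (length ys) Red"
    by (subst second_visits_all[where c = Red]) (use y in auto)
  then show ?case by (simp add: Let_def fr rr close(3) butlast_append)
next
  case (attach \<sigma> p sp ys s zs ms)
  interpret building \<sigma> by fact
  let ?\<sigma> = "attach (length ys) \<sigma>"
  define \<tau> where "\<tau> = run ?\<sigma> ms"
  interpret F: closed \<tau> using attach(6) by (simp add: \<tau>_def)
  note fin = attach_final[OF attach(1-6), folded \<tau>_def]
  note f = attach_fields[OF attach(2,3)] and c = attach_context[OF attach(2,3)]
  define k where "k = fresh \<sigma>"
  note fin = fin[folded k_def] and f = f[folded k_def] and c = c[folded k_def]
  let ?f = "edge_col (wooded_of \<tau>)" and ?A = "explored \<tau> \<sigma>"
  define ds where "ds = contour \<tau> ?\<sigma> ms"
  define P3 where "P3 = map (Pair (fresh \<tau> - 1)) (tl (butlast (rot \<tau> (fresh \<tau> - 1))))"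
  define seg where "seg = (p, k) # map (Pair k) (ys @ [s])"
  have IH: "distinct ds" "set ds \<inter> explored \<tau> ?\<sigma> = {}"
    "\<forall>(v, x)\<in>set ds. contour_dart \<tau> v x"
    "second_visits ?f (explored \<tau> ?\<sigma>) (ds @ P3) = word (length (s # zs) - 1) ms"
    using attach(7) by (auto simp: ds_def P3_def \<tau>_def f Let_def)
  have whole: "contour \<tau> \<sigma> (Attach (length ys) # ms) = seg @ ds"
    using attach(2,3) by (simp add: ds_def seg_def k_def)
  have pk: "p < k" "s < k" "p \<in> set (spine \<sigma>)" using c(1,2) attach(2) by auto
  have spk: "v < k" if "v \<in> set (spine \<sigma>)" for v using spine_less[OF that] by (simp add: k_def)
  have rk: "k \<notin> set (rot \<sigma> v)" if "v < k" for v using rot_less[of v k] that by (auto simp: k_def)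
  have disj: "set seg \<inter> ?A = {}"
    using spk rk[of p] pk fin(1) spine_neq_1 c(4) by (auto simp: seg_def explored_def k_def[symmetric])
  have new: "explored \<tau> ?\<sigma> = ?A \<union> set seg"
  proof -
    have rot': "rot ?\<sigma> v = rot \<sigma> v" if "v \<in> set (spine \<sigma>)" "v \<noteq> p" for v
      using that spk[OF that(1)] distinct_front attach(2,3) by (auto simp: f front_def)
    have rotp: "rot ?\<sigma> p = rot \<sigma> p @ [k]" using c(6) pk by (simp add: f)
    have rotk: "rot ?\<sigma> k = p # ys @ [s]" "out ?\<sigma> k Blue = p" by (auto simp: f)
    have out': "out ?\<sigma> v Blue = out \<sigma> v Blue" if "v < k" for v using that by (auto simp: f)
    have 1: "{(v, x). v \<in> set (spine ?\<sigma>) \<and> x \<in> set (rot ?\<sigma> v) \<and> x \<noteq> (if v = 0 then 1 else out ?\<sigma> v Blue)}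
      = {(v, x). v \<in> set (spine \<sigma>) \<and> x \<in> set (rot \<sigma> v) \<and> x \<noteq> (if v = 0 then 1 else out \<sigma> v Blue)}
        \<union> set seg" (is "?L = ?R")
    proof (rule set_eqI, clarify)
      fix v x
      consider "v = k" | "v = p" | "v \<noteq> k" "v \<noteq> p" by blast
      then show "(v, x) \<in> ?L \<longleftrightarrow> (v, x) \<in> ?R"
      proof cases
        case 1
        have "p \<notin> set (ys @ [s])" using c by auto
        then show ?thesis using 1 spk[of k] fin(1) rotk pk by (auto simp: seg_def f)
      next
        case 2
        have "k \<noteq> out \<sigma> p Blue" if "p \<noteq> 0"
          using out_less[of p] pk c(4) that by (simp add: k_def)
        then show ?thesis
          using 2 pk rotp out'[OF pk(1)] fin(1) c(4) by (auto simp: seg_def f attach(2))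
      next
        case 3
        then show ?thesis using rot'[of v] out'[of v] spk[of v] by (auto simp: seg_def f attach(2))
      qed
    qed
    have 2: "(2 \<le> v \<and> v < fresh ?\<sigma> \<and> v \<notin> set (spine ?\<sigma>) \<and> x \<in> set (rot \<tau> v)) \<longleftrightarrow>
      (2 \<le> v \<and> v < fresh \<sigma> \<and> v \<notin> set (spine \<sigma>) \<and> x \<in> set (rot \<tau> v))" for v x
      by (auto simp: f k_def[symmetric] attach(2))
    show ?thesis unfolding explored_def 1 2 by blast
  qed
  have vis: "second_visits ?f ?A seg = replicate (length ys) Red @ [Green]"
  proof -
    have "(k, p) \<notin> ?A" using spk[of k] fin(1) by (auto simp: explored_def k_def[symmetric])
    moreover have "second_visits ?f (insert (p, k) ?A) (map (Pair k) ys) = replicate (length ys) Red"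
    proof -
      have "(y, k) \<in> ?A \<and> ?f (k, y) = Red" if "y \<in> set ys" for y
      proof -
        have "y \<in> set (stack \<sigma>)" "y \<noteq> 1" using that attach(3) fin(5)[OF that] by auto
        then show ?thesis
          using stack_ge[of y] fin(5)[OF that] fin(8)[of y] that F.edge_col_out(2)[of y Red]
          by (auto simp: explored_def)
      qed
      then show ?thesis by (subst second_visits_all[where c = Red]) auto
    qed
    moreover have "(s, k) \<in> ?A"
    proof (cases "s = 1")
      case True
      then show ?thesis using fin(8)[of s] fin(1,2) by (auto simp: explored_def)
    next
      case False
      then show ?thesis using stack_ge[of s] fin(8)[of s] attach(3) by (auto simp: explored_def)
    qed
    moreover have "?f (k, s) = Green" using F.edge_col_out(1)[OF fin(1,2), of Green] fin(4) by simp
    ultimately show ?thesis by (simp add: seg_def second_visits_append)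
  qed
  have dseg: "distinct seg" using c(6,7,8,9) pk by (auto simp: seg_def distinct_map inj_on_def)
  have segd: "\<forall>(v, x)\<in>set seg. contour_dart \<tau> v x"
  proof -
    have "x \<in> set (rot \<tau> k)" "k \<in> set (rot \<tau> x)" if "x \<in> set (p # ys @ [s])" for x
    proof -
      show kx: "k \<in> set (rot \<tau> x)" using fin(8)[OF that] .
      have "x < k" using that pk c(3)[of x] by auto
      then show "x \<in> set (rot \<tau> k)" using F.rot_sym[of x k] kx fin(2) by simp
    qed
    then show ?thesis using fin(1,2) pk c(4) by (auto simp: seg_def)
  qed
  have disj': "set seg \<inter> set ds = {}" "set ds \<inter> ?A = {}" using IH(2) unfolding new by auto
  have run: "run \<sigma> (Attach (length ys) # ms) = \<tau>" by (simp add: \<tau>_def)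
  show ?case
    unfolding Let_def run whole P3_def[symmetric]
  proof (intro conjI)
    show "distinct (seg @ ds)" using dseg IH(1) disj' by simp
    show "set (seg @ ds) \<inter> ?A = {}" using disj disj' by auto
    show "\<forall>(v, x)\<in>set (seg @ ds). contour_dart \<tau> v x"
      using segd IH(3) unfolding set_append by blast
    show "second_visits ?f ?A ((seg @ ds) @ P3) = word (length (stack \<sigma>) - 1) (Attach (length ys) # ms)"
      using IH(4) vis attach(3) by (simp add: second_visits_append[of _ _ seg] flip: new)
  qed
next
  case (retreat \<sigma> p q sp ms)
  interpret building \<sigma> by fact
  define \<tau> where "\<tau> = run (retreat \<sigma>) ms"
  interpret F: closed \<tau> using retreat(5) by (simp add: \<tau>_def)
  obtain gs where fin: "2 \<le> p" "p < fresh \<tau> - 1" "out \<tau> p Blue = q" "out \<sigma> p Blue = q" "q < p"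
    "rot \<tau> p = gs @ rot \<sigma> p @ [out \<tau> p Red]" "hd (rot \<sigma> p) = q"
    "\<And>x. x \<in> set gs \<Longrightarrow> fresh \<sigma> \<le> x \<and> x < fresh \<tau> - 1 \<and> out \<tau> x Green = p"
    "fresh \<sigma> \<le> out \<tau> p Red" "takeWhile (\<lambda>x. x \<noteq> q) (rot \<tau> p) = gs"
    using retreat_final[OF retreat(1-5), folded \<tau>_def] by blast
  let ?f = "edge_col (wooded_of \<tau>)" and ?A = "explored \<tau> \<sigma>" and ?R = "out \<tau> p Red"
  define ds where "ds = contour \<tau> (retreat \<sigma>) ms"
  define P3 where "P3 = map (Pair (fresh \<tau> - 1)) (tl (butlast (rot \<tau> (fresh \<tau> - 1))))"
  define seg where "seg = (p, ?R) # map (Pair p) gs @ [(p, q)]"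
  have IH: "distinct ds" "set ds \<inter> explored \<tau> (retreat \<sigma>) = {}"
    "\<forall>(v, x)\<in>set ds. contour_dart \<tau> v x"
    "second_visits ?f (explored \<tau> (retreat \<sigma>)) (ds @ P3) = word (length (stack \<sigma>)) ms"
    using retreat(6) by (auto simp: ds_def P3_def \<tau>_def Let_def retreat_def)
  have whole: "contour \<tau> \<sigma> (Retreat # ms) = seg @ ds"
    using retreat(2) fin(3,10) by (simp add: ds_def seg_def Let_def)
  have d: "distinct (rot \<tau> p)" using F.distinct_rot[of p] fin(2) by auto
  have spk: "v < fresh \<sigma>" if "v \<in> set (spine \<sigma>)" for v using spine_less[OF that] .
  have ps: "p \<in> set (spine \<sigma>)" "q \<in> set (spine \<sigma>)" using retreat(2) by auto
  have pf: "p < fresh \<sigma>" "q < fresh \<sigma>" "p \<noteq> 1" "q \<noteq> 1"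
    using spk ps spine_neq_1 by auto
  have new_p: "x \<notin> set (rot \<sigma> p)" if "fresh \<sigma> \<le> x" for x
    using rot_less[OF pf(1)] that by fastforce
  obtain l where l: "rot \<sigma> p = q # l" using fin(7) rot_Nil[OF pf(1)] by (cases "rot \<sigma> p") auto
  have "\<not> (p = 0)" using fin(1) by simp
  then have disj: "set seg \<inter> ?A = {}"
    using new_p fin(8,9) fin(4) ps pf by (auto simp: seg_def explored_def)
  have new: "explored \<tau> (retreat \<sigma>) = ?A \<union> set seg"
  proof -
    have dsp: "p \<notin> set (q # sp)" using distinct_front retreat(2) by (auto simp: front_def)
    have f: "fresh (retreat \<sigma>) = fresh \<sigma>" "rot (retreat \<sigma>) = rot \<sigma>" "out (retreat \<sigma>) = out \<sigma>"
      "spine (retreat \<sigma>) = q # sp"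
      using retreat(2) by (auto simp: retreat_def)
    have seg: "(v, x) \<in> set seg \<longleftrightarrow> v = p \<and> (x = ?R \<or> x \<in> set gs \<or> x = q)" for v x
      by (auto simp: seg_def)
    have all: "x \<in> set (rot \<tau> p) \<longleftrightarrow> x \<in> set gs \<or> x \<in> set (rot \<sigma> p) \<or> x = ?R" for x
      by (auto simp: fin(6))
    show ?thesis
    proof (rule set_eqI, clarify)
      fix v x
      have q: "q \<in> set (rot \<sigma> p)" by (simp add: l)
      show "(v, x) \<in> explored \<tau> (retreat \<sigma>) \<longleftrightarrow> (v, x) \<in> ?A \<union> set seg"
      proof (cases "v = p")
        case True
        then show ?thesis
          using fin(1,4) pf dsp all[of x] q retreat(2) by (auto simp: explored_def seg f)
      next
        case False
        then show ?thesis using retreat(2) by (simp add: explored_def seg f)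
      qed
    qed
  qed
  have vis: "second_visits ?f ?A seg = [Blue]"
  proof -
    have notA: "(x, p) \<notin> ?A" if "fresh \<sigma> \<le> x" for x
      using spk[of x] that fresh_ge by (auto simp: explored_def)
    have "x \<noteq> p" if "fresh \<sigma> \<le> x" for x using that pf(1) by simp
    then have "second_visits ?f ?A ((p, ?R) # map (Pair p) gs) = []"
      using notA fin(8,9) by (intro second_visits_none) auto
    moreover have "(q, p) \<in> ?A"
    proof -
      have "p \<in> set (rot \<sigma> q)" using rot_sym[OF pf(2,1)] l by simp
      moreover have "p \<noteq> (if q = 0 then 1 else out \<sigma> q Blue)"
        using out_less[of q] pf fin(1,5) by auto
      ultimately show ?thesis using ps by (simp add: explored_def)
    qed
    moreover have "?f (p, q) = Blue" using F.edge_col_out(1)[OF fin(1,2), of Blue] fin(3) by simp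
    moreover have "seg = ((p, ?R) # map (Pair p) gs) @ [(p, q)]" by (simp add: seg_def)
    ultimately show ?thesis by (simp only: second_visits_append) simp
  qed
  have dseg: "distinct seg"
    using d unfolding fin(6) l by (auto simp: seg_def distinct_map inj_on_def)
  have segd: "\<forall>(v, x)\<in>set seg. contour_dart \<tau> v x"
    using fin(1,2) by (auto simp: seg_def fin(6) l)
  have "0 < length (stack \<sigma>)" using stack by simp
  have disj': "set seg \<inter> set ds = {}" "set ds \<inter> ?A = {}" using IH(2) unfolding new by auto
  have run: "run \<sigma> (Retreat # ms) = \<tau>" by (simp add: \<tau>_def)
  show ?case
    unfolding Let_def run whole P3_def[symmetric]
  proof (intro conjI)
    show "distinct (seg @ ds)" using dseg IH(1) disj' by simp
    show "set (seg @ ds) \<inter> ?A = {}" using disj disj' by auto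
    show "\<forall>(v, x)\<in>set (seg @ ds). contour_dart \<tau> v x"
      using segd IH(3) unfolding set_append by blast
    show "second_visits ?f ?A ((seg @ ds) @ P3) = word (length (stack \<sigma>) - 1) (Retreat # ms)"
      using IH(4) vis \<open>0 < length (stack \<sigma>)\<close> by (simp add: second_visits_append[of _ _ seg] flip: new)
  qed
qed

section \<open>The walk of a wooded triangulation spells its moves\<close>

lemma iterates_until_eq:
  assumes s: "successively (\<lambda>d e. f d = e) (ds @ [y])" and y: "y \<notin> set ds"
  shows "iterates_until f (hd (ds @ [y])) y = ds"
proof -
  let ?l = "ds @ [y]"
  have it: "(f ^^ i) (hd ?l) = ?l ! i" if "i \<le> length ds" for i
    using that
  proof (induction i)
    case 0
    then show ?case by (simp add: hd_conv_nth)
  next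
    case (Suc i)
    have "f (?l ! i) = ?l ! Suc i"
      using s Suc.prems by (simp add: successively_conv_nth)
    then show ?case using Suc by simp
  qed
  have "funpow_dist f (hd ?l) y = length ds"
    unfolding funpow_dist_def
  proof (rule Least_equality)
    show "(f ^^ length ds) (hd ?l) = y" using it[of "length ds"] by simp
    fix k assume k: "(f ^^ k) (hd ?l) = y"
    show "length ds \<le> k"
    proof (rule ccontr)
      assume "\<not> length ds \<le> k"
      then have "ds ! k = y" "k < length ds" using k it[of k] by (auto simp: nth_append)
      then show False using y by auto
    qed
  qed
  then show ?thesis
    unfolding iterates_until_def
    by (intro nth_equalityI) (auto simp: it nth_append)
qed

lemma successively_map_on:
  assumes "successively P (ds @ [y])" "\<And>d e. d \<in> set ds \<Longrightarrow> P d e \<Longrightarrow> Q (k d) (k e)"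
  shows "successively Q (map k ds @ [k y])"
  using assms
proof (induction ds)
  case (Cons d ds)
  then show ?case by (cases ds) (auto simp: successively_Cons)
qed simp

lemma count_list_edges:
  assumes "distinct ds" "v \<noteq> x"
  shows "count_list (map (\<lambda>(v, w). {v, w}) ds) {v, x} =
    (if (v, x) \<in> set ds then 1 else 0) + (if (x, v) \<in> set ds then 1 else 0)"
  using assms by (induction ds) (auto simp: doubleton_eq_iff)

text \<open>
  Among distinct darts an edge occurs at most twice, once in each direction.
\<close>

lemma walk_steps_second_visits:
  assumes "distinct ds" "\<forall>(v, x)\<in>set ds. v \<noteq> x"
  shows "[step_of (f (ds ! i)). i \<leftarrow> [0..<length ds],
      count_list (take i (map (\<lambda>(v, w). {v, w}) ds)) (map (\<lambda>(v, w). {v, w}) ds ! i) = 1]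
    = map step_of (second_visits f {} ds)"
  using assms
proof (induction ds rule: rev_induct)
  case (snoc d ds)
  let ?e = "\<lambda>(v, w). {v, w}"
  obtain v x where d: "d = (v, x)" by (cases d)
  have "count_list (map ?e ds) {v, x} = 1 \<longleftrightarrow> (x, v) \<in> set ds"
    using count_list_edges[of ds v x] snoc.prems by (auto simp: d)
  moreover have "[step_of (f ((ds @ [d]) ! i)). i \<leftarrow> [0..<length ds],
      count_list (take i (map ?e (ds @ [d]))) (map ?e (ds @ [d]) ! i) = 1]
    = [step_of (f (ds ! i)). i \<leftarrow> [0..<length ds], count_list (take i (map ?e ds)) (map ?e ds ! i) = 1]"
    by (intro arg_cong[where f = concat] map_cong) (auto simp: nth_append)
  ultimately show ?case
    using snoc by (simp add: second_visits_append d nth_append)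
qed simp

lemma second_visits_map:
  assumes "inj_on k V" "set ds \<union> A \<subseteq> V \<times> V" "\<And>v x. (v, x) \<in> set ds \<Longrightarrow> f' (k v, k x) = f (v, x)"
  shows "second_visits f' (map_prod k k ` A) (map (map_prod k k) ds) = second_visits f A ds"
  using assms(2,3)
proof (induction f A ds rule: second_visits.induct)
  case (2 f A v x ds)
  have "(k x, k v) \<in> map_prod k k ` A \<longleftrightarrow> (x, v) \<in> A"
    using 2(2) inj_onD[OF assms(1)] by (auto simp: map_prod_def) blast+
  moreover have "second_visits f' (map_prod k k ` insert (v, x) A) (map (map_prod k k) ds)
    = second_visits f (insert (v, x) A) ds"
    using 2 by auto
  ultimately show ?case using 2(3)[of v x] by simp
qed simp

lemma walk_of_eq: "walk_steps S = map step_of w \<Longrightarrow> walk_of S = walk_from (0, 0) w"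
  unfolding walk_from_sums[of "(0, 0)" w] by (simp add: walk_of_def flip: zero_prod_def del: upt_Suc)

lemma successively_turn:
  assumes cw: "cw M v = cycle_of_list l" and l: "l = x # xs @ [y]" and d: "distinct l"
  shows "successively (\<lambda>d e. turn M d = e) (map (Pair v) xs @ [(v, y)])"
    and "hd (map (Pair v) xs @ [(v, y)]) = turn M (v, x)"
proof -
  have c: "cw M v a = b" if "consec l a b" for a b
    unfolding cw using cycle_of_list_consec[OF d that] .
  have "turn M (v, a) = (v, b)" if "consec (xs @ [y]) a b" for a b
    using that c[of a b] by (simp add: turn_def l consec_Cons)
  then have "successively (\<lambda>d e. turn M d = e) (map (Pair v) (xs @ [y]))"
    unfolding successively_map by (simp only: successively_consec) blast
  then show "successively (\<lambda>d e. turn M d = e) (map (Pair v) xs @ [(v, y)])" by simp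
  show "hd (map (Pair v) xs @ [(v, y)]) = turn M (v, x)"
    using c[of x "hd (xs @ [y])"] by (cases xs) (auto simp: turn_def l consec_Cons)
qed

text \<open>
  The path is computed in the built map and carried over to \<open>S\<close> dart by dart, which at the same time
  shows that the walk is invariant under isomorphism.  The value of \<^const>\<open>edge_col\<close> at outer edges is
  arbitrary and differs between isomorphic maps, so it matters that the path stays within inner edges
  until it has arrived.
\<close>

lemma walk_of_wooded_iso:
  fixes S :: "'v wooded_map"
  assumes fits: "fits 0 0 ms" and iso: "wooded_iso h (wooded_of (run start ms)) S"
  shows "walk_of S = walk_from (0, 0) (word 0 ms)"
proof -
  define \<tau> where "\<tau> = run start ms"
  define M where "M = wooded_of \<tau>"
  have st: "length (stack start) - 1 = 0" "length (spine start) - 1 = 0" by (auto simp: start_def)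
  have fit: "completes start ms" using fits st by simp
  interpret closed \<tau> using building_run[OF building_start fit] by (simp add: \<tau>_def)
  let ?k = "map_prod h h"
  have inj: "inj_on h {..<fresh \<tau>}"
    and h_cw: "\<And>v x. (v, x) \<in> darts M \<Longrightarrow> cw S (h v) (h x) = h (cw M v x)"
    and h_corner: "\<And>c. corner S c = h (corner M c)"
    and h_arcs: "\<And>u v. u < fresh \<tau> \<Longrightarrow> v < fresh \<tau> \<Longrightarrow> (u, v) \<in> arcs M \<longleftrightarrow> (h u, h v) \<in> arcs S"
    and h_col: "\<And>u v. (u, v) \<in> arcs M \<Longrightarrow> col S (h u, h v) = col M (u, v)"
    using iso unfolding M_def \<tau>_def by (auto simp: wooded_iso_def bij_betw_def)
  have h_eq: "h x = h y \<longleftrightarrow> x = y" if "x < fresh \<tau>" "y < fresh \<tau>" for x y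
    using inj that by (auto simp: inj_on_def)
  have dart_less: "v < fresh \<tau> \<and> x < fresh \<tau> \<and> v \<noteq> x" if "(v, x) \<in> darts M" for v x
    using that rot_less rot_irrefl by (auto simp: M_def)
  have corner_less: "corner M c < fresh \<tau>" for c using r_ge by (cases c) (auto simp: M_def)
  have h_edge_col: "edge_col S (h v, h x) = edge_col M (v, x)"
    if "(v, x) \<in> darts M" "2 \<le> v \<and> v < r \<or> 2 \<le> x \<and> x < r" for v x
  proof -
    have l: "v < fresh \<tau>" "x < fresh \<tau>" using dart_less[OF that(1)] by auto
    have "x \<in> set (rot \<tau> v)" using that(1) unfolding M_def by simp
    then have vx: "v < fresh \<tau>" "x < fresh \<tau>" "x \<in> set (rot \<tau> v)" "v \<in> set (rot \<tau> x)"
      using rot_sym[OF l(1,2)] l by blast+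
    have "(v, x) \<in> arcs M \<longleftrightarrow> (x, v) \<notin> arcs M"
      using that(2) one_orientation[of v x] one_orientation[of x v] vx unfolding M_def by blast
    then show ?thesis
      using h_arcs[OF vx(1,2)] h_col[of v x] h_col[of x v] by (simp add: edge_col_def)
  qed
  have rots: "\<exists>xs. rot \<tau> 1 = r # xs @ [0]" "\<exists>xs. rot \<tau> r = 0 # xs @ [1]"
  proof -
    obtain gs where "rot \<tau> 1 = gs @ [0]" using rot_1 by auto
    then show "\<exists>xs. rot \<tau> 1 = r # xs @ [0]"
      using rot_ends(4) r_ge by (cases gs) auto
    show "\<exists>xs. rot \<tau> r = 0 # xs @ [1]" using rot_r(1) by auto
  qed
  then obtain gs rs where gs: "rot \<tau> 1 = r # gs @ [0]" and rs: "rot \<tau> r = 0 # rs @ [1]" by blast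
  have d1: "distinct (rot \<tau> 1)" and dr: "distinct (rot \<tau> r)" using distinct_rot r_ge by auto
  \<comment> \<open>The path around \<open>A\<^sub>g\<close>, along the blue tree and around \<open>A\<^sub>r\<close>.\<close>
  define P1 where "P1 = map (Pair (1 :: nat)) gs"
  define P2 where "P2 = contour \<tau> start ms"
  define P3 where "P3 = map (Pair r) rs"
  have rest: "map (Pair r) (tl (butlast (rot \<tau> r))) = P3" unfolding P3_def rs by (simp add: butlast_append)
  have c: "distinct P2" "set P2 \<inter> explored \<tau> start = {}"
    "\<And>v x. (v, x) \<in> set P2 \<Longrightarrow> (v, x) \<in> darts M \<and> (2 \<le> v \<and> v < r \<or> 2 \<le> x \<and> x < r) \<and> v \<noteq> 1 \<and> v \<noteq> r"
    "second_visits (edge_col M) (explored \<tau> start) (P2 @ P3) = word 0 ms"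
    using contour_second_visits[OF building_start fit] st rest
    by (auto simp: Let_def P2_def M_def simp flip: \<tau>_def)
  have gs_inner: "2 \<le> x \<and> x < r" if "x \<in> set gs" for x
  proof -
    have v: "1 < fresh \<tau>" using r_ge by simp
    have x: "x \<in> set (rot \<tau> 1)" using that unfolding gs by simp
    then have "x < fresh \<tau>" "x \<noteq> 1" using rot_less[OF v] rot_irrefl[OF v] by metis+
    moreover have "x \<noteq> 0 \<and> x \<noteq> r" using d1 that unfolding gs by (cases "x = 0"; cases "x = r") auto
    ultimately show ?thesis by linarith
  qed
  have rs_inner: "2 \<le> x \<and> x < r" if "x \<in> set rs" for x
  proof -
    have v: "r < fresh \<tau>" using r_ge by simp
    have x: "x \<in> set (rot \<tau> r)" using that unfolding rs by simp
    then have "x < fresh \<tau>" "x \<noteq> r" using rot_less[OF v] rot_irrefl[OF v] by metis+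
    moreover have "x \<noteq> 0 \<and> x \<noteq> 1" using dr that unfolding rs by (cases "x = 0"; cases "x = 1") auto
    ultimately show ?thesis by linarith
  qed
  have P1: "set P1 = explored \<tau> start"
    using gs_inner r_ge unfolding P1_def explored_def gs by (auto simp: start_def)
  define P where "P = P1 @ P2 @ P3"
  have inner: "(v, x) \<in> darts M \<and> (2 \<le> v \<and> v < r \<or> 2 \<le> x \<and> x < r)" if "(v, x) \<in> set P" for v x
  proof -
    have "y \<in> set (rot \<tau> 1)" if "y \<in> set gs" for y using that unfolding gs by simp
    then have "(1, y) \<in> darts M" if "y \<in> set gs" for y using that r_ge by (simp add: M_def)
    moreover have "y \<in> set (rot \<tau> r)" if "y \<in> set rs" for y using that unfolding rs by simp
    then have "(r, y) \<in> darts M" if "y \<in> set rs" for y using that r_ge by (simp add: M_def)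
    ultimately show ?thesis
      using that c(3) gs_inner rs_inner by (auto simp: P_def P1_def P3_def)
  qed
  have "distinct P"
  proof -
    have "distinct P1" "distinct P3"
      using d1 dr unfolding gs rs by (auto simp: P1_def P3_def distinct_map inj_on_def)
    moreover have "set P1 \<inter> set P2 = {}" using c(2) P1 by auto
    moreover have "set P1 \<inter> set P3 = {}" using r_ge by (auto simp: P1_def P3_def)
    moreover have "set P2 \<inter> set P3 = {}" using c(3) by (auto simp: P3_def)
    ultimately show ?thesis using c(1) by (auto simp: P_def)
  qed
  have word: "second_visits (edge_col M) {} P = word 0 ms"
  proof -
    have "second_visits (edge_col M) {} P1 = []"
      using gs_inner[of 1] by (intro second_visits_none) (auto simp: P1_def)
    then show ?thesis using c(4) P1 by (simp add: P_def second_visits_append)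
  qed
  have path: "exploration_path S = map ?k P"
  proof -
    have turns: "turn S (?k d) = ?k (turn M d)" if "d \<in> darts M" for d
      using that h_cw by (cases d) (simp add: turn_def)
    have explores: "explore S (?k d) = ?k (explore M d)" if "d \<in> set P" for d
    proof -
      obtain v x where d: "d = (v, x)" by (cases d)
      have vx: "(v, x) \<in> darts M" "2 \<le> v \<and> v < r \<or> 2 \<le> x \<and> x < r" using inner that d by auto
      from vx(1) have "(x, v) \<in> darts M"
        unfolding M_def by (rule rotation_system.sym_darts[OF rotation_system])
      then show ?thesis
        using h_cw vx h_edge_col[OF vx] by (simp add: explore_def d)
    qed
    have corner_out: "?k (corner M a, corner M a') \<notin> ?k ` set P" for a a'
    proof
      assume "?k (corner M a, corner M a') \<in> ?k ` set P"
      then obtain v x where vx: "(v, x) \<in> set P" "h v = h (corner M a)" "h x = h (corner M a')" by auto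
      have ne: "\<not> (2 \<le> corner M c \<and> corner M c < r)" for c by (cases c) (auto simp: M_def)
      have "v = corner M a" "x = corner M a'"
        using vx inner[OF vx(1)] dart_less[of v x] h_eq corner_less by auto
      then show False using inner[OF vx(1)] ne by blast
    qed
    have piece: "iterates_until F (?k (hd (Q @ [y]))) (?k y) = map ?k Q"
      if s: "successively (\<lambda>d e. E d = e) (Q @ [y])" and y: "y = (corner M a, corner M a')"
        and Q: "set Q \<subseteq> set P" and EF: "\<And>d. d \<in> set P \<Longrightarrow> F (?k d) = ?k (E d)" for E F Q y a a'
    proof -
      have "successively (\<lambda>d e. F d = e) (map ?k Q @ [?k y])"
        by (rule successively_map_on[OF s]) (use Q EF in auto)
      moreover have "?k y \<notin> set (map ?k Q)"
        unfolding set_map y using corner_out[of a a'] image_mono[OF Q, of ?k]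
        by (rule contra_subsetD[rotated])
      ultimately have "iterates_until F (hd (map ?k Q @ [?k y])) (?k y) = map ?k Q"
        by (rule iterates_until_eq)
      moreover have "hd (map ?k Q @ [?k y]) = ?k (hd (Q @ [y]))"
        by (cases Q) auto
      ultimately show ?thesis by simp
    qed
    have corners: "corner M Blue = 0" "corner M Green = 1" "corner M Red = r" by (auto simp: M_def)
    have cwM: "cw M v = cycle_of_list (rot \<tau> v)" for v by (simp add: M_def)
    have cd: "(corner M a, corner M a') \<in> darts M" if "a \<noteq> a'" for a a'
      using corner_darts[OF that] by (simp add: M_def)
    have turnP: "turn S (?k d) = ?k (turn M d)" if "d \<in> set P" for d
      using turns inner that by (cases d) auto
    have sub: "set P1 \<subseteq> set P" "set P2 \<subseteq> set P" "set P3 \<subseteq> set P" by (auto simp: P_def)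
    have ends: "(1, 0) = (corner M Green, corner M Blue)" "(0, r) = (corner M Blue, corner M Red)"
      "(r, 1) = (corner M Red, corner M Green)"
      by (simp_all add: corners)
    note t1 = successively_turn[OF cwM gs d1, folded P1_def]
      and t3 = successively_turn[OF cwM rs dr, folded P3_def]
    have t2: "hd (P2 @ [(0, r)]) = turn M (0, 1)" "successively (\<lambda>d e. explore M d = e) (P2 @ [(0, r)])"
    proof -
      have "hd (spine start) = 0" "hd (stack start) = 1" by (simp_all add: start_def)
      then show "hd (P2 @ [(0, r)]) = turn M (0, 1)"
        "successively (\<lambda>d e. explore M d = e) (P2 @ [(0, r)])"
        using contour_explores[OF building_start fit]
        unfolding Let_def \<tau>_def[symmetric] P2_def[symmetric] M_def[symmetric]
        by (simp_all add: turn_def cwM)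
    qed
    have 1: "iterates_until (turn S) (turn S (h 1, h r)) (h 1, h 0) = map ?k P1"
      using piece[OF t1(1) ends(1) sub(1), of "turn S", OF turnP] turns[OF cd[of Green Red]]
      unfolding t1(2) corners by simp
    have 2: "iterates_until (explore S) (turn S (h 0, h 1)) (h 0, h r) = map ?k P2"
      using piece[OF t2(2) ends(2) sub(2), of "explore S", OF explores] turns[OF cd[of Blue Green]]
      unfolding t2(1) corners by simp
    have 3: "iterates_until (turn S) (turn S (h r, h 0)) (h r, h 1) = map ?k P3"
      using piece[OF t3(1) ends(3) sub(3), of "turn S", OF turnP] turns[OF cd[of Red Blue]]
      unfolding t3(2) corners by simp
    show ?thesis
      unfolding exploration_path_def Let_def h_corner corners 1 2 3 by (simp add: P_def)
  qed
  have VV: "set P \<subseteq> {..<fresh \<tau>} \<times> {..<fresh \<tau>}" using inner dart_less by auto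
  have inj_k: "inj_on ?k (set P)"
    by (rule inj_on_subset[OF map_prod_inj_on[OF inj inj] VV])
  have "walk_steps S = map step_of (second_visits (edge_col S) {} (map ?k P))"
    unfolding walk_steps_def Let_def path
  proof (rule walk_steps_second_visits)
    show "distinct (map ?k P)" using \<open>distinct P\<close> inj_k by (simp add: distinct_map)
    have "h v \<noteq> h x" if "(v, x) \<in> set P" for v x
      using dart_less[of v x] inner[OF that] h_eq[of v x] by simp
    then show "\<forall>(v, x)\<in>set (map ?k P). v \<noteq> x" by force
  qed
  also have "second_visits (edge_col S) {} (map ?k P) = second_visits (edge_col M) {} P"
    using second_visits_map[OF inj, of P "{}" "edge_col S" "edge_col M"] VV h_edge_col inner by simp
  finally show ?thesis using walk_of_eq word by simp
qed

theorem theorem1p4: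
  fixes n :: nat
  assumes "n \<ge> 1"
  shows "(\<forall>S :: nat wooded_map. wooded_triangulation n S \<longrightarrow> walk_of S \<in> quadrant_walks n) \<and>
    (\<forall>S S'. (S, S') \<in> same_wooded n \<longrightarrow> walk_of S = walk_of S') \<and>
    bij_betw class_walk (wooded_triangulations n) (quadrant_walks n)"
proof -
  let ?T = "{S :: nat wooded_map. wooded_triangulation n S}"
  have code: "\<exists>ms h. fits 0 0 ms \<and> attachments ms = n \<and> wooded_iso h (wooded_of (run start ms)) S \<and>
      walk_of S = walk_from (0, 0) (word 0 ms)" if "S \<in> ?T" for S
  proof -
    interpret wooded n S using that by (simp add: wooded_def)
    show ?thesis using moves_exist walk_of_wooded_iso by metis
  qed
  have model: "wooded_of (run start ms) \<in> ?T \<and>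
      walk_of (wooded_of (run start ms)) = walk_from (0, 0) (word 0 ms)"
    if "fits 0 0 ms" "attachments ms = n" for ms
  proof -
    have "closed (run start ms)" "fresh (run start ms) = n + 3"
      using building_run[OF building_start, of ms] that by (simp_all add: start_def)
    then show ?thesis
      using closed.wooded_of_triangulation walk_of_wooded_iso[OF that(1) wooded_iso_refl] by fastforce
  qed
  have walks: "walk_from (0, 0) (word 0 ms) \<in> quadrant_walks n" if "fits 0 0 ms" "attachments ms = n" for ms
    using legal_word[OF that(1)] count_word that(2) unfolding quadrant_walks_legal by blast
  have in_walks: "walk_of S \<in> quadrant_walks n" if "S \<in> ?T" for S
    using code[OF that] walks by auto
  have same: "walk_of S = walk_of S'" if SS: "(S, S') \<in> same_wooded n" for S S'
  proof -
    obtain k where S: "S \<in> ?T" "S' \<in> ?T" "wooded_iso k S S'" using SS by (auto simp: same_wooded_def)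
    obtain ms h where ms: "fits 0 0 ms" "attachments ms = n" "wooded_iso h (wooded_of (run start ms)) S"
      "walk_of S = walk_from (0, 0) (word 0 ms)"
      using code[OF S(1)] by blast
    have wt: "wooded_triangulation n (wooded_of (run start ms))" using model[OF ms(1,2)] by simp
    have "wooded_iso (k \<circ> h) (wooded_of (run start ms)) S'"
      by (rule wooded_iso_trans[OF wooded_triangulationD(1,2)[OF wt] ms(3) S(3)])
    then show ?thesis unfolding ms(4) by (rule walk_of_wooded_iso[OF ms(1), symmetric])
  qed
  \<comment> \<open>Equal walks come from the same moves, and both triangulations are copies of what these build.\<close>
  have same_iff: "(S, S') \<in> same_wooded n" if S: "S \<in> ?T" "S' \<in> ?T" and w: "walk_of S = walk_of S'" for S S'
  proof -
    obtain ms h where ms: "fits 0 0 ms" "attachments ms = n" "wooded_iso h (wooded_of (run start ms)) S"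
      "walk_of S = walk_from (0, 0) (word 0 ms)"
      using code[OF S(1)] by blast
    obtain ms' h' where ms': "wooded_iso h' (wooded_of (run start ms')) S'"
      "walk_of S' = walk_from (0, 0) (word 0 ms')"
      using code[OF S(2)] by blast
    have "ms' = ms" using w ms(4) ms'(2) by (simp add: walk_from_inject word_inject)
    then have "(wooded_of (run start ms), S) \<in> same_wooded n" "(wooded_of (run start ms), S') \<in> same_wooded n"
      using model[OF ms(1,2)] S ms(3) ms'(1) by (auto simp: same_wooded_def)
    then show ?thesis
      using equiv_same_wooded[of n] by (meson equivE symD transD)
  qed
  have class_value: "class_walk (same_wooded n `` {S}) = walk_of S" if "S \<in> ?T" for S
  proof -
    have "S \<in> same_wooded n `` {S}" using that equiv_class_self[OF equiv_same_wooded] by blast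
    moreover have "walk_of S' = walk_of S" if "(S, S') \<in> same_wooded n" for S'
      using same[OF that] by simp
    ultimately have "walk_of ` (same_wooded n `` {S}) = {walk_of S}" by blast
    then show ?thesis by (simp add: class_walk_def)
  qed
  have "bij_betw class_walk (wooded_triangulations n) (quadrant_walks n)"
    unfolding bij_betw_def
  proof
    show "inj_on class_walk (wooded_triangulations n)"
    proof (rule inj_onI)
      fix C C' assume C: "C \<in> wooded_triangulations n" "C' \<in> wooded_triangulations n" "class_walk C = class_walk C'"
      obtain S S' where S: "S \<in> ?T" "C = same_wooded n `` {S}" "S' \<in> ?T" "C' = same_wooded n `` {S'}"
        using C(1,2) unfolding wooded_triangulations_def by (meson quotientE)
      then have "(S, S') \<in> same_wooded n" using same_iff class_value C(3) by metis
      then show "C = C'" using S equiv_class_eq[OF equiv_same_wooded] by blast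
    qed
    show "class_walk ` wooded_triangulations n = quadrant_walks n"
    proof
      show "class_walk ` wooded_triangulations n \<subseteq> quadrant_walks n"
      proof
        fix z assume "z \<in> class_walk ` wooded_triangulations n"
        then obtain S where "S \<in> ?T" "z = class_walk (same_wooded n `` {S})"
          unfolding wooded_triangulations_def by (auto elim!: quotientE)
        then show "z \<in> quadrant_walks n" using class_value in_walks by simp
      qed
      show "quadrant_walks n \<subseteq> class_walk ` wooded_triangulations n"
      proof
        fix z assume "z \<in> quadrant_walks n"
        then obtain w where w: "legal 0 0 w" "count_list w Green = n" "z = walk_from (0, 0) w"
          unfolding quadrant_walks_legal by blast
        obtain ms where ms: "fits 0 0 ms" "word 0 ms = w" using legal_is_word[OF w(1)] by blast
        then have a: "attachments ms = n" using w(2) count_word[of 0 ms] by simp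
        let ?S = "wooded_of (run start ms)"
        have "z = class_walk (same_wooded n `` {?S})" using class_value model[OF ms(1) a] w(3) ms(2) by simp
        moreover have "same_wooded n `` {?S} \<in> wooded_triangulations n"
          unfolding wooded_triangulations_def using model[OF ms(1) a] by (intro quotientI) blast
        ultimately show "z \<in> class_walk ` wooded_triangulations n" by blast
      qed
    qed
  qed
  then show ?thesis using in_walks same by auto
qed

end
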